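(* Let $\mathbf{P}\subset\mathbb{R}$ be a nonempty finite union of disjoint compact intervals with $\overline{\operatorname{int}\mathbf{P}}=\mathbf{P}$, and let $A\in C(\mathbf{P},\mathbb{R}^{n\times n})$, $B\in C(\mathbf{P},\mathbb{R}^{n\times m})$. The ensemble of linear systems $\Sigma=\{(A(\theta),B(\theta))\;|\;\theta\in\mathbf{P}\}$ is uniformly ensemble controllable if the following conditions are satisfied: (i) $(A(\theta),B(\theta))$ is reachable for all $\theta\in\mathbf{P}$. (ii) The input Hermite indices $K_1(\theta),\ldots,K_m(\theta)$ of $(A(\theta),B(\theta))$ are independent of $\theta\in\mathbf{P}$. (iii) For any pair of distinct parameters $\theta,\theta'\in\mathbf{P}$, $\theta\neq\theta'$, the spectra of $A(\theta)$ and $A(\theta')$ are disjoint: $\sigma(A(\theta))\cap\sigma(A(\theta'))=\emptyset$. (iv) For each $\theta\in\mathbf{P}$, the eigenvalues of $A(\theta)$ have algebraic multiplicity one.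
   Context: $\sigma(M)\subset\mathbb{C}$ is the set of real and complex eigenvalues of a square matrix $M$. A pair $(A,B)\in\mathbb{R}^{n\times n}\times\mathbb{R}^{n\times m}$ is reachable if $\operatorname{rank}(B\ AB\ \cdots\ A^{n-1}B)=n$. Hermite indices: for $(A,B)\in\mathbb{R}^{n\times n}\times\mathbb{R}^{n\times m}$ with $b_i$ the $i$th column of $B$, go from left to right through the columns of $(b_1\ Ab_1\ \cdots\ A^{n-1}b_1\ \cdots\ b_m\ Ab_m\ \cdots\ A^{n-1}b_m)$ and select each column that is linearly independent of the columns preceding it. The selected columns are $b_1,\ldots,A^{K_1-1}b_1,\ldots,b_m,\ldots,A^{K_m-1}b_m$ (with $K_i=0$ if $b_i$ is not selected), and $K_1,\ldots,K_m$ are the Hermite indices of $(A,B)$. The ensemble is uniformly ensemble controllable if for every $x^*\in C(\mathbf{P},\mathbb{R}^n)$ and every $\varepsilon>0$ there exist $T>0$ and a $\theta$-independent input $u$ such that $\sup_{\theta\in\mathbf{P}}\|\varphi(T,\theta,u)-x^*(\theta)\|<\varepsilon$. In continuous time, $u\in L^1([0,T],\mathbb{R}^m)$ and $\varphi(T,\theta,u)=\int_0^Te^{A(\theta)(T-s)}B(\theta)u(s)\,ds$ (the solution at time $T$ of $\dot x=A(\theta)x+B(\theta)u$, $x(0)=0$). In discrete time, $T$ is a positive integer, $u=(u_0,\ldots,u_{T-1})$ is a sequence in $\mathbb{R}^m$ and $\varphi(T,\theta,u)=\sum_{k=0}^{T-1}A(\theta)^kB(\theta)u_{T-1-k}$.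 The claim is asserted for each of the two notions. *)

theory Defs
  imports
    "HOL-Analysis.Analysis"
    "HOL-Computational_Algebra.Polynomial"
    "HOL-Library.Disjoint_Sets"
begin

section \<open>Powers and exponential of a square matrix\<close>

text \<open>On \<open>'a^'n^'n\<close> the operation \<open>(*)\<close> is componentwise, so neither \<open>(^)\<close> nor \<open>exp\<close>
  gives the matrix operations.\<close>

primrec matpow :: "'a::semiring_1^'n^'n \<Rightarrow> nat \<Rightarrow> 'a^'n^'n" where
  "matpow A 0 = mat 1"
| "matpow A (Suc k) = A ** matpow A k"

definition matexp :: "real^'n^'n \<Rightarrow> real^'n^'n" where
  "matexp A = (\<Sum>k. (1 / fact k) *\<^sub>R matpow A k)"

lemma matexp_sums: "(\<lambda>k. (1 / fact k) *\<^sub>R matpow A k) sums matexp A"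
  for A :: "real^'n^'n"
proof -
  define K where "K = onorm ((*v) A)"
  have K0: "0 \<le> K"
    unfolding K_def by (rule onorm_pos_le[OF matrix_vector_mul_bounded_linear])
  have bnd: "norm (matpow A k *v x) \<le> K ^ k * norm x" for k x
  proof (induction k)
    case 0
    then show ?case by simp
  next
    case (Suc k)
    have "norm (matpow A (Suc k) *v x) = norm (A *v (matpow A k *v x))"
      by (simp add: matrix_vector_mul_assoc)
    also have "\<dots> \<le> K * norm (matpow A k *v x)"
      unfolding K_def by (rule onorm[OF matrix_vector_mul_bounded_linear])
    also have "\<dots> \<le> K * (K ^ k * norm x)"
      using K0 Suc by (rule mult_left_mono[rotated])
    finally show ?case by (simp add: mult.assoc)
  qed
  have entry: "\<bar>matpow A k $ i $ j\<bar> \<le> K ^ k" for k i j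
  proof -
    have "\<bar>matpow A k $ i $ j\<bar> = \<bar>(matpow A k *v axis j 1) $ i\<bar>"
      by (simp add: matrix_vector_mult_basis column_def)
    also have "\<dots> \<le> norm (matpow A k *v axis j 1)"
      by (rule component_le_norm_cart)
    also have "\<dots> \<le> K ^ k * norm (axis j (1::real) :: real^'n)"
      by (rule bnd)
    finally show ?thesis by simp
  qed
  have "norm (matpow A k) \<le> real CARD('n) * (real CARD('n) * K ^ k)" for k
  proof -
    have "norm (matpow A k) \<le> (\<Sum>i\<in>UNIV. norm (matpow A k $ i))"
      by (subst norm_vec_def, rule L2_set_le_sum) simp
    also have "\<dots> \<le> (\<Sum>i\<in>(UNIV::'n set). \<Sum>j\<in>UNIV. \<bar>matpow A k $ i $ j\<bar>)"
      by (intro sum_mono norm_le_l1_cart)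
    also have "\<dots> \<le> (\<Sum>i\<in>(UNIV::'n set). \<Sum>j\<in>(UNIV::'n set). K ^ k)"
      by (intro sum_mono entry)
    finally show ?thesis by simp
  qed
  then have "norm ((1 / fact k) *\<^sub>R matpow A k)
      \<le> inverse (fact k) * (real CARD('n) * (real CARD('n) * K ^ k))" for k
    by (simp add: divide_inverse mult_left_mono)
  then have "norm ((1 / fact k) *\<^sub>R matpow A k)
      \<le> real CARD('n) * (real CARD('n) * (inverse (fact k) * K ^ k))" for k
    by (simp only: mult.left_commute)
  moreover have "summable (\<lambda>k. real CARD('n) * (real CARD('n) * (inverse (fact k) * K ^ k)))"
    by (rule summable_mult, rule summable_mult, rule summable_exp)
  ultimately have "summable (\<lambda>k. (1 / fact k) *\<^sub>R matpow A k)"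
    by (rule summable_comparison_test'[where N = 0, rotated])
  then show ?thesis
    unfolding matexp_def by (rule summable_sums)
qed

section \<open>Eigenvalues and algebraic multiplicities\<close>

definition complex_matrix :: "real^'n^'n \<Rightarrow> complex^'n^'n" where
  "complex_matrix A = (\<chi> i j. complex_of_real (A $ i $ j))"

definition spectrum :: "real^'n^'n \<Rightarrow> complex set" where
  "spectrum A = {l. \<exists>v. v \<noteq> 0 \<and> complex_matrix A *v v = l *s v}"

definition charpoly :: "'a::comm_ring_1^'n^'n \<Rightarrow> 'a poly" where
  "charpoly M = det (\<chi> i j. (if i = j then [:0, 1:] else 0) - [:M $ i $ j:])"

definition alg_mult :: "real^'n^'n \<Rightarrow> complex \<Rightarrow> nat" where
  "alg_mult A l = order l (charpoly (complex_matrix A))"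

section \<open>Reachability\<close>

text \<open>The \<open>n * m\<close> columns of \<open>(B, A B, \<dots>, A\<^sup>n\<^sup>-\<^sup>1 B)\<close> are indexed by \<open>'n \<times> 'm\<close>; the
  exponents \<open>0, \<dots>, n - 1\<close> are attached to the elements of \<open>'n\<close> by an arbitrary bijection, which
  permutes columns and so does not affect the rank (see \<open>reachable_iff_dim\<close>).\<close>

definition exponent :: "'n::finite \<Rightarrow> nat" where
  "exponent = (SOME f. bij_betw f UNIV {..<CARD('n)})"

definition reachability_matrix :: "real^'n^'n \<Rightarrow> real^'m^'n \<Rightarrow> real^('n \<times> 'm)^'n" where
  "reachability_matrix A B = (\<chi> i p. (matpow A (exponent (fst p)) ** B) $ i $ snd p)"

definition reachable :: "real^'n^'n \<Rightarrow> real^'m^'n \<Rightarrow> bool" where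
  "reachable A B \<longleftrightarrow> rank (reachability_matrix A B) = CARD('n)"

lemma range_exponent: "range (exponent :: 'n::finite \<Rightarrow> nat) = {..<CARD('n)}"
proof -
  have "\<exists>f :: 'n \<Rightarrow> nat. bij_betw f UNIV {..<CARD('n)}"
    by (metis ex_bij_betw_finite_nat finite_class.finite_UNIV atLeast0LessThan)
  then have "bij_betw (exponent :: 'n \<Rightarrow> nat) UNIV {..<CARD('n)}"
    unfolding exponent_def by (rule someI_ex)
  then show ?thesis by (simp add: bij_betw_def)
qed

lemma reachable_iff_dim:
  fixes A :: "real^'n^'n" and B :: "real^'m^'n"
  shows "reachable A B \<longleftrightarrow> dim (\<Union>k<CARD('n). columns (matpow A k ** B)) = CARD('n)"
proof -
  have col: "column (k, j) (reachability_matrix A B) = column j (matpow A (exponent k) ** B)" for k j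
    by (simp add: column_def reachability_matrix_def vec_eq_iff)
  have "columns (reachability_matrix A B)
      = (\<Union>k\<in>range (exponent :: 'n \<Rightarrow> nat). columns (matpow A k ** B))"
    by (auto simp: columns_def col)
  then show ?thesis
    by (simp add: reachable_def column_rank_def range_exponent)
qed

section \<open>Hermite indices\<close>

definition hermite_column :: "real^'n^'n \<Rightarrow> real^'m^'n \<Rightarrow> 'm \<Rightarrow> nat \<Rightarrow> real^'n" where
  "hermite_column A B i k = matpow A k *v column i B"

definition hermite_selected ::
    "real^'n^'n \<Rightarrow> real^('m::{finite,linorder})^'n \<Rightarrow> 'm \<Rightarrow> nat \<Rightarrow> bool" where
  "hermite_selected A B i k \<longleftrightarrow> k < CARD('n) \<and>
     hermite_column A B i k \<notin>
       span {hermite_column A B j l | j l. l < CARD('n) \<and> (j < i \<or> j = i \<and> l < k)}"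

definition hermite_index ::
    "real^'n^'n \<Rightarrow> real^('m::{finite,linorder})^'n \<Rightarrow> 'm \<Rightarrow> nat" where
  "hermite_index A B i = card {k. hermite_selected A B i k}"

section \<open>Uniform ensemble controllability\<close>

definition phi_continuous ::
    "real^'n^'n \<Rightarrow> real^'m^'n \<Rightarrow> (real \<Rightarrow> real^'m) \<Rightarrow> real \<Rightarrow> real^'n" where
  "phi_continuous A B u T = (LINT s:{0..T}|lebesgue. matexp ((T - s) *\<^sub>R A) *v (B *v u s))"

definition phi_discrete ::
    "real^'n^'n \<Rightarrow> real^'m^'n \<Rightarrow> (nat \<Rightarrow> real^'m) \<Rightarrow> nat \<Rightarrow> real^'n" where
  "phi_discrete A B u T = (\<Sum>k<T. matpow A k *v (B *v u (T - 1 - k)))"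

text \<open>The supremum is taken in \<open>ereal\<close>, so that it is meaningful without a boundedness
  side condition.\<close>

definition uniformly_ensemble_controllable_continuous ::
    "real set \<Rightarrow> (real \<Rightarrow> real^'n^'n) \<Rightarrow> (real \<Rightarrow> real^'m^'n) \<Rightarrow> bool" where
  "uniformly_ensemble_controllable_continuous P A B \<longleftrightarrow>
     (\<forall>x :: real \<Rightarrow> real^'n. continuous_on P x \<longrightarrow> (\<forall>\<epsilon>>0. \<exists>T>0. \<exists>u.
        u absolutely_integrable_on {0..T} \<and>
        (SUP \<theta>\<in>P. ereal (norm (phi_continuous (A \<theta>) (B \<theta>) u T - x \<theta>))) < ereal \<epsilon>))"

definition uniformly_ensemble_controllable_discrete ::
    "real set \<Rightarrow> (real \<Rightarrow> real^'n^'n) \<Rightarrow> (real \<Rightarrow> real^'m^'n) \<Rightarrow> bool" where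
  "uniformly_ensemble_controllable_discrete P A B \<longleftrightarrow>
     (\<forall>x :: real \<Rightarrow> real^'n. continuous_on P x \<longrightarrow> (\<forall>\<epsilon>>0. \<exists>T>0. \<exists>u.
        (SUP \<theta>\<in>P. ereal (norm (phi_discrete (A \<theta>) (B \<theta>) u T - x \<theta>))) < ereal \<epsilon>))"

end

theory Submission
  imports Defs "HOL-Complex_Analysis.Complex_Analysis"
    "HOL-Computational_Algebra.Fundamental_Theorem_Algebra"
begin

text \<open>
  The union \<open>K\<close> of the spectra is compact, and by the disjointness of the spectra the parameter is a
  continuous function on \<open>K\<close> with finite fibres, so \<open>K\<close> has empty interior. Since the eigenvalues are
  simple they move continuously and separately; hence continuous logarithms on \<open>K\<close> can be continued
  along the parameter, and by Borsuk's criterion \<open>K\<close> does not separate the plane. By Lavrentiev's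
  theorem every continuous function of the parameter is then a uniform limit of polynomials on \<open>K\<close>,
  which can be taken real because \<open>K\<close> is symmetric. As the spectra are uniformly separated, Lagrange
  interpolation turns this into: for continuous \<open>g\<close> there are real polynomials \<open>q\<close> with \<open>q(A(\<theta>))\<close>
  uniformly close to \<open>g(\<theta>)\<close> times the identity. By reachability every continuous target is a
  combination of the \<open>A\<^sup>k b\<^sub>j\<close> with continuous coefficients, hence a uniform limit of sums of
  \<open>q\<^sub>j(A) b\<^sub>j\<close>, and these are the states that can be reached (discrete time) or approximated
  (continuous time).

  Lavrentiev's theorem is reduced by Stone--Weierstrass to the function \<open>cnj\<close>, which is, up to a
  Cauchy integral over the boundary of a large square, the Cauchy transform of the area measure of
  that square. The square is divided into tiles of side \<open>d\<close>, and the Cauchy transform of each tile is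
  replaced by a multiple of a bounded function with the same leading term at infinity and with
  singularities off \<open>K\<close>. The total error is of order \<open>d log\<^sup>2 (1/d)\<close>.
\<close>

section \<open>Uniform polynomial approximation\<close>

text \<open>The eigenvalues move only continuously, so \<open>K\<close> may have positive area and
  approximation theorems for null sets do not apply: empty interior and connected complement have to
  suffice. Near every tile the complement of \<open>K\<close> contains a connected set of size
  comparable to \<open>d\<close>, and a branch of the root of (z - a)(z - b) defined off such a set
  gives a function of size 1/d that behaves like 1/(z - c). Matching this leading term is essential.
  The tiles have Cauchy transforms of size d^2/|z - c|, and over the roughly 1/d^2 tiles these add
  up to order one; after matching, the error per tile is of order d^3/(d^2 + |z - c|^2), and the sum
  tends to 0. Another obstacle is the passage from eigenvalues to matrices: smallness of a
  polynomial on the spectrum bounds the matrix only through the spectral projections, and the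
  uniform separation of the eigenvalues bounds these independently of the degree. For the
  logarithms, the new pieces of \<open>K\<close> added in a short step of the parameter are pairwise
  disjoint and each meets the old part in at most one point, so the constants 2 pi i k can be
  adjusted one piece at a time.\<close>

definition poly_approximable :: "complex set \<Rightarrow> (complex \<Rightarrow> complex) \<Rightarrow> bool" where
  "poly_approximable K f \<longleftrightarrow> (\<forall>e>0. \<exists>p. \<forall>z\<in>K. cmod (poly p z - f z) < e)"

lemma poly_approximable_poly: "poly_approximable K (poly p)"
  unfolding poly_approximable_def by (intro allI impI exI[of _ p]) auto

lemma poly_approximable_cong:
  assumes "poly_approximable K f" "\<And>z. z \<in> K \<Longrightarrow> g z = f z"
  shows "poly_approximable K g"
  using assms by (simp add: poly_approximable_def)

lemma poly_approximable_const [simp]: "poly_approximable K (\<lambda>z. c)"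
  by (rule poly_approximable_cong[OF poly_approximable_poly[of K "[:c:]"]]) simp

lemma poly_approximable_ident: "poly_approximable K (\<lambda>z. z)"
  by (rule poly_approximable_cong[OF poly_approximable_poly[of K "[:0, 1:]"]]) simp

lemma poly_approximable_add:
  assumes "poly_approximable K f" "poly_approximable K g"
  shows "poly_approximable K (\<lambda>z. f z + g z)"
  unfolding poly_approximable_def
proof (intro allI impI)
  fix e :: real assume "e > 0"
  then obtain p q where pq: "\<And>z. z \<in> K \<Longrightarrow> cmod (poly p z - f z) < e/2"
      "\<And>z. z \<in> K \<Longrightarrow> cmod (poly q z - g z) < e/2"
    using assms unfolding poly_approximable_def by (meson half_gt_zero)
  have "cmod (poly (p + q) z - (f z + g z)) < e" if "z \<in> K" for z
  proof -
    have "poly (p + q) z - (f z + g z) = (poly p z - f z) + (poly q z - g z)" by simp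
    then have "cmod (poly (p + q) z - (f z + g z)) \<le> cmod (poly p z - f z) + cmod (poly q z - g z)"
      using norm_triangle_ineq by metis
    then show ?thesis
      using pq[OF that] by linarith
  qed
  then show "\<exists>p. \<forall>z\<in>K. cmod (poly p z - (f z + g z)) < e" by blast
qed

lemma poly_approximable_limit:
  assumes "\<And>e. e > 0 \<Longrightarrow> \<exists>g. poly_approximable K g \<and> (\<forall>z\<in>K. cmod (g z - f z) < e)"
  shows "poly_approximable K f"
  unfolding poly_approximable_def
proof (intro allI impI)
  fix e :: real assume "e > 0"
  then obtain g where g: "poly_approximable K g" "\<And>z. z \<in> K \<Longrightarrow> cmod (g z - f z) < e/2"
    using assms[of "e/2"] by auto
  then obtain p where p: "\<And>z. z \<in> K \<Longrightarrow> cmod (poly p z - g z) < e/2"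
    using \<open>e > 0\<close> unfolding poly_approximable_def by (meson half_gt_zero)
  have "cmod (poly p z - f z) < e" if "z \<in> K" for z
    using norm_triangle_ineq[of "poly p z - g z" "g z - f z"] p[OF that] g(2)[OF that] by simp
  then show "\<exists>p. \<forall>z\<in>K. cmod (poly p z - f z) < e" by blast
qed

lemma poly_approximable_bounded:
  assumes "compact K" "poly_approximable K f"
  obtains M where "M > 0" "\<And>z. z \<in> K \<Longrightarrow> cmod (f z) \<le> M"
proof -
  obtain p where p: "\<And>z. z \<in> K \<Longrightarrow> cmod (poly p z - f z) < 1"
    using assms(2) unfolding poly_approximable_def by (meson zero_less_one)
  have "compact (poly p ` K)"
    by (intro compact_continuous_image assms continuous_intros)
  then obtain B where B: "B > 0" "\<And>z. z \<in> K \<Longrightarrow> cmod (poly p z) \<le> B"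
    by (auto simp: bounded_pos dest!: compact_imp_bounded)
  have "cmod (f z) \<le> B + 1" if "z \<in> K" for z
    using norm_triangle_ineq4[of "poly p z" "poly p z - f z"] p[OF that] B(2)[OF that] by simp
  with B show ?thesis by (intro that[of "B + 1"]) auto
qed

lemma poly_approximable_mult:
  assumes K: "compact K" and f: "poly_approximable K f" and g: "poly_approximable K g"
  shows "poly_approximable K (\<lambda>z. f z * g z)"
  unfolding poly_approximable_def
proof (intro allI impI)
  fix e :: real assume e: "e > 0"
  obtain M where M: "M > 0" "\<And>z. z \<in> K \<Longrightarrow> cmod (f z) \<le> M"
    using poly_approximable_bounded[OF K f] by blast
  obtain q where q: "\<And>z. z \<in> K \<Longrightarrow> cmod (poly q z - g z) < e / (2 * M)"
    using g e M unfolding poly_approximable_def by (meson divide_pos_pos mult_pos_pos zero_less_numeral)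
  \<comment> \<open>The polynomial \<open>q\<close> is fixed before \<open>p\<close>, since the
    accuracy demanded of \<open>p\<close> depends on the bound \<open>M'\<close> for
    \<open>q\<close> on \<open>K\<close>.\<close>
  obtain M' where M': "M' > 0" "\<And>z. z \<in> K \<Longrightarrow> cmod (poly q z) \<le> M'"
    using poly_approximable_bounded[OF K poly_approximable_poly] by blast
  obtain p where p: "\<And>z. z \<in> K \<Longrightarrow> cmod (poly p z - f z) < e / (2 * M')"
    using f e M' unfolding poly_approximable_def by (meson divide_pos_pos mult_pos_pos zero_less_numeral)
  have "cmod (poly (p * q) z - f z * g z) < e" if z: "z \<in> K" for z
  proof -
    have "poly (p * q) z - f z * g z = (poly p z - f z) * poly q z + f z * (poly q z - g z)"
      by (simp add: algebra_simps)
    also have "cmod \<dots> \<le> cmod (poly p z - f z) * cmod (poly q z) + cmod (f z) * cmod (poly q z - g z)"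
      by (metis norm_mult norm_triangle_ineq)
    also have "\<dots> \<le> cmod (poly p z - f z) * M' + M * cmod (poly q z - g z)"
      using M M' z by (intro add_mono mult_mono) auto
    also have "\<dots> < e/2 + e/2"
      using p[OF z] q[OF z] M(1) M'(1) by (intro add_strict_mono) (auto simp: field_simps)
    finally show ?thesis by simp
  qed
  then show "\<exists>p. \<forall>z\<in>K. cmod (poly p z - f z * g z) < e" by blast
qed

lemma poly_approximable_diff:
  assumes "compact K" "poly_approximable K f" "poly_approximable K g"
  shows "poly_approximable K (\<lambda>z. f z - g z)"
  using poly_approximable_add[OF assms(2) poly_approximable_mult[OF assms(1) poly_approximable_const[of _ "-1"] assms(3)]]
  by simp

lemma poly_approximable_sum:
  assumes "\<And>i. i \<in> A \<Longrightarrow> poly_approximable K (f i)"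
  shows "poly_approximable K (\<lambda>z. \<Sum>i\<in>A. f i z)"
  using assms by (induction A rule: infinite_finite_induct) (auto intro: poly_approximable_add)

lemma poly_approximable_power:
  assumes "compact K" "poly_approximable K f"
  shows "poly_approximable K (\<lambda>z. f z ^ n)"
  by (induction n) (auto intro: poly_approximable_mult assms)

section \<open>Power series in approximable functions, and Runge's pole pushing\<close>

lemma poly_approximable_compose_holomorphic:
  assumes K: "compact K" and h: "poly_approximable K h" and F: "F holomorphic_on ball 0 1"
    and le: "\<And>z. z \<in> K \<Longrightarrow> cmod (h z) \<le> 1/2"
  shows "poly_approximable K (\<lambda>z. F (h z))"
proof (rule poly_approximable_limit)
  fix e :: real assume e: "e > 0"
  define a where "a n = (deriv ^^ n) F 0 / fact n" for n
  have sums: "(\<lambda>n. a n * w ^ n) sums F w" if "w \<in> ball 0 1" for w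
    using holomorphic_power_series[OF F that] by (simp add: a_def)
  have "summable (\<lambda>n. norm (a n * (1/2) ^ n))"
  proof (rule powser_insidea)
    \<comment> \<open>The point 3/4 lies between the bound 1/2 for \<open>h\<close> and the radius
      1. Convergence there gives absolute convergence at 1/2, the majorant for the M-test.\<close>
    show "summable (\<lambda>n. a n * (3/4) ^ n)"
      using sums[of "3/4"] by (auto simp: sums_iff norm_divide)
  qed auto
  then have sm: "summable (\<lambda>n. cmod (a n) * (1/2) ^ n)"
    by (simp add: norm_mult norm_power norm_divide)
  have "uniform_limit K (\<lambda>n z. \<Sum>i<n. a i * h z ^ i) (\<lambda>z. \<Sum>i. a i * h z ^ i) sequentially"
  proof (rule Weierstrass_m_test[OF _ sm])
    fix n z assume "z \<in> K"
    then show "norm (a n * h z ^ n) \<le> cmod (a n) * (1/2) ^ n"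
      using le by (auto simp: norm_mult norm_power intro!: mult_left_mono power_mono)
  qed
  then obtain n where n: "\<And>z. z \<in> K \<Longrightarrow> dist (\<Sum>i<n. a i * h z ^ i) (\<Sum>i. a i * h z ^ i) < e"
    using e unfolding uniform_limit_iff eventually_sequentially by blast
  show "\<exists>g. poly_approximable K g \<and> (\<forall>z\<in>K. cmod (g z - F (h z)) < e)"
  proof (intro exI conjI ballI)
    show "poly_approximable K (\<lambda>z. \<Sum>i<n. a i * h z ^ i)"
      by (intro poly_approximable_sum poly_approximable_mult poly_approximable_power K h poly_approximable_const)
    fix z assume z: "z \<in> K"
    have "(\<Sum>i. a i * h z ^ i) = F (h z)"
      using sums[of "h z"] le[OF z] by (simp add: sums_iff)
    with n[OF z] show "cmod ((\<Sum>i<n. a i * h z ^ i) - F (h z)) < e"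
      by (simp add: dist_norm)
  qed
qed

text \<open>Geometric series: \<open>1 / (z - b)\<close> is \<open>1 / (z - a)\<close> times the
  value of \<open>1 / (1 - w)\<close> at \<open>w = (b - a) / (z - a)\<close>, and on
  \<open>K\<close> this \<open>w\<close> has modulus at most 1/2.\<close>

lemma poly_approximable_inverse_step:
  assumes K: "compact K" and a: "poly_approximable K (\<lambda>z. 1 / (z - a))"
    and aK: "a \<notin> K" and bK: "b \<notin> K" and le: "\<And>z. z \<in> K \<Longrightarrow> cmod (b - a) \<le> cmod (z - a) / 2"
  shows "poly_approximable K (\<lambda>z. 1 / (z - b))"
proof -
  have "poly_approximable K (\<lambda>z. (\<lambda>w. 1 / (1 - w)) ((b - a) * (1 / (z - a))))"
  proof (rule poly_approximable_compose_holomorphic[OF K, where F = "\<lambda>w. 1 / (1 - w)"])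
    show "poly_approximable K (\<lambda>z. (b - a) * (1 / (z - a)))"
      by (intro poly_approximable_mult K a poly_approximable_const)
    show "(\<lambda>w. 1 / (1 - w)) holomorphic_on ball 0 1"
      by (intro holomorphic_intros) auto
    show "cmod ((b - a) * (1 / (z - a))) \<le> 1/2" if "z \<in> K" for z
      using le[OF that] aK that by (auto simp: norm_mult norm_divide divide_simps)
  qed
  then have "poly_approximable K (\<lambda>z. (1 / (z - a)) * (1 / (1 - (b - a) * (1 / (z - a)))))"
    by (intro poly_approximable_mult K a)
  then show ?thesis
  proof (rule poly_approximable_cong)
    fix z assume "z \<in> K"
    then have "z - a \<noteq> 0" "z - b \<noteq> 0" using aK bK by auto
    then have "1 - (b - a) * (1 / (z - a)) = (z - b) / (z - a)" by (simp add: field_simps)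
    then show "1 / (z - b) = (1 / (z - a)) * (1 / (1 - (b - a) * (1 / (z - a))))"
      using \<open>z - a \<noteq> 0\<close> by simp
  qed
qed

text \<open>The estimate holds for any two points of the ball, because induction over a connected
  set must pass from every point of a neighbourhood to every other one.\<close>

lemma compact_Compl_ball_quarter:
  fixes K :: "complex set"
  assumes K: "compact K" and a: "a \<notin> K"
  obtains r where "r > 0" "ball a r \<subseteq> - K"
    "\<And>x y z. x \<in> ball a r \<Longrightarrow> y \<in> ball a r \<Longrightarrow> z \<in> K \<Longrightarrow> cmod (y - x) \<le> cmod (z - x) / 2"
proof -
  obtain d where d: "d > 0" "ball a d \<subseteq> - K"
    using a K by (metis ComplI compact_imp_closed open_Compl open_contains_ball)
  \<comment> \<open>Two points of the ball of radius d/8 are less than d/4 apart and more than 7d/8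
    away from \<open>K\<close>.\<close>
  show ?thesis
  proof (rule that[of "d/8"])
    show "cmod (y - x) \<le> cmod (z - x) / 2" if "x \<in> ball a (d/8)" "y \<in> ball a (d/8)" "z \<in> K" for x y z
    proof -
      have "dist a z \<ge> d" using d that by force
      moreover have "dist a x < d/8" "dist a y < d/8" using that by auto
      moreover have "dist a z \<le> dist a x + dist z x" "dist y x \<le> dist a y + dist a x"
        by (metis dist_commute dist_triangle, metis dist_commute dist_triangle)
      ultimately show ?thesis using d by (simp add: dist_norm)
    qed
  next
    have "ball a (d/8) \<subseteq> ball a d" using d by (intro subset_ball) auto
    then show "ball a (d/8) \<subseteq> - K" using d by blast
  qed (use d in auto)
qed

text \<open>The pole starts at distance 2R from the origin, where \<open>z / a\<close> has modulus
  at most 1/2 on \<open>K\<close> and a geometric series applies; it is then moved through the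
  connected complement in short steps.\<close>

lemma poly_approximable_inverse:
  assumes K: "compact K" and con: "connected (- K)" and b: "b \<notin> K"
  shows "poly_approximable K (\<lambda>z. 1 / (z - b))"
proof -
  obtain R where R: "R > 0" "\<And>z. z \<in> K \<Longrightarrow> cmod z \<le> R"
    using compact_imp_bounded[OF K] by (auto simp: bounded_pos)
  define a where "a = complex_of_real (2 * R)"
  have na: "cmod a = 2 * R" using R by (simp add: a_def del: of_real_mult)
  have aK: "a \<notin> K" using R na by force
  have "poly_approximable K (\<lambda>z. (\<lambda>w. 1 / (1 - w)) (z * (1 / a)))"
  proof (rule poly_approximable_compose_holomorphic[OF K, where F = "\<lambda>w. 1 / (1 - w)"])
    show "poly_approximable K (\<lambda>z. z * (1 / a))"
      by (intro poly_approximable_mult K poly_approximable_ident poly_approximable_const)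
    show "(\<lambda>w. 1 / (1 - w)) holomorphic_on ball 0 1"
      by (intro holomorphic_intros) auto
    show "cmod (z * (1 / a)) \<le> 1/2" if "z \<in> K" for z
      using R(2)[OF that] R(1) by (auto simp: norm_mult norm_divide field_simps na)
  qed
  then have "poly_approximable K (\<lambda>z. (- 1 / a) * (1 / (1 - z * (1 / a))))"
    by (intro poly_approximable_mult K poly_approximable_const)
  then have pa: "poly_approximable K (\<lambda>z. 1 / (z - a))"
  proof (rule poly_approximable_cong)
    fix z assume "z \<in> K"
    then have "z - a \<noteq> 0" "a \<noteq> 0" using aK na R by auto
    then show "1 / (z - a) = (- 1 / a) * (1 / (1 - z * (1 / a)))"
      by (simp add: field_simps)
  qed
  show ?thesis
  proof (rule connected_induction_simple[OF con, where P = "\<lambda>b. poly_approximable K (\<lambda>z. 1 / (z - b))"])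
    show "a \<in> - K" "b \<in> - K" using aK b by auto
    fix c assume "c \<in> - K"
    then obtain r where r: "r > 0" "ball c r \<subseteq> - K"
      "\<And>x y z. x \<in> ball c r \<Longrightarrow> y \<in> ball c r \<Longrightarrow> z \<in> K \<Longrightarrow> cmod (y - x) \<le> cmod (z - x) / 2"
      using compact_Compl_ball_quarter[OF K, of c] by auto
    show "\<exists>T. openin (top_of_set (- K)) T \<and> c \<in> T \<and> (\<forall>x\<in>T. \<forall>y\<in>T.
        poly_approximable K (\<lambda>z. 1 / (z - x)) \<longrightarrow> poly_approximable K (\<lambda>z. 1 / (z - y)))"
    proof (intro exI[of _ "ball c r"] conjI ballI impI)
      show "openin (top_of_set (- K)) (ball c r)"
        using r by (meson open_ball open_subset)
      show "poly_approximable K (\<lambda>z. 1 / (z - y))"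
        if "x \<in> ball c r" "y \<in> ball c r" "poly_approximable K (\<lambda>z. 1 / (z - x))" for x y
        using that r K by (intro poly_approximable_inverse_step[of K x y]) auto
    qed (use r in auto)
  qed (rule pa)
qed

section \<open>Square roots on the right half-plane and their continuation along a connected
  set\<close>

lemma csqrt_bounds_right_half_plane:
  assumes "Re p > 0"
  shows "Re (csqrt p) > 0" "\<bar>Im (csqrt p)\<bar> < Re (csqrt p)"
proof -
  have "(csqrt p)\<^sup>2 = p" by simp
  then have "Re ((csqrt p)\<^sup>2) > 0" using assms by (simp only:)
  then have "(Re (csqrt p))\<^sup>2 - (Im (csqrt p))\<^sup>2 > 0"
    by (simp only: power2_eq_square[of "csqrt p"] complex_mult power2_eq_square) simp
  then have "(Im (csqrt p))\<^sup>2 < (Re (csqrt p))\<^sup>2" by simp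
  then have "\<bar>Im (csqrt p)\<bar> < \<bar>Re (csqrt p)\<bar>" by (metis abs_le_square_iff not_le)
  then show "\<bar>Im (csqrt p)\<bar> < Re (csqrt p)" using Re_csqrt[of p] by simp
  then show "Re (csqrt p) > 0" by linarith
qed

text \<open>Both roots have an argument of modulus less than pi/4, so their product stays in the
  right half-plane and is again the principal root.\<close>

lemma csqrt_mult_right_half_plane:
  assumes "Re p > 0" "Re r > 0"
  shows "csqrt (p * r) = csqrt p * csqrt r"
proof (rule csqrt_unique)
  show "(csqrt p * csqrt r)\<^sup>2 = p * r" by (simp add: power_mult_distrib)
  have "\<bar>Im (csqrt p) * Im (csqrt r)\<bar> < Re (csqrt p) * Re (csqrt r)"
    unfolding abs_mult using csqrt_bounds_right_half_plane assms
    by (intro mult_strict_mono') auto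
  then have "Re (csqrt p * csqrt r) > 0"
    by (simp only: times_complex.simps complex.sel)
  then show "0 < Re (csqrt p * csqrt r) \<or> Re (csqrt p * csqrt r) = 0 \<and> 0 \<le> Im (csqrt p * csqrt r)"
    by blast
qed

lemma Re_pos_near_1: "cmod (p - 1) \<le> 1/2 \<Longrightarrow> Re p > 0"
  using abs_Re_le_cmod[of "p - 1"] by simp

text \<open>Moving the second end point from \<open>x\<close> to \<open>y\<close> multiplies
  \<open>S\<close> by the principal root of \<open>(z - y) / (z - x)\<close>, a number within 1/2 of
  1. The last conjunct pins down the sign far from \<open>a\<close>: there all quotients lie in the
  right half-plane, where principal roots multiply. The equation for the square alone would leave
  the sign open at each point.\<close>

lemma poly_approximable_sqrt_quotient:
  assumes K: "compact K" and conK: "connected (- K)" and C: "connected C" "C \<subseteq> - K" "C \<subseteq> cball a d"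
    and a: "a \<in> C" and b: "b \<in> C" and d: "d > 0"
  shows "\<exists>S. poly_approximable K S \<and> (\<forall>z\<in>K. (S z)\<^sup>2 = (z - b) / (z - a)) \<and>
    (\<forall>z\<in>K. cmod (z - a) > 4 * d \<longrightarrow> S z = csqrt ((z - b) / (z - a)))" (is "?P b")
proof (rule connected_induction_simple[OF C(1) a b, where P = ?P])
  have "a \<notin> K" using a C by auto
  then show "?P a" by (intro exI[of _ "\<lambda>_. 1"]) auto
next
  fix c assume c: "c \<in> C"
  then obtain r where r: "r > 0" "ball c r \<subseteq> - K"
      "\<And>x y z. x \<in> ball c r \<Longrightarrow> y \<in> ball c r \<Longrightarrow> z \<in> K \<Longrightarrow> cmod (y - x) \<le> cmod (z - x) / 2"
    using compact_Compl_ball_quarter[OF K, of c] C(2) by (metis ComplD subsetD)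
  show "\<exists>T. openin (top_of_set C) T \<and> c \<in> T \<and> (\<forall>x\<in>T. \<forall>y\<in>T. ?P x \<longrightarrow> ?P y)"
  proof (intro exI[of _ "C \<inter> ball c r"] conjI ballI impI)
    show "openin (top_of_set C) (C \<inter> ball c r)" by (simp add: openin_open_Int)
    fix x y assume x: "x \<in> C \<inter> ball c r" and y: "y \<in> C \<inter> ball c r" and "?P x"
    then obtain S where S: "poly_approximable K S" "\<And>z. z \<in> K \<Longrightarrow> (S z)\<^sup>2 = (z - x) / (z - a)"
      "\<And>z. z \<in> K \<Longrightarrow> cmod (z - a) > 4 * d \<Longrightarrow> S z = csqrt ((z - x) / (z - a))" by blast
    have ne: "z - x \<noteq> 0" "z - a \<noteq> 0" if "z \<in> K" for z using x a C that by auto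
    let ?h = "\<lambda>z. (x - y) * (1 / (z - x))"
    have h: "1 + ?h z = (z - y) / (z - x)" if "z \<in> K" for z using ne[OF that] by (simp add: field_simps)
    have hle: "cmod (?h z) \<le> 1/2" if "z \<in> K" for z
      using r(3)[of x y z] x y that ne[OF that]
      by (auto simp: norm_mult norm_divide norm_minus_commute field_simps)
    have "poly_approximable K (\<lambda>z. (\<lambda>w. csqrt (1 + w)) (?h z))"
    proof (rule poly_approximable_compose_holomorphic[OF K _ _ hle])
      show "poly_approximable K ?h"
        using x C by (intro poly_approximable_mult K poly_approximable_inverse conK poly_approximable_const) auto
      have "1 + w \<notin> \<real>\<^sub>\<le>\<^sub>0" if "cmod w < 1" for w
        using that abs_Re_le_cmod[of w] by (auto simp: complex_nonpos_Reals_iff)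
      then show "(\<lambda>w. csqrt (1 + w)) holomorphic_on ball 0 1"
        by (intro holomorphic_intros) auto
    qed
    then have 1: "poly_approximable K (\<lambda>z. S z * csqrt (1 + ?h z))"
      by (intro poly_approximable_mult K S(1))
    show "?P y"
    proof (intro exI[of _ "\<lambda>z. S z * csqrt (1 + ?h z)"] conjI ballI impI 1)
      fix z assume z: "z \<in> K"
      show "(S z * csqrt (1 + ?h z))\<^sup>2 = (z - y) / (z - a)"
        using S(2)[OF z] ne[OF z] h[OF z] by (simp add: power_mult_distrib)
      assume far: "4 * d < cmod (z - a)"
      have "cmod ((z - x) / (z - a) - 1) \<le> 1/2"
      proof -
        have "(z - x) / (z - a) - 1 = (a - x) / (z - a)" using ne[OF z] by (simp add: field_simps)
        moreover have "cmod (a - x) \<le> d" using x C by (auto simp: dist_norm)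
        ultimately show ?thesis using far d by (auto simp: norm_divide divide_simps)
      qed
      then have "csqrt ((z - x) / (z - a) * (1 + ?h z)) = S z * csqrt (1 + ?h z)"
        unfolding S(3)[OF z far] using hle[OF z]
        by (intro csqrt_mult_right_half_plane Re_pos_near_1) auto
      then show "S z * csqrt (1 + ?h z) = csqrt ((z - y) / (z - a))"
        using ne[OF z] h[OF z] by simp
    qed
  qed (use c r in auto)
qed

section \<open>A bounded substitute for the Cauchy kernel\<close>

text \<open>Empty interior puts a point \<open>a\<close> of the complement close to
  \<open>c\<close>. The complement is unbounded, open and connected, so a path in it leads from
  \<open>a\<close> out of the disc of radius \<open>d\<close>.\<close>

lemma Compl_connected_subset_of_diameter:
  fixes K :: "complex set"
  assumes K: "compact K" and int: "interior K = {}" and con: "connected (- K)" and d: "d > 0"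
  obtains a b C where "connected C" "C \<subseteq> - K" "C \<subseteq> cball a d" "a \<in> C" "b \<in> C"
    "cmod (a - c) < d" "cmod (b - a) = d"
proof -
  have "c \<in> closure (- K)" using int by (simp add: closure_complement)
  then obtain a where a: "a \<in> - K" "dist a c < d" using d by (auto simp: closure_approachable)
  have "\<not> - K \<subseteq> cball a d"
  proof
    assume "- K \<subseteq> cball a d"
    then have "bounded (- K \<union> K)"
      using bounded_subset[OF bounded_cball] compact_imp_bounded[OF K] unfolding bounded_Un by blast
    then show False using not_bounded_UNIV[where 'a = complex] by (simp add: Un_commute)
  qed
  then obtain e where e: "e \<in> - K" "e \<notin> cball a d" by blast
  have "path_connected (- K)"
    using con connected_open_path_connected K compact_imp_closed open_Compl by blast
  then obtain g where g: "path g" "path_image g \<subseteq> - K" "pathstart g = a" "pathfinish g = e"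
    using a e unfolding path_connected_def by blast
  \<comment> \<open>Stopping the path at the circle gives an end point at distance exactly
    \<open>d\<close>, so that \<open>(a - b)^2\<close> has modulus exactly \<open>d^2\<close> in the
    normalisation of the kernel.\<close>
  obtain h where h: "path h" "pathstart h = pathstart g" "path_image h \<subseteq> path_image g \<inter> cball a d"
      "pathfinish h \<in> frontier (cball a d)"
    by (rule exists_path_subpath_to_frontier_closed[of "cball a d" g]) (use g e d in auto)
  show ?thesis
  proof (rule that[of "path_image h" a "pathfinish h"])
    show "cmod (pathfinish h - a) = d" using h d by (simp add: dist_norm norm_minus_commute)
    show "cmod (a - c) < d" using a by (simp add: dist_norm)
    show "a \<in> path_image h" using h g pathstart_in_path_image[of h] by simp
  qed (use h g connected_path_image in auto)
qed

text \<open>If \<open>S\<^sup>2 = (z - b) / (z - a)\<close>, the function \<open>w = z - (a + b) / 2 - (z - a) S\<close> is an inverse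
  Joukowski map of the complement of a curve joining \<open>a\<close> to \<open>b\<close>: it is bounded and behaves like
  \<open>(a - b)\<^sup>2 / (8 z)\<close> at infinity.\<close>

lemma Cauchy_kernel_substitute:
  fixes K :: "complex set"
  assumes K: "compact K" and int: "interior K = {}" and con: "connected (- K)" and d: "d > 0"
  obtains Q where "poly_approximable K Q" "\<And>z. z \<in> K \<Longrightarrow> cmod (Q z) \<le> 76 / d"
    "\<And>z. z \<in> K \<Longrightarrow> cmod (z - c) > 5 * d \<Longrightarrow> cmod (Q z - 1 / (z - c)) \<le> 7 * d / (cmod (z - c))\<^sup>2"
proof -
  obtain a b C where C: "connected C" "C \<subseteq> - K" "C \<subseteq> cball a d" "a \<in> C" "b \<in> C"
    and ac: "cmod (a - c) < d" and ba: "cmod (b - a) = d"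
    using Compl_connected_subset_of_diameter[OF K int con d, of c] by metis
  obtain S where S: "poly_approximable K S" "\<And>z. z \<in> K \<Longrightarrow> (S z)\<^sup>2 = (z - b) / (z - a)"
    "\<And>z. z \<in> K \<Longrightarrow> cmod (z - a) > 4 * d \<Longrightarrow> S z = csqrt ((z - b) / (z - a))"
    using poly_approximable_sqrt_quotient[OF K con C d] by blast
  have ab0: "a - b \<noteq> 0" using ba d by auto
  \<comment> \<open>With \<open>u\<close> measured from the midpoint, the squares of
    \<open>u\<close> and \<open>s\<close> differ by a constant. The difference \<open>u - s\<close>
    decays like \<open>(a - b)^2 / (8 z)\<close>, whence the factor that makes the leading
    coefficient of \<open>Q\<close> equal to 1.\<close>
  define u s Q where "u z = z - (a + b) / 2" and "s z = (z - a) * S z"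
    and "Q z = (u z - s z) * (8 / (a - b)\<^sup>2)" for z
  have s2: "(s z)\<^sup>2 = (z - a) * (z - b)" if "z \<in> K" for z
  proof -
    have "z - a \<noteq> 0" using that C by auto
    then show ?thesis
      by (simp add: s_def power_mult_distrib S(2)[OF that]) (simp add: power2_eq_square)
  qed
  have us: "(u z - s z) * (u z + s z) = (a - b)\<^sup>2 / 4" if "z \<in> K" for z
  proof -
    note s2[OF that]
    moreover have "(u z - s z) * (u z + s z) = (u z)\<^sup>2 - (s z)\<^sup>2"
      by (simp add: power2_eq_square algebra_simps)
    ultimately have "(u z - s z) * (u z + s z) = (z - (a + b) / 2)\<^sup>2 - (z - a) * (z - b)"
      by (simp only: u_def)
    also have "\<dots> = (a - b)\<^sup>2 / 4"
    proof -
      define m where "m = (a + b) / 2"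
      have "2 * m = a + b" by (simp add: m_def del: distrib_left_numeral)
      then have "a = 2 * m - b" by (simp add: algebra_simps)
      show ?thesis
        unfolding m_def[symmetric] \<open>a = 2 * m - b\<close> by (simp add: power2_eq_square algebra_simps)
    qed
    finally show ?thesis .
  qed
  have uz: "z - a = u z + (b - a) / 2" for z by (simp add: u_def field_simps)
  have "cmod ((b - a) / 2) = d / 2" using ba by (simp add: norm_divide)
  then have u1: "cmod (z - a) \<le> cmod (u z) + d/2" "cmod (u z) \<le> cmod (z - a) + d/2" for z
    using norm_triangle_ineq[of "u z" "(b - a) / 2"] norm_triangle_ineq4[of "z - a" "(b - a) / 2"]
    unfolding uz[of z] by (simp_all only: \<open>cmod ((b - a) / 2) = d / 2\<close> add_diff_cancel_right')
  have far: "cmod (u z - s z) \<le> 3/2 * d" "Q z = 2 / (u z + s z)"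
    "cmod (u z + s z) \<ge> 11/8 * cmod (z - a)" if z: "z \<in> K" "cmod (z - a) > 4 * d" for z
  proof -
    have za: "z - a \<noteq> 0" using z d by auto
    \<comment> \<open>A nonnegative real part keeps \<open>S z\<close> away from -1, so it is
      \<open>S z - 1\<close> that is small. This selects the sign for which \<open>u - s\<close>,
      and not \<open>u + s\<close>, is the small factor.\<close>
    have Re: "Re (S z) \<ge> 0" using S(3)[OF z] Re_csqrt by simp
    have "1 \<le> Re (S z + 1)" using Re by simp
    then have S1: "1 \<le> cmod (S z + 1)" using complex_Re_le_cmod order_trans by blast
    have "(z - a) * ((S z - 1) * (S z + 1)) = a - b"
      using S(2)[OF z(1)] za by (simp add: algebra_simps power2_eq_square)
        (simp add: field_simps)
    then have "cmod (z - a) * (cmod (S z - 1) * cmod (S z + 1)) = d"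
      using ba by (metis norm_minus_commute norm_mult)
    moreover have "cmod (z - a) * (cmod (S z - 1) * 1) \<le> cmod (z - a) * (cmod (S z - 1) * cmod (S z + 1))"
      using S1 by (intro mult_left_mono) auto
    ultimately have "cmod ((z - a) * (S z - 1)) \<le> d" by (simp add: norm_mult)
    moreover have "s z - u z = (z - a) * (S z - 1) + (b - a) / 2"
      by (simp add: s_def u_def field_simps)
    ultimately have "cmod (s z - u z) \<le> d + d/2"
      using norm_triangle_ineq[of "(z - a) * (S z - 1)" "(b - a) / 2"] \<open>cmod ((b - a) / 2) = d / 2\<close> by simp
    then show 1: "cmod (u z - s z) \<le> 3/2 * d" by (simp add: norm_minus_commute)
    have "cmod (2 * u z) \<le> cmod (u z + s z) + cmod (u z - s z)"
      using norm_triangle_ineq[of "u z + s z" "u z - s z"] by simp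
    then have "2 * cmod (u z) \<le> cmod (u z + s z) + 3/2 * d" using 1 by (simp add: norm_mult)
    then show 2: "cmod (u z + s z) \<ge> 11/8 * cmod (z - a)" using u1(1)[of z] z d by linarith
    have "u z + s z \<noteq> 0" using 2 z d by auto
    then have "u z - s z = (a - b)\<^sup>2 / 4 / (u z + s z)"
      using us[OF z(1)] by (metis nonzero_mult_div_cancel_right)
    then have "Q z = (a - b)\<^sup>2 / 4 / (u z + s z) * (8 / (a - b)\<^sup>2)" by (simp only: Q_def)
    also have "\<dots> = 2 / (u z + s z)"
    proof -
      have "x / 4 / y * (8 / x) = 2 / y" if "x \<noteq> 0" "y \<noteq> 0" for x y :: complex
        using that by (simp add: field_simps)
      then show ?thesis using ab0 \<open>u z + s z \<noteq> 0\<close> by (metis power_not_zero)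
    qed
    finally show "Q z = 2 / (u z + s z)" .
  qed
  show ?thesis
  proof (rule that[of Q])
    show "poly_approximable K Q"
      unfolding Q_def u_def s_def
      by (intro poly_approximable_mult poly_approximable_diff poly_approximable_const poly_approximable_ident K S)
    fix z assume z: "z \<in> K"
    show "cmod (Q z) \<le> 76 / d"
    proof (cases "cmod (z - a) > 4 * d")
      case True
      have "cmod (Q z) = 2 / cmod (u z + s z)" using far(2)[OF z True] by (simp add: norm_divide)
      also have "\<dots> \<le> 2 / d" using far(3)[OF z True] True d by (intro frac_le) auto
      also have "\<dots> \<le> 76 / d" using d by (intro divide_right_mono) auto
      finally show ?thesis .
    next
      case False
      \<comment> \<open>Near \<open>a\<close> sizes suffice: \<open>s\<close> is at most 5d and
        \<open>u\<close> at most 9d/2, so \<open>u - s\<close> is at most 19d/2, and 8 * 19/2 =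
        76.\<close>
      have za: "z - a \<noteq> 0" using z C by auto
      have zb: "cmod (z - b) \<le> 5 * d"
        using norm_triangle_ineq4[of "z - a" "b - a"] False ba by simp
      have "(cmod (s z))\<^sup>2 = cmod (z - a) * cmod (z - b)"
        using s2[OF z] by (metis norm_mult norm_power)
      also have "\<dots> \<le> (4 * d) * (5 * d)" using False zb d by (intro mult_mono) auto
      also have "\<dots> \<le> (5 * d)\<^sup>2" using d by (simp add: power2_eq_square)
      finally have "cmod (s z) \<le> 5 * d" using d by (auto intro: power2_le_imp_le)
      moreover have "cmod (u z) \<le> 4 * d + d/2" using u1(2)[of z] False by simp
      ultimately have "cmod (u z - s z) \<le> 19/2 * d" using norm_triangle_ineq4[of "u z" "s z"] by simp
      then have "cmod (u z - s z) * (8 / d\<^sup>2) \<le> 19/2 * d * (8 / d\<^sup>2)" by (intro mult_right_mono) auto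
      moreover have "cmod (Q z) = cmod (u z - s z) * (8 / d\<^sup>2)"
        unfolding Q_def norm_mult norm_divide norm_power using ba by (simp add: norm_minus_commute)
      ultimately show ?thesis using d by (simp add: power2_eq_square)
    qed
    \<comment> \<open>As \<open>a\<close> is within \<open>d\<close> of \<open>c\<close>, the
      threshold 5d for \<open>c\<close> implies the threshold 4d for \<open>a\<close>. The
      comparison with \<open>1 / (z - c)\<close> passes through \<open>1 / u z\<close>.\<close>
    assume zc: "cmod (z - c) > 5 * d"
    define r where "r = cmod (z - a)"
    have rc: "cmod (z - c) \<le> r + d" "r \<le> cmod (z - c) + d"
      using norm_triangle_ineq[of "z - a" "a - c"] norm_triangle_ineq4[of "z - c" "a - c"] ac by (simp_all add: r_def)
    have r: "r > 4 * d" using zc rc by simp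
    have u: "cmod (u z) \<ge> 7/8 * r" using u1(1)[of z] r by (simp add: r_def)
    have us: "cmod (u z + s z) \<ge> 11/8 * r" using far(3)[OF z] r by (simp add: r_def)
    have cr: "cmod (z - c) \<ge> 3/4 * r" using rc r by simp
    have ne: "u z \<noteq> 0" "u z + s z \<noteq> 0" "z - c \<noteq> 0" using u us cr r d by auto
    have rpos: "r > 0" using r d by simp
    have "Q z - 1 / u z = (u z - s z) / (u z * (u z + s z))"
    proof -
      have "2 / y - 1 / x = (2 * x - y) / (x * y)" if "x \<noteq> 0" "y \<noteq> 0" for x y :: complex
        using that by (simp add: field_simps)
      from this[OF ne(1,2)] have "2 / (u z + s z) - 1 / u z = (2 * u z - (u z + s z)) / (u z * (u z + s z))" .
      moreover have "2 * u z - (u z + s z) = u z - s z" by simp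
      ultimately show ?thesis using far(2)[OF z] r by (simp only: r_def)
    qed
    then have "cmod (Q z - 1 / u z) = cmod (u z - s z) / (cmod (u z) * cmod (u z + s z))"
      by (simp add: norm_divide norm_mult)
    also have "\<dots> \<le> (3/2 * d) / (7/8 * r * (11/8 * r))"
      using far(1)[OF z] r u us rpos d by (intro frac_le mult_mono mult_pos_pos) (auto simp: r_def)
    finally have 1: "cmod (Q z - 1 / u z) \<le> (3/2 * d) / (7/8 * r * (11/8 * r))" .
    have "cmod (z - c - u z) \<le> 3/2 * d"
      using norm_triangle_ineq[of "a - c" "(b - a) / 2"] ac \<open>cmod ((b - a) / 2) = d / 2\<close>
      by (simp add: u_def field_simps)
    moreover have "1 / u z - 1 / (z - c) = (z - c - u z) / (u z * (z - c))"
      using ne by (simp add: divide_simps)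
    ultimately have "cmod (1 / u z - 1 / (z - c)) \<le> (3/2 * d) / (7/8 * r * (3/4 * r))"
      unfolding norm_divide norm_mult \<open>1 / u z - 1 / (z - c) = _\<close>
      using u cr rpos d by (intro frac_le mult_mono mult_pos_pos) auto
    \<comment> \<open>The coefficients of d/r^2 are 96/77 and 16/7, with sum below 4. Passing from
      \<open>r\<close> to the distance from \<open>c\<close> costs a factor 25/16, and 4 * 25/16 =
      25/4 is below 7.\<close>
    then have "cmod (Q z - 1 / (z - c)) \<le> (3/2 * d) / (7/8 * r * (11/8 * r)) + (3/2 * d) / (7/8 * r * (3/4 * r))"
      using 1 norm_triangle_ineq[of "Q z - 1 / u z" "1 / u z - 1 / (z - c)"] by simp
    also have "\<dots> \<le> 4 * d / r\<^sup>2" using rpos d by (simp add: power2_eq_square field_simps)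
    also have "\<dots> \<le> 4 * d / (4/5 * cmod (z - c))\<^sup>2"
      using rc zc rpos d by (intro divide_left_mono power_mono mult_pos_pos) auto
    also have "\<dots> \<le> 7 * d / (cmod (z - c))\<^sup>2"
    proof -
      have "4 * d / (4/5 * cmod (z - c))\<^sup>2 = 25/4 * (d / (cmod (z - c))\<^sup>2)" by (simp add: power2_eq_square)
      also have "\<dots> \<le> 7 * (d / (cmod (z - c))\<^sup>2)" using d by (intro mult_right_mono) auto
      finally show ?thesis by simp
    qed
    finally show "cmod (Q z - 1 / (z - c)) \<le> 7 * d / (cmod (z - c))\<^sup>2" .
  qed
qed

section \<open>Cauchy transforms of squares\<close>

text \<open>Along a segment \<open>cnj\<close> is affine, so the trapezoidal rule is exact. As
  \<open>cnj\<close> is not holomorphic, the antiderivative \<open>F\<close> is taken with respect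
  to the real parameter of the segment.\<close>

lemma contour_integral_linepath_cnj:
  "contour_integral (linepath a b) (\<lambda>w. cnj (w - c)) = (b - a) * (cnj (a - c) + cnj (b - c)) / 2"
proof -
  define F where "F w = (w * cnj (a - c) + w\<^sup>2 / 2 * cnj (b - a)) * (b - a)" for w
  have "((\<lambda>x. cnj (linepath a b x - c) * (b - a)) has_integral (F (of_real 1) - F (of_real 0))) {0..1}"
  proof (rule fundamental_theorem_of_calculus)
    fix x :: real assume "x \<in> {0..1}"
    have "(F has_field_derivative (cnj (a - c) + of_real x * cnj (b - a)) * (b - a)) (at (of_real x))"
      unfolding F_def by (auto intro!: derivative_eq_intros)
    then have "((\<lambda>x. F (of_real x)) has_vector_derivative (cnj (a - c) + of_real x * cnj (b - a)) * (b - a)) (at x within {0..1})"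
      by (rule has_vector_derivative_real_field)
    moreover have "cnj (linepath a b x - c) = cnj (a - c) + of_real x * cnj (b - a)"
      by (simp add: linepath_def scaleR_conv_of_real algebra_simps)
    ultimately show "((\<lambda>x. F (of_real x)) has_vector_derivative cnj (linepath a b x - c) * (b - a)) (at x within {0..1})"
      by (simp only:)
  qed simp
  then have "contour_integral (linepath a b) (\<lambda>w. cnj (w - c)) = F (of_real 1) - F (of_real 0)"
    by (intro contour_integral_unique) (simp add: has_contour_integral_linepath)
  also have "\<dots> = (b - a) * (cnj (a - c) + cnj (b - c)) / 2"
    by (simp add: F_def field_simps)
  finally show ?thesis .
qed

lemma contour_integral_linepath_subdivide:
  fixes a b :: complex
  assumes f: "continuous_on (closed_segment a b) f" and n: "n > 0"
  shows "(\<Sum>k<n. contour_integral (linepath (a + of_real (real k / real n) * (b - a))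
            (a + of_real (real (Suc k) / real n) * (b - a))) f) = contour_integral (linepath a b) f"
proof -
  define x where "x k = a + of_real (real k / real n) * (b - a)" for k
  have seg: "x k \<in> closed_segment a b" if "k \<le> n" for k
    using that n unfolding x_def closed_segment_def
    by (intro CollectI exI[of _ "real k / real n"]) (auto simp: scaleR_conv_of_real algebra_simps simp del: of_real_divide)
  have seg': "x k \<in> closed_segment a (x (Suc k))" for k
    unfolding closed_segment_def
  proof (intro CollectI exI[of _ "real k / real (Suc k)"] conjI)
    have "of_real (real k / real (Suc k)) * of_real (real (Suc k) / real n) = (of_real (real k / real n) :: complex)"
      unfolding of_real_mult[symmetric] by (simp del: of_nat_Suc)
    then show "x k = (1 - real k / real (Suc k)) *\<^sub>R a + (real k / real (Suc k)) *\<^sub>R x (Suc k)"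
      unfolding x_def scaleR_conv_of_real
      by (simp add: algebra_simps del: of_nat_Suc of_real_divide)
  qed auto
  have "(\<Sum>k<m. contour_integral (linepath (x k) (x (Suc k))) f) = contour_integral (linepath a (x m)) f"
    if "m \<le> n" for m using that
  proof (induction m)
    case 0
    have "x 0 = a" by (simp add: x_def)
    then show ?case by (simp only: lessThan_0 sum.empty contour_integral_trivial)
  next
    case (Suc m)
    have "closed_segment a (x (Suc m)) \<subseteq> closed_segment a b"
      using seg[OF Suc.prems] by (simp add: subset_closed_segment)
    then have "contour_integral (linepath a (x (Suc m))) f =
        contour_integral (linepath a (x m)) f + contour_integral (linepath (x m) (x (Suc m))) f"
      using seg' by (intro contour_integral_split_linepath continuous_on_subset[OF f])
    with Suc show ?case by simp
  qed
  from this[of n] n show ?thesis by (simp add: x_def)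
qed

lemma contour_integral_rectpath:
  assumes f: "continuous_on (path_image (rectpath a1 a3)) f"
    and a: "a2 = Complex (Re a3) (Im a1)" "a4 = Complex (Re a1) (Im a3)"
  shows "f contour_integrable_on rectpath a1 a3"
    and "contour_integral (rectpath a1 a3) f = contour_integral (linepath a1 a2) f +
      contour_integral (linepath a2 a3) f + contour_integral (linepath a3 a4) f + contour_integral (linepath a4 a1) f"
proof -
  have im: "path_image (rectpath a1 a3) = closed_segment a1 a2 \<union> closed_segment a2 a3 \<union>
      closed_segment a3 a4 \<union> closed_segment a4 a1"
    unfolding a by (auto simp: rectpath_def Let_def path_image_join)
  have int: "f contour_integrable_on linepath a1 a2" "f contour_integrable_on linepath a2 a3"
      "f contour_integrable_on linepath a3 a4" "f contour_integrable_on linepath a4 a1"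
    by (intro contour_integrable_continuous_linepath continuous_on_subset[OF f]; force simp: im)+
  have r: "rectpath a1 a3 = linepath a1 a2 +++ linepath a2 a3 +++ linepath a3 a4 +++ linepath a4 a1"
    unfolding a rectpath_def Let_def ..
  show "f contour_integrable_on rectpath a1 a3"
    unfolding r using int by (intro contour_integrable_joinI valid_path_join) auto
  show "contour_integral (rectpath a1 a3) f = contour_integral (linepath a1 a2) f +
      contour_integral (linepath a2 a3) f + contour_integral (linepath a3 a4) f + contour_integral (linepath a4 a1) f"
    unfolding r using int by (simp add: contour_integral_join contour_integrable_joinI valid_path_join)
qed

text \<open>By Green's formula, \<open>edge\<close> summed over the boundary of a square and divided by \<open>- 2 pi i\<close> is
  \<open>1/pi\<close> times the Cauchy transform of the area measure of the square. Its integrand has modulus 1.\<close>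

definition edge :: "complex \<Rightarrow> complex \<Rightarrow> complex \<Rightarrow> complex" where
  "edge a b z = contour_integral (linepath a b) (\<lambda>w. cnj (w - z) / (w - z))"

text \<open>Summed edge by edge rather than along \<open>rectpath\<close>, since grid lines may pass
  through points of \<open>K\<close> and the shared sides have to cancel for those points
  too.\<close>

definition tile :: "complex \<Rightarrow> complex \<Rightarrow> complex \<Rightarrow> complex" where
  "tile a1 a3 z = - (edge a1 (Complex (Re a3) (Im a1)) z + edge (Complex (Re a3) (Im a1)) a3 z +
     edge a3 (Complex (Re a1) (Im a3)) z + edge (Complex (Re a1) (Im a3)) a1 z) / (2 * of_real pi * \<i>)"

text \<open>No position of \<open>z\<close> is excluded: at \<open>w = z\<close> the integrand is 0
  by the convention for division, and a contour integral that does not exist has the value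
  0.\<close>

lemma norm_edge_le: "cmod (edge a b z) \<le> cmod (b - a)"
proof (cases "(\<lambda>w. cnj (w - z) / (w - z)) contour_integrable_on linepath a b")
  case True
  have "cmod (cnj (w - z) / (w - z)) \<le> 1" for w
    by (simp add: norm_divide flip: complex_cnj_diff)
  then show ?thesis
    using contour_integral_bound_linepath[OF True, of 1] by (simp add: edge_def)
qed (simp add: edge_def not_integrable_contour_integral)

lemma edge_reverse: "edge b a z = - edge a b z"
  using contour_integral_reversepath[of "linepath a b"] by (simp add: edge_def)

lemma tile_eq_rectpath:
  assumes "z \<notin> path_image (rectpath a1 a3)"
  shows "tile a1 a3 z = - contour_integral (rectpath a1 a3) (\<lambda>w. cnj (w - z) / (w - z)) / (2 * of_real pi * \<i>)"
proof -
  have "continuous_on (path_image (rectpath a1 a3)) (\<lambda>w. cnj (w - z) / (w - z))"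
    using assms by (intro continuous_intros) auto
  from contour_integral_rectpath(2)[OF this refl refl] show ?thesis
    by (simp add: tile_def edge_def)
qed

context
  fixes c :: complex and d :: real and a1 a3 :: complex
  assumes d: "d > 0"
    and a1: "a1 = c - Complex (d/2) (d/2)" and a3: "a3 = c + Complex (d/2) (d/2)"
begin

lemma cmod_diff_corners:
  "cmod (Complex (Re a3) (Im a1) - a1) = d" "cmod (a3 - Complex (Re a3) (Im a1)) = d"
  "cmod (Complex (Re a1) (Im a3) - a3) = d" "cmod (a1 - Complex (Re a1) (Im a3)) = d"
  using d by (simp_all add: a1 a3 cmod_def)

lemma norm_square_tile_le: "cmod (tile a1 a3 z) \<le> d"
proof -
  let ?a2 = "Complex (Re a3) (Im a1)" and ?a4 = "Complex (Re a1) (Im a3)"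
  have "cmod (edge a1 ?a2 z + edge ?a2 a3 z + edge a3 ?a4 z + edge ?a4 a1 z) \<le> d + d + d + d"
    using norm_edge_le[of _ _ z] cmod_diff_corners by (intro norm_triangle_mono) metis+
  moreover have "cmod (2 * of_real pi * \<i>) = 2 * pi" by (simp add: norm_mult)
  ultimately have "cmod (tile a1 a3 z) \<le> 4 * d / (2 * pi)"
    unfolding tile_def norm_divide norm_minus_cancel by (simp only:) (intro divide_right_mono, auto)
  also have "\<dots> \<le> d" using d pi_gt3 by (simp add: field_simps)
  finally show ?thesis .
qed

text \<open>Seen from afar a square acts like its area concentrated at the centre. The error left
  after this leading term is quadratic in the distance of \<open>w\<close> from
  \<open>c\<close>.\<close>

lemma square_tile_far:
  assumes z: "cmod (z - c) \<ge> 2 * d"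
  shows "cmod (tile a1 a3 z - of_real (d\<^sup>2 / pi) / (z - c)) \<le> 2 * d ^ 3 / (cmod (z - c))\<^sup>2"
proof -
  let ?P = "path_image (rectpath a1 a3)"
  let ?a2 = "Complex (Re a3) (Im a1)" and ?a4 = "Complex (Re a1) (Im a3)"
  have le: "Re a1 \<le> Re a3" "Im a1 \<le> Im a3" using d by (auto simp: a1 a3)
  have cb: "cmod (w - c) \<le> d" if "w \<in> cbox a1 a3" for w
  proof -
    have "Re c - d/2 \<le> Re w" "Re w \<le> Re c + d/2" "Im c - d/2 \<le> Im w" "Im w \<le> Im c + d/2"
      using that by (auto simp: a1 a3 in_cbox_complex_iff)
    then have "\<bar>Re (w - c)\<bar> \<le> d/2" "\<bar>Im (w - c)\<bar> \<le> d/2"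
      unfolding minus_complex.sel by linarith+
    then show ?thesis using cmod_le[of "w - c"] by linarith
  qed
  have wc: "cmod (w - c) \<le> d" if "w \<in> ?P" for w
    using path_image_rectpath_subset_cbox[OF le] that cb by blast
  have zc: "z - c \<noteq> 0" using z d by auto
  have wz: "cmod (w - z) \<ge> cmod (z - c) / 2" if "w \<in> ?P" for w
    using norm_triangle_ineq4[of "w - c" "w - z"] wc[OF that] z by simp
  have wz0: "w - z \<noteq> 0" if "w \<in> ?P" for w using wz[OF that] z d by auto
  have zP: "z \<notin> ?P" using wz0 by auto
  have zbox: "z \<notin> cbox a1 a3" using cb[of z] z d by auto
  let ?e = "\<lambda>w. cnj (w - c) * (w - c) / ((w - z) * (z - c))"
  have cont: "continuous_on ?P (\<lambda>w. cnj (w - c))" "continuous_on ?P ?e" "continuous_on ?P (\<lambda>w. 1 / (w - z))"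
    using wz0 zc by (auto intro!: continuous_intros)
  note int = contour_integral_rectpath(1)[OF cont(1) refl refl] contour_integral_rectpath(1)[OF cont(2) refl refl]
    contour_integral_rectpath(1)[OF cont(3) refl refl]
  \<comment> \<open>Here \<open>1/(w - z) = - 1/(z - c) + (w - c)/((w - z)(z - c))\<close> is
    inserted in the part containing \<open>cnj (w - c)\<close>. The part with
    \<open>cnj (z - c)\<close> is left alone and integrates to 0, because \<open>z\<close> is
    outside the square.\<close>
  have "contour_integral (rectpath a1 a3) (\<lambda>w. cnj (w - z) / (w - z)) =
      contour_integral (rectpath a1 a3) (\<lambda>w. (- 1 / (z - c)) * cnj (w - c) + ?e w + (- cnj (z - c)) * (1 / (w - z)))"
  proof (rule contour_integral_eq)
    fix w assume "w \<in> ?P"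
    then have "w - z \<noteq> 0" using wz0 by auto
    have "(X - Y) / p = (- 1 / q) * X + X * (p + q) / (p * q) + (- Y) * (1 / p)"
      if "p \<noteq> 0" "q \<noteq> 0" for p q X Y :: complex
      using that by (simp add: field_simps)
    from this[OF \<open>w - z \<noteq> 0\<close> zc, of "cnj (w - c)" "cnj (z - c)"]
    show "cnj (w - z) / (w - z) = (- 1 / (z - c)) * cnj (w - c) + ?e w + (- cnj (z - c)) * (1 / (w - z))"
      by simp
  qed
  also have "\<dots> = (- 1 / (z - c)) * contour_integral (rectpath a1 a3) (\<lambda>w. cnj (w - c)) +
      contour_integral (rectpath a1 a3) ?e + (- cnj (z - c)) * contour_integral (rectpath a1 a3) (\<lambda>w. 1 / (w - z))"
    using int by (simp only: contour_integral_add contour_integral_lmul contour_integrable_add contour_integrable_lmul)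
  also have "contour_integral (rectpath a1 a3) (\<lambda>w. 1 / (w - z)) = 0"
    using winding_number_rectpath_outside[OF le zbox] winding_number_valid_path[OF valid_path_rectpath zP] by simp
  \<comment> \<open>This is 2i times the area, as Green's formula predicts.\<close>
  also have "contour_integral (rectpath a1 a3) (\<lambda>w. cnj (w - c)) = 2 * \<i> * of_real (d\<^sup>2)"
    unfolding contour_integral_rectpath(2)[OF cont(1) refl refl] contour_integral_linepath_cnj
    by (simp add: a1 a3 complex_eq_iff power2_eq_square field_simps)
  finally have T: "tile a1 a3 z - of_real (d\<^sup>2 / pi) / (z - c) =
      - contour_integral (rectpath a1 a3) ?e / (2 * of_real pi * \<i>)"
  proof -
    assume I: "contour_integral (rectpath a1 a3) (\<lambda>w. cnj (w - z) / (w - z)) = - 1 / (z - c) * (2 * \<i> * of_real (d\<^sup>2)) +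
      contour_integral (rectpath a1 a3) ?e + - cnj (z - c) * 0"
    have "- (- 1 / y * (2 * \<i> * D) + E + C * 0) / (2 * p * \<i>) - D / p / y = - E / (2 * p * \<i>)"
      if "y \<noteq> 0" "p \<noteq> 0" for y p C D E :: complex
      using that by (simp add: field_simps)
    then show ?thesis unfolding tile_eq_rectpath[OF zP] I of_real_divide using zc by (simp only: of_real_eq_0_iff pi_neq_zero not_False_eq_True)
  qed
  have im: "closed_segment a1 ?a2 \<subseteq> ?P" "closed_segment ?a2 a3 \<subseteq> ?P" "closed_segment a3 ?a4 \<subseteq> ?P"
     "closed_segment ?a4 a1 \<subseteq> ?P"
    by (auto simp: rectpath_def Let_def path_image_join)
  define B where "B = d\<^sup>2 / (cmod (z - c) / 2 * cmod (z - c))"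
  have eB: "cmod (?e w) \<le> B" if "w \<in> ?P" for w
  proof -
    have "cmod (?e w) = cmod (w - c) * cmod (w - c) / (cmod (w - z) * cmod (z - c))"
      by (simp add: norm_divide norm_mult flip: complex_cnj_diff)
    also have "\<dots> \<le> (d * d) / (cmod (z - c) / 2 * cmod (z - c))"
      using wc[OF that] wz[OF that] zc d by (intro frac_le mult_mono mult_pos_pos) auto
    finally show ?thesis by (simp add: B_def power2_eq_square)
  qed
  have B0: "B \<ge> 0" by (simp add: B_def)
  have ci: "cmod (contour_integral (linepath p q) ?e) \<le> B * cmod (q - p)" if "closed_segment p q \<subseteq> ?P" for p q
    using that eB B0 by (intro contour_integral_bound_linepath contour_integrable_continuous_linepath
      continuous_on_subset[OF cont(2)]) auto
  have "cmod (contour_integral (rectpath a1 a3) ?e) \<le> B * d + B * d + B * d + B * d"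
    unfolding contour_integral_rectpath(2)[OF cont(2) refl refl]
    using ci[OF im(1)] ci[OF im(2)] ci[OF im(3)] ci[OF im(4)]
    unfolding cmod_diff_corners by (intro norm_triangle_mono)
  then have "cmod (contour_integral (rectpath a1 a3) ?e) / (2 * pi) \<le> 4 * B * d / (2 * pi)"
    by (intro divide_right_mono) auto
  moreover have "cmod (2 * of_real pi * \<i>) = 2 * pi" by (simp add: norm_mult)
  ultimately have "cmod (tile a1 a3 z - of_real (d\<^sup>2 / pi) / (z - c)) \<le> 4 * B * d / (2 * pi)"
    unfolding T norm_divide norm_minus_cancel by (simp only:)
  also have "\<dots> \<le> B * d" using B0 d pi_gt3 by (simp add: field_simps mult_mono)
  also have "\<dots> = 2 * d ^ 3 / (cmod (z - c))\<^sup>2" by (simp add: B_def power2_eq_square power3_eq_cube)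
  finally show ?thesis .
qed

text \<open>Scaled by \<open>d\<^sup>2 / pi\<close>, the substitute kernel has the same leading term
  as the tile, so their difference decays quadratically; close to the tile both are of order
  \<open>d\<close>. The denominator covers both ranges at once.\<close>

lemma square_tile_approx:
  fixes K :: "complex set"
  assumes K: "compact K" and int: "interior K = {}" and con: "connected (- K)"
  shows "\<exists>Q. poly_approximable K Q \<and>
    (\<forall>z\<in>K. cmod (Q z - tile a1 a3 z) \<le> 702 * d ^ 3 / (d\<^sup>2 + (cmod (z - c))\<^sup>2))"
proof -
  obtain Q where Q: "poly_approximable K Q" "\<And>z. z \<in> K \<Longrightarrow> cmod (Q z) \<le> 76 / d"
    "\<And>z. z \<in> K \<Longrightarrow> cmod (z - c) > 5 * d \<Longrightarrow> cmod (Q z - 1 / (z - c)) \<le> 7 * d / (cmod (z - c))\<^sup>2"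
    using Cauchy_kernel_substitute[OF K int con d, of c] by metis
  show ?thesis
  proof (intro exI[of _ "\<lambda>z. of_real (d\<^sup>2 / pi) * Q z"] conjI ballI)
    show "poly_approximable K (\<lambda>z. of_real (d\<^sup>2 / pi) * Q z)"
      by (intro poly_approximable_mult K Q poly_approximable_const)
    fix z assume z: "z \<in> K"
    have p3: "1 / pi \<le> 1 / 3" using pi_gt3 by (intro divide_left_mono) auto
    have np: "cmod (of_real (d\<^sup>2 / pi) * x) \<le> d\<^sup>2 / 3 * cmod x" for x
      using p3 mult_right_mono[of "1/pi" "1/3" "d\<^sup>2 * cmod x"]
      by (simp add: norm_mult norm_divide norm_power field_simps)
    have pos: "d\<^sup>2 + (cmod (z - c))\<^sup>2 > 0" using d by (simp add: add_pos_nonneg)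
    show "cmod (of_real (d\<^sup>2 / pi) * Q z - tile a1 a3 z) \<le> 702 * d ^ 3 / (d\<^sup>2 + (cmod (z - c))\<^sup>2)"
    proof (cases "cmod (z - c) > 5 * d")
      case True
      define t where "t = (cmod (z - c))\<^sup>2"
      have "(5 * d)\<^sup>2 \<le> t" unfolding t_def using True d by (intro power_mono) auto
      then have t: "25 * d\<^sup>2 \<le> t" by (simp add: power_mult_distrib)
      have t0: "t > 0" using t d by (smt (verit) zero_less_power)
      have "cmod (of_real (d\<^sup>2 / pi) * (Q z - 1 / (z - c))) \<le> d\<^sup>2 / 3 * (7 * d / t)"
        using order_trans[OF np mult_left_mono[OF Q(3)[OF z True]]] by (simp add: t_def)
      moreover have "cmod (tile a1 a3 z - of_real (d\<^sup>2 / pi) / (z - c)) \<le> 2 * d ^ 3 / t"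
        using square_tile_far[of z] True d by (simp add: t_def)
      moreover have "of_real (d\<^sup>2 / pi) * Q z - tile a1 a3 z =
          of_real (d\<^sup>2 / pi) * (Q z - 1 / (z - c)) - (tile a1 a3 z - of_real (d\<^sup>2 / pi) / (z - c))"
      proof -
        have "k * q - t = k * (q - 1 / y) - (t - k / y)" for k q t y :: complex by (simp add: algebra_simps)
        then show ?thesis .
      qed
      ultimately have "cmod (of_real (d\<^sup>2 / pi) * Q z - tile a1 a3 z) \<le> d\<^sup>2 / 3 * (7 * d / t) + 2 * d ^ 3 / t"
        using norm_triangle_ineq4 by (smt (verit))
      also have "\<dots> \<le> 5 * d ^ 3 / t" using t0 d by (simp add: field_simps power2_eq_square power3_eq_cube)
      also have "\<dots> = 10 * d ^ 3 / (t + t)" by simp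
      also have "\<dots> \<le> 10 * d ^ 3 / (d\<^sup>2 + t)" using t t0 d
        by (intro divide_left_mono mult_pos_pos add_pos_nonneg) (auto intro: order_trans[of _ "25 * d\<^sup>2"])
      also have "\<dots> \<le> 702 * d ^ 3 / (d\<^sup>2 + t)" using t0 d by (intro divide_right_mono) auto
      finally show ?thesis by (simp add: t_def)
    next
      case False
      \<comment> \<open>In this range the error is at most 27d. Since
        \<open>d\<^sup>2 + (5 * d)\<^sup>2\<close> is 26 times \<open>d\<^sup>2\<close>, the
        constant is 27 * 26 = 702.\<close>
      have "cmod (of_real (d\<^sup>2 / pi) * Q z) \<le> d\<^sup>2 / 3 * (76 / d)"
        using order_trans[OF np mult_left_mono[OF Q(2)[OF z]]] by simp
      also have "\<dots> = 76 / 3 * d" using d by (simp add: power2_eq_square)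
      finally have "cmod (of_real (d\<^sup>2 / pi) * Q z - tile a1 a3 z) \<le> 76 / 3 * d + d"
        using norm_square_tile_le[of z] norm_triangle_ineq4[of "of_real (d\<^sup>2 / pi) * Q z" "tile a1 a3 z"] by simp
      also have "\<dots> \<le> 27 * d" using d by simp
      also have "\<dots> = 702 * d ^ 3 / (d\<^sup>2 + (5 * d)\<^sup>2)" using d by (simp add: power2_eq_square power3_eq_cube)
      also have "\<dots> \<le> 702 * d ^ 3 / (d\<^sup>2 + (cmod (z - c))\<^sup>2)"
        using False d pos by (intro divide_left_mono add_mono power_mono mult_pos_pos) (auto intro: add_pos_nonneg)
      finally show ?thesis .
    qed
  qed
qed

end

section \<open>Lavrentiev's theorem\<close>

text \<open>On each side of \<open>\<xi>\<close> the distances to the integers are at least 0, 1, 2,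
  ..., so each side contributes at most \<open>harm N\<close>. The truncations \<open>nat\<close>
  and \<open>min\<close> take care of a \<open>\<xi>\<close> outside the range of summation.\<close>

lemma sum_inverse_dist_le_harm:
  fixes \<xi> :: real
  shows "(\<Sum>p<N. 1 / (1 + \<bar>\<xi> - real p\<bar>)) \<le> 2 * harm N"
proof -
  define m where "m = nat \<lceil>\<xi>\<rceil>"
  define M where "M = min m N"
  have h: "(\<Sum>k<n. 1 / (1 + real k)) \<le> harm N" if "n \<le> N" for n
  proof -
    have "(\<Sum>k<n. 1 / (1 + real k)) = harm n"
      by (induction n) (auto simp: harm_Suc harm_expand divide_inverse)
    also have "\<dots> \<le> harm N" by (rule harm_mono[OF that])
    finally show ?thesis .
  qed
  have "(\<Sum>p<N. 1 / (1 + \<bar>\<xi> - real p\<bar>)) =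
      (\<Sum>p<M. 1 / (1 + \<bar>\<xi> - real p\<bar>)) + (\<Sum>p=M..<N. 1 / (1 + \<bar>\<xi> - real p\<bar>))"
    unfolding lessThan_atLeast0 by (rule sum.atLeastLessThan_concat[symmetric]) (auto simp: M_def)
  also have "(\<Sum>p<M. 1 / (1 + \<bar>\<xi> - real p\<bar>)) \<le> (\<Sum>p<M. 1 / (1 + real (M - Suc p)))"
  proof (rule sum_mono)
    fix p assume p: "p \<in> {..<M}"
    then have "real m - 1 < \<xi>" unfolding m_def M_def by (simp add: min_def split: if_splits) linarith+
    then have "real (M - Suc p) \<le> \<bar>\<xi> - real p\<bar>" using p by (auto simp: M_def min_def of_nat_diff split: if_splits)
    then show "1 / (1 + \<bar>\<xi> - real p\<bar>) \<le> 1 / (1 + real (M - Suc p))" by (intro divide_left_mono) auto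
  qed
  also have "\<dots> = (\<Sum>k<M. 1 / (1 + real k))" by (rule sum.nat_diff_reindex)
  also have "\<dots> \<le> harm N" by (rule h) (simp add: M_def)
  also have "(\<Sum>p=M..<N. 1 / (1 + \<bar>\<xi> - real p\<bar>)) \<le> (\<Sum>p=M..<N. 1 / (1 + real (p - M)))"
  proof (rule sum_mono)
    fix p assume p: "p \<in> {M..<N}"
    then have "\<xi> \<le> real M" unfolding m_def M_def by (simp add: min_def split: if_splits) linarith+
    then have "real (p - M) \<le> \<bar>\<xi> - real p\<bar>" using p by (auto simp: of_nat_diff)
    then show "1 / (1 + \<bar>\<xi> - real p\<bar>) \<le> 1 / (1 + real (p - M))" by (intro divide_left_mono) auto
  qed
  also have "\<dots> = (\<Sum>k<N - M. 1 / (1 + real k))"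
    by (rule sum.reindex_bij_witness[of _ "\<lambda>k. k + M" "\<lambda>p. p - M"]) auto
  also have "\<dots> \<le> harm N" by (rule h) simp
  finally show ?thesis by simp
qed

text \<open>\<open>harm n - ln n\<close> converges, so \<open>harm n\<close> grows more slowly than
  \<open>sqrt n\<close>; the claim is the square of this.\<close>

lemma harm_squared_div_tendsto_0: "(\<lambda>n. (harm n)\<^sup>2 / real n) \<longlonglongrightarrow> 0"
proof -
  have "(\<lambda>n. 1 / sqrt (real n)) \<longlonglongrightarrow> 0" "(\<lambda>n. ln (real n) / sqrt (real n)) \<longlonglongrightarrow> 0"
    using lim_1_over_real_power[of "1/2"] lim_ln_over_power[of "1/2"] by (simp_all add: powr_half_sqrt)
  then have "(\<lambda>n. (harm n - ln (real n)) * (1 / sqrt (real n)) + ln (real n) / sqrt (real n)) \<longlonglongrightarrow> euler_mascheroni * 0 + 0"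
    by (intro tendsto_intros euler_mascheroni_LIMSEQ)
  then have "(\<lambda>n. harm n / sqrt (real n)) \<longlonglongrightarrow> 0" by (simp add: diff_divide_distrib)
  from tendsto_power[OF this, of 2] show ?thesis by (simp only: power_divide real_sqrt_pow2 of_nat_0_le_iff power_zero_numeral)
qed

text \<open>Riemann sums of the integral are combinations of simple fractions with poles off
  \<open>K\<close>. They converge uniformly in \<open>z\<close>, because the kernel is uniformly
  continuous on the product of the segment with \<open>K\<close>.\<close>

lemma poly_approximable_Cauchy_integral:
  assumes K: "compact K" and con: "connected (- K)" and seg: "closed_segment a b \<inter> K = {}"
    and g: "continuous_on (closed_segment a b) g"
  shows "poly_approximable K (\<lambda>z. contour_integral (linepath a b) (\<lambda>w. g w / (w - z)))"
proof (rule poly_approximable_limit)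
  fix e :: real assume e: "e > 0"
  define e' where "e' = e / (2 * (1 + cmod (b - a)))"
  have e': "e' > 0" "e' * cmod (b - a) < e"
    using e by (auto simp: e'_def field_simps add_pos_nonneg)
  have ne: "w - z \<noteq> 0" if "w \<in> closed_segment a b" "z \<in> K" for w z using seg that by auto
  define F where "F = (\<lambda>(w, z). g w / (w - z))"
  have "uniformly_continuous_on (closed_segment a b \<times> K) F"
    unfolding F_def using ne by (intro compact_uniformly_continuous compact_Times K compact_segment)
      (auto simp: case_prod_beta' intro!: continuous_intros continuous_on_compose2[OF g])
  then have "\<exists>r>0. \<forall>p\<in>closed_segment a b \<times> K. \<forall>q\<in>closed_segment a b \<times> K. dist q p < r \<longrightarrow> dist (F q) (F p) < e'"
    using e'(1) unfolding uniformly_continuous_on_def by blast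
  then obtain r where r: "r > 0" "\<And>p q. p \<in> closed_segment a b \<times> K \<Longrightarrow> q \<in> closed_segment a b \<times> K \<Longrightarrow>
      dist q p < r \<Longrightarrow> dist (F q) (F p) < e'"
    by blast
  obtain n where n: "n > 0" "cmod (b - a) / real n < r"
  proof -
    obtain n where "real n > cmod (b - a) / r" using reals_Archimedean2 by blast
    moreover have "cmod (b - a) / r \<ge> 0" using r by simp
    ultimately have "real n > 0" "cmod (b - a) < real n * r"
      using r by (linarith, simp add: pos_divide_less_eq)
    then show ?thesis by (intro that[of n]) (simp_all add: pos_divide_less_eq mult.commute)
  qed
  define x where "x k = a + of_real (real k / real n) * (b - a)" for k
  have step: "x (Suc k) - x k = (b - a) / of_nat n" for k
    using n by (simp add: x_def field_simps)
  have xseg: "x k \<in> closed_segment a b" if "k \<le> n" for k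
    using that n unfolding x_def closed_segment_def
    by (intro CollectI exI[of _ "real k / real n"]) (auto simp: scaleR_conv_of_real algebra_simps simp del: of_real_divide)
  show "\<exists>h. poly_approximable K h \<and>
      (\<forall>z\<in>K. cmod (h z - contour_integral (linepath a b) (\<lambda>w. g w / (w - z))) < e)"
  proof (intro exI conjI ballI)
    show "poly_approximable K (\<lambda>z. \<Sum>k<n. ((b - a) / of_nat n * g (x k)) * ((-1) * (1 / (z - x k))))"
      using xseg seg by (intro poly_approximable_sum poly_approximable_mult poly_approximable_inverse
         poly_approximable_const K con) (auto simp: disjoint_iff)
    fix z assume z: "z \<in> K"
    let ?f = "\<lambda>w. g w / (w - z)"
    have f: "continuous_on (closed_segment a b) ?f"
      using ne z by (intro continuous_intros g) auto
    have piece: "cmod ((b - a) / of_nat n * g (x k) * ((-1) * (1 / (z - x k))) -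
        contour_integral (linepath (x k) (x (Suc k))) ?f) \<le> e' * cmod (b - a) / n" if k: "k < n" for k
    proof -
      have sub: "closed_segment (x k) (x (Suc k)) \<subseteq> closed_segment a b"
        using xseg k by (simp add: subset_closed_segment)
      have int: "?f contour_integrable_on linepath (x k) (x (Suc k))"
        by (intro contour_integrable_continuous_linepath continuous_on_subset[OF f] sub)
      have const: "(\<lambda>w. ?f (x k)) contour_integrable_on linepath (x k) (x (Suc k))"
        by (intro contour_integrable_continuous_linepath continuous_intros)
      have "cmod (contour_integral (linepath (x k) (x (Suc k))) (\<lambda>w. ?f w - ?f (x k))) \<le> e' * cmod (x (Suc k) - x k)"
      proof (rule contour_integral_bound_linepath)
        fix w assume w: "w \<in> closed_segment (x k) (x (Suc k))"
        have "dist w (x k) \<le> cmod (x (Suc k) - x k)"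
          using segment_bound(1)[OF w] by (simp add: dist_norm norm_minus_commute)
        also have "\<dots> < r" using n by (simp add: step norm_divide)
        finally have "dist (w, z) (x k, z) < r" by (simp add: dist_Pair_Pair)
        then have "dist (?f w) (?f (x k)) < e'"
          using r(2)[of "(x k, z)" "(w, z)"] w sub xseg[of k] k z by (auto simp: F_def)
        then show "cmod (?f w - ?f (x k)) \<le> e'" by (simp add: dist_norm)
      qed (use e' int const contour_integrable_diff in auto)
      also have "contour_integral (linepath (x k) (x (Suc k))) (\<lambda>w. ?f w - ?f (x k)) =
          contour_integral (linepath (x k) (x (Suc k))) ?f - ?f (x k) * (x (Suc k) - x k)"
        by (simp only: contour_integral_diff[OF int const] contour_integral_const_linepath mult.commute)
      finally have 1: "cmod (contour_integral (linepath (x k) (x (Suc k))) ?f - ?f (x k) * ((b - a) / of_nat n))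
          \<le> e' * cmod (b - a) / n"
        by (simp add: step norm_divide)
      have "(- 1) * (1 / (z - x k)) = 1 / (x k - z)" by (metis minus_diff_eq minus_divide_right mult_minus1)
      then have "(b - a) / of_nat n * g (x k) * ((-1) * (1 / (z - x k))) = ?f (x k) * ((b - a) / of_nat n)"
      proof -
        assume eq: "(- 1) * (1 / (z - x k)) = 1 / (x k - z)"
        have "u * y * (1 / v) = y / v * u" for u v y :: complex by (simp add: mult.commute)
        then show ?thesis unfolding eq .
      qed
      with 1 show ?thesis by (simp only: norm_minus_commute)
    qed
    have "cmod ((\<Sum>k<n. ((b - a) / of_nat n * g (x k)) * ((-1) * (1 / (z - x k)))) - contour_integral (linepath a b) ?f)
        = cmod (\<Sum>k<n. (b - a) / of_nat n * g (x k) * ((-1) * (1 / (z - x k))) -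
        contour_integral (linepath (x k) (x (Suc k))) ?f)"
      unfolding contour_integral_linepath_subdivide[OF f n(1), symmetric] x_def sum_subtractf ..
    also have "\<dots> \<le> (\<Sum>k<n. e' * cmod (b - a) / n)"
      by (intro sum_norm_le piece) auto
    also have "\<dots> < e" using e' n by simp
    finally show "cmod ((\<Sum>k<n. ((b - a) / of_nat n * g (x k)) * ((-1) * (1 / (z - x k)))) - contour_integral (linepath a b) ?f) < e" .
  qed
qed

text \<open>Each inner edge is traversed once in each direction, so the horizontal sums
  \<open>H\<close> and the vertical sums \<open>V\<close> telescope. Only the outer sides are
  reassembled from their pieces, and there \<open>z\<close> is off the segment.\<close>

lemma sum_tiles_eq_tile:
  assumes M: "M > 0" and N: "N > 0" and z: "\<bar>Re z\<bar> < M" "\<bar>Im z\<bar> < M"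
    and G: "\<And>p q. G p q = Complex (- M + 2 * M * real p / real N) (- M + 2 * M * real q / real N)"
  shows "(\<Sum>p<N. \<Sum>q<N. tile (G p q) (G (Suc p) (Suc q)) z) = tile (Complex (- M) (- M)) (Complex M M) z"
proof -
  define H V where "H p q = edge (G p q) (G (Suc p) q) z" and "V p q = edge (G p q) (G p (Suc q)) z" for p q
  have corner: "Complex (Re (G p' q')) (Im (G p q)) = G p' q" for p q p' q' by (simp add: G)
  have side: "(\<Sum>p<N. edge (\<gamma> p) (\<gamma> (Suc p)) z) = edge a b z"
    if "z \<notin> closed_segment a b" "\<And>p. \<gamma> p = a + of_real (real p / real N) * (b - a)" for a b \<gamma>
    unfolding edge_def that(2) using that(1) by (intro contour_integral_linepath_subdivide N continuous_intros) auto
  have seg: "z \<notin> closed_segment a b" if "\<bar>Re a\<bar> = M \<and> Re a = Re b \<or> \<bar>Im a\<bar> = M \<and> Im a = Im b" for a b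
    using that z by (auto simp: closed_segment_same_Re closed_segment_same_Im)
  have H0: "(\<Sum>p<N. H p 0) = edge (Complex (- M) (- M)) (Complex M (- M)) z"
    unfolding H_def by (rule side, rule seg) (use M N in \<open>auto simp: G complex_eq_iff\<close>)
  have HN: "(\<Sum>p<N. H p N) = edge (Complex (- M) M) (Complex M M) z"
    unfolding H_def by (rule side, rule seg) (use M N in \<open>auto simp: G complex_eq_iff\<close>)
  have V0: "(\<Sum>q<N. V 0 q) = edge (Complex (- M) (- M)) (Complex (- M) M) z"
    unfolding V_def by (rule side, rule seg) (use M N in \<open>auto simp: G complex_eq_iff\<close>)
  have VN: "(\<Sum>q<N. V N q) = edge (Complex M (- M)) (Complex M M) z"
    unfolding V_def by (rule side, rule seg) (use M N in \<open>auto simp: G complex_eq_iff\<close>)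
  have "(\<Sum>p<N. \<Sum>q<N. tile (G p q) (G (Suc p) (Suc q)) z) =
      (\<Sum>p<N. \<Sum>q<N. - ((H p q - H p (Suc q)) + (V (Suc p) q - V p q)) / (2 * of_real pi * \<i>))"
  proof (intro sum.cong refl)
    fix p q
    have "edge (G (Suc p) (Suc q)) (G p (Suc q)) z = - H p (Suc q)" "edge (G p (Suc q)) (G p q) z = - V p q"
      unfolding H_def V_def by (rule edge_reverse)+
    then show "tile (G p q) (G (Suc p) (Suc q)) z =
        - ((H p q - H p (Suc q)) + (V (Suc p) q - V p q)) / (2 * of_real pi * \<i>)"
      unfolding tile_def corner by (simp add: H_def V_def)
  qed
  also have "\<dots> = - ((\<Sum>p<N. \<Sum>q<N. H p q - H p (Suc q)) + (\<Sum>p<N. \<Sum>q<N. V (Suc p) q - V p q)) / (2 * of_real pi * \<i>)"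
    by (simp only: sum_divide_distrib[symmetric] sum_negf sum.distrib)
  also have "(\<Sum>p<N. \<Sum>q<N. H p q - H p (Suc q)) = (\<Sum>p<N. H p 0) - (\<Sum>p<N. H p N)"
    unfolding sum_lessThan_telescope' by (rule sum_subtractf)
  also have "(\<Sum>p<N. \<Sum>q<N. V (Suc p) q - V p q) = (\<Sum>q<N. V N q) - (\<Sum>q<N. V 0 q)"
  proof -
    have "(\<Sum>p<N. V (Suc p) q - V p q) = V N q - V 0 q" for q
      by (rule sum_lessThan_telescope[of "\<lambda>p. V p q"])
    then show ?thesis by (subst sum.swap) (simp only: sum_subtractf)
  qed
  finally show ?thesis
    unfolding H0 HN V0 VN tile_def complex.sel
    by (simp add: edge_reverse[of "Complex M M" "Complex (- M) M"] edge_reverse[of "Complex (- M) M" "Complex (- M) (- M)"])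
qed

lemma poly_approximable_cnj:
  fixes K :: "complex set"
  assumes K: "compact K" and int: "interior K = {}" and con: "connected (- K)"
  shows "poly_approximable K cnj"
proof (rule poly_approximable_limit)
  fix e :: real assume e: "e > 0"
  obtain R where R: "R > 0" "\<And>z. z \<in> K \<Longrightarrow> cmod z \<le> R"
    using compact_imp_bounded[OF K] by (auto simp: bounded_pos)
  \<comment> \<open>The outer square must contain \<open>K\<close> in its interior, so that the
    boundary integrals in \<open>E\<close> have their poles off \<open>K\<close>.\<close>
  define M where "M = R + 1"
  have M: "M > 0" "\<And>z. z \<in> K \<Longrightarrow> \<bar>Re z\<bar> < M" "\<And>z. z \<in> K \<Longrightarrow> \<bar>Im z\<bar> < M"
  proof -
    show "M > 0" using R by (simp add: M_def)
    show "\<bar>Re z\<bar> < M" "\<bar>Im z\<bar> < M" if "z \<in> K" for z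
      using R(2)[OF that] abs_Re_le_cmod[of z] abs_Im_le_cmod[of z] by (simp_all add: M_def)
  qed
  \<comment> \<open>The total error obtained below is \<open>1404 * d * (2 * harm N)\<^sup>2\<close>
    with \<open>d = 2 * M / N\<close>, which has the coefficient 5616; 11232 is twice that.\<close>
  have "(\<lambda>N. 11232 * (2 * M) * ((harm N)\<^sup>2 / real N)) \<longlonglongrightarrow> 11232 * (2 * M) * 0"
    by (intro tendsto_intros harm_squared_div_tendsto_0)
  then have "\<forall>\<^sub>F N in sequentially. 11232 * (2 * M) * ((harm N)\<^sup>2 / real N) < e"
    using e by (intro order_tendstoD(2)) auto
  then obtain N where N: "N > 0" "11232 * (2 * M) * ((harm N)\<^sup>2 / real N) < e"
    using eventually_gt_at_top[of 0] by (metis (mono_tags, lifting) eventually_conj eventually_happens' sequentially_bot)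
  define d where "d = 2 * M / real N"
  have d: "d > 0" using M N by (simp add: d_def)
  define G where "G p q = Complex (- M + 2 * M * real p / real N) (- M + 2 * M * real q / real N)" for p q
  define c where "c p q = G p q + Complex (d/2) (d/2)" for p q
  have G1: "G p q = c p q - Complex (d/2) (d/2)" for p q by (simp add: c_def)
  have G2: "G (Suc p) (Suc q) = c p q + Complex (d/2) (d/2)" for p q
    using N by (simp add: c_def G_def d_def complex_eq_iff field_simps)
  have "\<exists>Q. poly_approximable K Q \<and> (\<forall>z\<in>K. cmod (Q z - tile (G p q) (G (Suc p) (Suc q)) z) \<le>
     702 * d ^ 3 / (d\<^sup>2 + (cmod (z - c p q))\<^sup>2))" for p q
    by (rule square_tile_approx[OF d G1 G2 K int con])
  then obtain Q where Q: "\<And>p q. poly_approximable K (Q p q)"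
    "\<And>p q z. z \<in> K \<Longrightarrow> cmod (Q p q z - tile (G p q) (G (Suc p) (Suc q)) z) \<le> 702 * d ^ 3 / (d\<^sup>2 + (cmod (z - c p q))\<^sup>2)"
    by metis
  define a1 a3 where "a1 = Complex (- M) (- M)" and "a3 = Complex M M"
  define a2 a4 where "a2 = Complex (Re a3) (Im a1)" and "a4 = Complex (Re a1) (Im a3)"
  let ?C = "\<lambda>a b z. contour_integral (linepath a b) (\<lambda>w. cnj w / (w - z))"
  define E where "E z = (?C a1 a2 z + ?C a2 a3 z + ?C a3 a4 z + ?C a4 a1 z) * (1 / (2 * of_real pi * \<i>))" for z
  have seg: "closed_segment a b \<inter> K = {}" if "\<bar>Re a\<bar> = M \<and> Re a = Re b \<or> \<bar>Im a\<bar> = M \<and> Im a = Im b" for a b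
    using that M by (fastforce simp: closed_segment_same_Re closed_segment_same_Im)
  have E: "poly_approximable K E"
    unfolding E_def
    by (intro poly_approximable_mult[OF K] poly_approximable_add poly_approximable_Cauchy_integral K con seg
       continuous_intros poly_approximable_const)
      (use M in \<open>auto simp: a1_def a2_def a3_def a4_def\<close>)
  \<comment> \<open>The Cauchy-Pompeiu formula for \<open>cnj\<close>: splitting
    \<open>cnj (w - z)\<close> leaves the Cauchy integral of \<open>cnj\<close> over the boundary
    and \<open>cnj z\<close> times a winding number 1.\<close>
  have cnj: "tile a1 a3 z + E z = cnj z" if z: "z \<in> K" for z
  proof -
    have zbox: "z \<in> box a1 a3" using M(2,3)[OF z] by (auto simp: in_box_complex_iff a1_def a3_def abs_less_iff)
    have im: "path_image (rectpath a1 a3) = closed_segment a1 a2 \<union> closed_segment a2 a3 \<union>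
        closed_segment a3 a4 \<union> closed_segment a4 a1"
      unfolding a2_def a4_def by (auto simp: rectpath_def Let_def path_image_join)
    have zP: "z \<notin> path_image (rectpath a1 a3)"
    proof -
      have "z \<notin> closed_segment a b" if "\<bar>Re a\<bar> = M \<and> Re a = Re b \<or> \<bar>Im a\<bar> = M \<and> Im a = Im b" for a b
        using seg[OF that] z by blast
      then show ?thesis unfolding im Un_iff de_Morgan_disj
        using M(1) by (intro conjI) (auto simp: a1_def a2_def a3_def a4_def)
    qed
    have c1: "continuous_on (path_image (rectpath a1 a3)) (\<lambda>w. cnj w / (w - z))"
      "continuous_on (path_image (rectpath a1 a3)) (\<lambda>w. 1 / (w - z))"
      using zP by (auto intro!: continuous_intros)
    have "contour_integral (rectpath a1 a3) (\<lambda>w. cnj (w - z) / (w - z)) =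
       contour_integral (rectpath a1 a3) (\<lambda>w. cnj w / (w - z) - cnj z * (1 / (w - z)))"
      by (intro contour_integral_eq) (simp add: diff_divide_distrib)
    also have "\<dots> = contour_integral (rectpath a1 a3) (\<lambda>w. cnj w / (w - z)) -
        cnj z * contour_integral (rectpath a1 a3) (\<lambda>w. 1 / (w - z))"
      using contour_integral_rectpath(1)[OF c1(1) refl refl] contour_integral_rectpath(1)[OF c1(2) refl refl]
      by (simp only: contour_integral_diff contour_integral_lmul contour_integrable_lmul)
    also have "contour_integral (rectpath a1 a3) (\<lambda>w. 1 / (w - z)) = 2 * of_real pi * \<i>"
      using winding_number_rectpath[OF zbox] winding_number_valid_path[OF valid_path_rectpath zP] by simp
    also have "contour_integral (rectpath a1 a3) (\<lambda>w. cnj w / (w - z)) = E z * (2 * of_real pi * \<i>)"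
      unfolding contour_integral_rectpath(2)[OF c1(1) a2_def a4_def] E_def by simp
    finally show ?thesis
      unfolding tile_eq_rectpath[OF zP] by (simp add: field_simps)
  qed
  show "\<exists>g. poly_approximable K g \<and> (\<forall>z\<in>K. cmod (g z - cnj z) < e)"
  proof (intro exI conjI ballI)
    show "poly_approximable K (\<lambda>z. (\<Sum>p<N. \<Sum>q<N. Q p q z) + E z)"
      by (intro poly_approximable_add poly_approximable_sum Q E)
    fix z assume z: "z \<in> K"
    \<comment> \<open>Coordinates of \<open>z\<close> in units of \<open>d\<close>, shifted by 1/2
      so that the centre \<open>c p q\<close> has the coordinates \<open>(p, q)\<close>.\<close>
    define \<xi> \<eta> where "\<xi> = (Re z + M) / d - 1/2" and "\<eta> = (Im z + M) / d - 1/2"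
    have err: "702 * d ^ 3 / (d\<^sup>2 + (cmod (z - c p q))\<^sup>2) \<le>
        1404 * d * (1 / (1 + \<bar>\<xi> - real p\<bar>) * (1 / (1 + \<bar>\<eta> - real q\<bar>)))" for p q
    proof -
      define X Y where "X = \<bar>\<xi> - real p\<bar>" and "Y = \<bar>\<eta> - real q\<bar>"
      have G: "G p q = Complex (- M + d * real p) (- M + d * real q)" by (simp add: G_def d_def)
      have "Re (z - c p q) = d * (\<xi> - real p)" "Im (z - c p q) = d * (\<eta> - real q)"
        using d by (simp_all add: c_def G \<xi>_def \<eta>_def field_simps)
      then have "(cmod (z - c p q))\<^sup>2 = d\<^sup>2 * X\<^sup>2 + d\<^sup>2 * Y\<^sup>2"
        by (simp add: cmod_power2 X_def Y_def power_mult_distrib)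
      then have "702 * d ^ 3 / (d\<^sup>2 + (cmod (z - c p q))\<^sup>2) = 702 * d * (d\<^sup>2 / (d\<^sup>2 * (1 + X\<^sup>2 + Y\<^sup>2)))"
        by (simp add: power2_eq_square power3_eq_cube algebra_simps)
      also have "\<dots> = 702 * d * (1 / (1 + X\<^sup>2 + Y\<^sup>2))" using d by simp
      \<comment> \<open>This separates the variables, so that the double sum becomes a product of
        two harmonic sums. The price is the second logarithm in the error.\<close>
      also have "\<dots> \<le> 702 * d * (2 / ((1 + X) * (1 + Y)))"
      proof (intro mult_left_mono)
        have "2 * X \<le> 1 + X\<^sup>2" "2 * Y \<le> 1 + Y\<^sup>2" "2 * (X * Y) \<le> X\<^sup>2 + Y\<^sup>2"
          using zero_le_power2[of "X - 1"] zero_le_power2[of "Y - 1"] sum_squares_bound[of X Y]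
          by (simp_all add: power2_diff)
        then have "1 + X + Y + X * Y \<le> 2 * (1 + X\<^sup>2 + Y\<^sup>2)"
          using zero_le_power2[of X] zero_le_power2[of Y] unfolding distrib_left by linarith
        moreover have "(1 + X) * (1 + Y) = 1 + X + Y + X * Y" by (simp add: algebra_simps)
        ultimately have "(1 + X) * (1 + Y) \<le> 2 * (1 + X\<^sup>2 + Y\<^sup>2)" by (simp only:)
        moreover have "X \<ge> 0" "Y \<ge> 0" by (auto simp: X_def Y_def)
        moreover have "1 + X\<^sup>2 + Y\<^sup>2 > 0" by (simp add: add_pos_nonneg)
        ultimately show "1 / (1 + X\<^sup>2 + Y\<^sup>2) \<le> 2 / ((1 + X) * (1 + Y))"
          by (subst frac_le_eq) (auto simp: divide_le_0_iff zero_less_mult_iff)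
      qed (use d in auto)
      finally show ?thesis by (simp add: X_def Y_def)
    qed
    have "cmod ((\<Sum>p<N. \<Sum>q<N. Q p q z) + E z - cnj z) =
        cmod (\<Sum>p<N. \<Sum>q<N. Q p q z - tile (G p q) (G (Suc p) (Suc q)) z)"
    proof -
      have "cnj z = (\<Sum>p<N. \<Sum>q<N. tile (G p q) (G (Suc p) (Suc q)) z) + E z"
        using sum_tiles_eq_tile[OF M(1) N(1) M(2)[OF z] M(3)[OF z] G_def] cnj[OF z] by (simp add: a1_def a3_def)
      then show ?thesis by (simp only: sum_subtractf add_diff_cancel_right)
    qed
    also have "\<dots> \<le> (\<Sum>p<N. \<Sum>q<N. 1404 * d * (1 / (1 + \<bar>\<xi> - real p\<bar>) * (1 / (1 + \<bar>\<eta> - real q\<bar>))))"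
      by (intro sum_norm_le order_trans[OF Q(2)[OF z] err])
    also have "\<dots> = 1404 * d * ((\<Sum>p<N. 1 / (1 + \<bar>\<xi> - real p\<bar>)) * (\<Sum>q<N. 1 / (1 + \<bar>\<eta> - real q\<bar>)))"
      by (simp only: sum_distrib_left[symmetric] sum_distrib_right[symmetric])
    also have "\<dots> \<le> 1404 * d * ((2 * harm N) * (2 * harm N))"
      using d by (intro mult_left_mono mult_mono sum_inverse_dist_le_harm sum_nonneg) (auto simp: harm_nonneg)
    also have "\<dots> \<le> 11232 * (2 * M) * ((harm N)\<^sup>2 / real N)" 
      using M by (simp add: d_def power2_eq_square divide_right_mono)
    also have "\<dots> < e" by (rule N)
    finally show "cmod ((\<Sum>p<N. \<Sum>q<N. Q p q z) + E z - cnj z) < e" .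
  qed
qed

text \<open>A real linear functional on the plane is a combination of real and imaginary part, hence
  of \<open>z\<close> and \<open>cnj z\<close>; sums and products follow from the algebra
  structure.\<close>

lemma poly_approximable_real_polynomial_function:
  assumes K: "compact K" and cnj: "poly_approximable K cnj" and g: "real_polynomial_function g"
  shows "poly_approximable K (\<lambda>z. of_real (g z))"
  using g
proof induction
  case (linear f)
  have "f z = Re z * f 1 + Im z * f \<i>" for z
  proof -
    have "f z = f (Re z *\<^sub>R 1 + Im z *\<^sub>R \<i>)"
      by (rule arg_cong[of _ _ f]) (simp add: complex_eq_iff)
    also have "\<dots> = Re z * f 1 + Im z * f \<i>"
      using bounded_linear.linear[OF linear] by (simp only: linear_add linear_scale real_scaleR_def)
    finally show ?thesis .
  qed
  moreover have "of_real (Re z) = (1/2) * (z + cnj z)" "of_real (Im z) = (1 / (2 * \<i>)) * (z - cnj z)" for z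
    by (auto simp: complex_eq_iff)
  ultimately have eq: "of_real (f z) = (1/2) * (z + cnj z) * of_real (f 1) + (1 / (2 * \<i>)) * (z - cnj z) * of_real (f \<i>)" for z
    by (metis of_real_add of_real_mult)
  have "poly_approximable K (\<lambda>z. (1/2) * (z + cnj z) * of_real (f 1) + (1 / (2 * \<i>)) * (z - cnj z) * of_real (f \<i>))"
    by (intro poly_approximable_add poly_approximable_mult poly_approximable_diff K cnj poly_approximable_ident poly_approximable_const)
  then show ?case by (rule poly_approximable_cong) (rule eq)
qed (auto intro: poly_approximable_add poly_approximable_mult K)

theorem Lavrentiev:
  fixes K :: "complex set"
  assumes K: "compact K" and int: "interior K = {}" and con: "connected (- K)" and f: "continuous_on K f"
  shows "poly_approximable K f"
proof -
  have real: "poly_approximable K (\<lambda>z. of_real (g z))" if g: "continuous_on K g" for g :: "complex \<Rightarrow> real"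
  proof (rule poly_approximable_limit)
    fix e :: real assume "e > 0"
    then obtain h where h: "real_polynomial_function h" "\<And>z. z \<in> K \<Longrightarrow> \<bar>g z - h z\<bar> < e"
      using Stone_Weierstrass_real_polynomial_function[OF K g] by metis
    show "\<exists>h. poly_approximable K h \<and> (\<forall>z\<in>K. cmod (h z - of_real (g z)) < e)"
    proof (intro exI[of _ "\<lambda>z. of_real (h z)"] conjI ballI)
      show "poly_approximable K (\<lambda>z. of_real (h z))"
        by (intro poly_approximable_real_polynomial_function K poly_approximable_cnj int con h)
      show "cmod (of_real (h z) - of_real (g z)) < e" if "z \<in> K" for z
        using h(2)[OF that] by (simp add: abs_minus_commute flip: of_real_diff)
    qed
  qed
  have "poly_approximable K (\<lambda>z. of_real (Re (f z)) + \<i> * of_real (Im (f z)))"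
    by (intro poly_approximable_add poly_approximable_mult poly_approximable_const K real continuous_intros f)
  then show ?thesis by (rule poly_approximable_cong) (simp add: complex_eq_iff)
qed

section \<open>Characteristic polynomials\<close>

lemma poly_charpoly:
  fixes M :: "'a::comm_ring_1^'n^'n"
  shows "poly (charpoly M) z = det (mat z - M)"
proof -
  have "poly ((\<chi> i j. (if i = j then [:0, 1:] else 0) - [:M $ i $ j:]) $ i $ j) z = (mat z - M) $ i $ j" for i j :: 'n
    by (simp add: mat_def)
  then show ?thesis
    unfolding charpoly_def det_def by (simp add: poly_sum poly_prod)
qed

text \<open>In the Leibniz expansion the identity contributes a monic term of full degree. Every
  other permutation moves some index, whose factor is constant, so its term has smaller
  degree.\<close>

lemma charpoly_monic:
  fixes M :: "'a::idom^'n^'n"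
  shows "degree (charpoly M) = CARD('n)" "lead_coeff (charpoly M) = 1"
proof -
  define E where "E i j = (if i = j then [:0, 1:] else 0) - [:M $ i $ j:]" for i j
  define D where "D = (\<Prod>i\<in>UNIV. E i i)"
  define R where "R = (\<Sum>p\<in>{p. p permutes UNIV} - {id}. of_int (sign p) * (\<Prod>i\<in>UNIV. E i (p i)))"
  have Eii: "E i i = [:- M $ i $ i, 1:]" for i by (simp add: E_def)
  have "degree D = (\<Sum>i\<in>(UNIV::'n set). degree (E i i))"
    unfolding D_def by (rule degree_prod_eq_sum_degree) (simp add: Eii)
  then have dD: "degree D = CARD('n)" by (simp add: Eii)
  have lD: "lead_coeff D = 1" unfolding D_def lead_coeff_prod by (simp add: Eii)
  have "degree (of_int (sign p) * (\<Prod>i\<in>UNIV. E i (p i))) \<le> CARD('n) - 1"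
    if p: "p \<in> {p. p permutes UNIV} - {id}" for p
  proof -
    from p obtain j where j: "p j \<noteq> j" by (auto simp: fun_eq_iff)
    have "degree (\<Prod>i\<in>UNIV. E i (p i)) \<le> (\<Sum>i\<in>UNIV. degree (E i (p i)))"
      using degree_prod_sum_le[of UNIV "\<lambda>i. E i (p i)"] by (simp add: o_def)
    also have "\<dots> \<le> (\<Sum>i\<in>UNIV. if i = j then 0 else 1)"
      by (intro sum_mono) (use j in \<open>auto simp: E_def\<close>)
    also have "\<dots> = CARD('n) - 1"
      by (simp add: sum.If_cases card_Diff_subset Compl_eq_Diff_UNIV)
    finally have "degree (\<Prod>i\<in>UNIV. E i (p i)) \<le> CARD('n) - 1" .
    moreover have "degree (of_int (sign p) :: 'a poly) = 0" by simp
    ultimately show ?thesis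
      using degree_mult_le[of "of_int (sign p)" "\<Prod>i\<in>UNIV. E i (p i)"] by simp
  qed
  then have "degree R \<le> CARD('n) - 1" unfolding R_def by (intro degree_sum_le) auto
  then have dR: "degree R < CARD('n)" by (simp add: le_less_trans[OF _ diff_less])
  have "charpoly M = D + R"
  proof -
    have "charpoly M = (\<Sum>p\<in>{p. p permutes (UNIV::'n set)}. of_int (sign p) * (\<Prod>i\<in>UNIV. E i (p i)))"
      unfolding charpoly_def det_def by (simp add: E_def)
    also have "\<dots> = of_int (sign id) * (\<Prod>i\<in>UNIV. E i (id i)) + R"
      unfolding R_def by (subst sum.remove[of _ id]) (auto simp: permutes_id finite_permutations)
    finally show ?thesis by (simp add: D_def)
  qed
  then show "degree (charpoly M) = CARD('n)" "lead_coeff (charpoly M) = 1"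
    using dD lD dR by (simp_all add: degree_add_eq_left coeff_eq_0)
qed

lemma mat_mult_vector: "mat c *v v = c *s (v :: 'a::comm_semiring_1^'n)"
  by (simp add: vec_eq_iff matrix_vector_mult_def mat_def if_distrib if_distribR cong: if_cong)

lemma mem_spectrum_iff: "l \<in> spectrum A \<longleftrightarrow> poly (charpoly (complex_matrix A)) l = 0"
proof -
  let ?M = "mat l - complex_matrix A"
  have "poly (charpoly (complex_matrix A)) l \<noteq> 0 \<longleftrightarrow> invertible ?M"
    by (simp add: poly_charpoly invertible_det_nz)
  also have "\<dots> \<longleftrightarrow> (\<exists>B. B ** ?M = mat 1)"
    using invertible_left_inverse by blast
  also have "\<dots> \<longleftrightarrow> (\<forall>v. ?M *v v = 0 \<longrightarrow> v = 0)"
    by (rule matrix_left_invertible_ker)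
  also have "\<dots> \<longleftrightarrow> l \<notin> spectrum A"
    by (auto simp: spectrum_def matrix_vector_mult_diff_rdistrib mat_mult_vector)
  finally show ?thesis by blast
qed

text \<open>Over the complex numbers the characteristic polynomial splits, and each root occurs
  once; comparing degrees counts the roots.\<close>

lemma simple_spectrum:
  fixes A :: "real^'n^'n"
  assumes simple: "\<And>l. l \<in> spectrum A \<Longrightarrow> alg_mult A l = 1"
  shows "finite (spectrum A)" "card (spectrum A) = CARD('n)"
    "poly (charpoly (complex_matrix A)) z = (\<Prod>l\<in>spectrum A. z - l)"
proof -
  let ?p = "charpoly (complex_matrix A)"
  have p0: "?p \<noteq> 0" using charpoly_monic(2)[of "complex_matrix A"] by auto
  have sp: "{z. poly ?p z = 0} = spectrum A" by (auto simp: mem_spectrum_iff)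
  show fin: "finite (spectrum A)" using poly_roots_finite[OF p0] by (simp add: sp)
  have "?p = (\<Prod>l\<in>spectrum A. [:-l, 1:] ^ order l ?p)"
    using complex_poly_decompose[of ?p] by (simp add: charpoly_monic(2) sp)
  also have "\<dots> = (\<Prod>l\<in>spectrum A. [:-l, 1:])"
    using simple by (intro prod.cong) (auto simp: alg_mult_def)
  finally have p: "?p = (\<Prod>l\<in>spectrum A. [:-l, 1:])" .
  show "poly ?p z = (\<Prod>l\<in>spectrum A. z - l)" by (subst p) (simp add: poly_prod)
  have "CARD('n) = degree (\<Prod>l\<in>spectrum A. [:-l, 1:])"
    using charpoly_monic(1)[of "complex_matrix A"] p by simp
  also have "\<dots> = card (spectrum A)" by (subst degree_prod_eq_sum_degree) auto
  finally show "card (spectrum A) = CARD('n)" by simp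
qed

text \<open>The matrix is real, so conjugating the entries of an eigenvector gives an eigenvector
  for the conjugate eigenvalue.\<close>

lemma spectrum_cnj: "l \<in> spectrum A \<Longrightarrow> cnj l \<in> spectrum A"
proof -
  assume "l \<in> spectrum A"
  then obtain v where v: "v \<noteq> 0" "complex_matrix A *v v = l *s v" by (auto simp: spectrum_def)
  have "(\<chi> i. cnj (v $ i)) \<noteq> 0" using v(1) by (simp add: vec_eq_iff)
  moreover have "complex_matrix A *v (\<chi> i. cnj (v $ i)) = cnj l *s (\<chi> i. cnj (v $ i))"
  proof -
    have "cnj ((complex_matrix A *v v) $ i) = cnj ((l *s v) $ i)" for i using v(2) by simp
    then show ?thesis by (simp add: vec_eq_iff matrix_vector_mult_def complex_matrix_def)
  qed
  ultimately show ?thesis unfolding spectrum_def by blast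
qed

section \<open>Bounds for matrices and eigenvalues that are continuous in the parameter\<close>

definition entry_sum :: "'a::real_normed_vector^'n^'m \<Rightarrow> real" where
  "entry_sum A = (\<Sum>i\<in>UNIV. \<Sum>j\<in>UNIV. norm (A $ i $ j))"

lemma entry_sum_nonneg: "entry_sum A \<ge> 0"
  by (simp add: entry_sum_def sum_nonneg)

lemma norm_vec_le_sum: "norm (v :: 'a::real_normed_vector^'n) \<le> (\<Sum>i\<in>UNIV. norm (v $ i))"
  unfolding norm_vec_def by (rule L2_set_le_sum) simp

lemma norm_matrix_vector_mult_le:
  fixes A :: "'a::real_normed_field^'n^'m"
  shows "norm (A *v v) \<le> entry_sum A * norm v"
proof -
  have "norm (A *v v) \<le> (\<Sum>i\<in>UNIV. norm ((A *v v) $ i))" by (rule norm_vec_le_sum)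
  also have "\<dots> \<le> (\<Sum>i\<in>UNIV. \<Sum>j\<in>UNIV. norm (A $ i $ j) * norm v)"
  proof (rule sum_mono)
    fix i
    have "norm ((A *v v) $ i) \<le> (\<Sum>j\<in>UNIV. norm (A $ i $ j * v $ j))"
      by (simp add: matrix_vector_mult_def norm_sum)
    also have "\<dots> \<le> (\<Sum>j\<in>UNIV. norm (A $ i $ j) * norm v)"
      by (intro sum_mono) (simp add: norm_mult mult_left_mono Finite_Cartesian_Product.norm_nth_le)
    finally show "norm ((A *v v) $ i) \<le> (\<Sum>j\<in>UNIV. norm (A $ i $ j) * norm v)" .
  qed
  finally show ?thesis by (simp add: entry_sum_def sum_distrib_right)
qed

lemma continuous_on_entry_sum [continuous_intros]:
  fixes A :: "'b::topological_space \<Rightarrow> 'a::real_normed_vector^'n^'m"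
  assumes "continuous_on P A"
  shows "continuous_on P (\<lambda>\<theta>. entry_sum (A \<theta>))"
  unfolding entry_sum_def by (intro continuous_intros assms)

lemma entry_sum_complex_matrix: "entry_sum (complex_matrix A) = entry_sum A"
  by (simp add: entry_sum_def complex_matrix_def)

lemma norm_spectrum_le:
  assumes "l \<in> spectrum A"
  shows "cmod l \<le> entry_sum A"
proof -
  obtain v where v: "v \<noteq> 0" "complex_matrix A *v v = l *s v" using assms by (auto simp: spectrum_def)
  have "norm (l *s v) = cmod l * norm v"
    by (simp add: norm_vec_def norm_mult L2_set_right_distrib)
  then have "cmod l * norm v \<le> entry_sum A * norm v"
    using norm_matrix_vector_mult_le[of "complex_matrix A" v] v(2) by (simp add: entry_sum_complex_matrix)
  then show ?thesis using v(1) by simp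
qed

lemma continuous_on_charpoly:
  fixes A :: "real \<Rightarrow> real^'n^'n"
  assumes A: "continuous_on P A"
  shows "continuous_on (P \<times> UNIV) (\<lambda>p. poly (charpoly (complex_matrix (A (fst p)))) (snd p))"
proof -
  have "continuous_on (P \<times> UNIV) (\<lambda>p. A (fst p))"
    by (intro continuous_on_compose2[OF A] continuous_intros) auto
  then have ent: "continuous_on (P \<times> UNIV) (\<lambda>p. A (fst p) $ i $ j)" for i j
    by (intro continuous_intros)
  have "continuous_on (P \<times> UNIV) (\<lambda>p. (if i = j then snd p else 0) - of_real (A (fst p) $ i $ j) :: complex)" for i j
    by (cases "i = j") (auto intro!: continuous_intros ent)
  then have "continuous_on (P \<times> UNIV) (\<lambda>p. (mat (snd p) - complex_matrix (A (fst p))) $ i $ j)" for i j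
    by (simp add: mat_def complex_matrix_def)
  then show ?thesis
    unfolding poly_charpoly det_def
    by (intro continuous_on_sum continuous_on_prod continuous_on_mult continuous_on_const)
qed

text \<open>Two logarithms differ by a multiple of 2 pi i at a common point. With at most one common
  point, adding the constant \<open>c\<close> to one of them makes them agree; without a common
  point no correction is made.\<close>

lemma continuous_log_Un:
  fixes f :: "'a::topological_space \<Rightarrow> complex"
  assumes S: "closed S" and T: "closed T" and ST: "S \<inter> T \<subseteq> {x}"
    and g: "continuous_on S g" "\<And>y. y \<in> S \<Longrightarrow> f y = exp (g y)"
    and h: "continuous_on T h" "\<And>y. y \<in> T \<Longrightarrow> f y = exp (h y)"
  shows "\<exists>g. continuous_on (S \<union> T) g \<and> (\<forall>y\<in>S \<union> T. f y = exp (g y))"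
proof -
  define c where "c = (if x \<in> S \<inter> T then g x - h x else 0)"
  have c: "exp c = 1"
  proof (cases "x \<in> S \<inter> T")
    case True
    then have "exp (g x) = exp (h x)" using g(2)[of x] h(2)[of x] by auto
    then show ?thesis using True by (simp add: c_def exp_diff)
  qed (auto simp: c_def)
  have eq: "h y + c = g y" if "y \<in> S" "y \<in> T" for y
    using ST that by (auto simp: c_def)
  let ?k = "\<lambda>y. if y \<in> S then g y else h y + c"
  have "continuous_on (S \<union> T) ?k"
    using S T ST eq by (intro continuous_on_cases continuous_intros g h) auto
  moreover have "f y = exp (?k y)" if "y \<in> S \<union> T" for y
    using that g(2) h(2) c by (auto simp: exp_add)
  ultimately show ?thesis by blast
qed

section \<open>The union of the spectra\<close>

locale simple_disjoint_spectra =
  fixes P :: "real set" and A :: "real \<Rightarrow> real^'n^'n"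
  assumes compact_P: "compact P" and continuous_A: "continuous_on P A"
    and disjoint_spectra: "\<And>\<theta> \<theta>'. \<theta> \<in> P \<Longrightarrow> \<theta>' \<in> P \<Longrightarrow> \<theta> \<noteq> \<theta>' \<Longrightarrow> spectrum (A \<theta>) \<inter> spectrum (A \<theta>') = {}"
    and simple: "\<And>\<theta> l. \<theta> \<in> P \<Longrightarrow> l \<in> spectrum (A \<theta>) \<Longrightarrow> alg_mult (A \<theta>) l = 1"
begin

abbreviation \<sigma> :: "real \<Rightarrow> complex set" where "\<sigma> \<theta> \<equiv> spectrum (A \<theta>)"

abbreviation charp :: "real \<Rightarrow> complex \<Rightarrow> complex" where "charp \<theta> \<equiv> poly (charpoly (complex_matrix (A \<theta>)))"

definition K :: "complex set" where "K = (\<Union>\<theta>\<in>P. \<sigma> \<theta>)"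

definition parameter :: "complex \<Rightarrow> real" where "parameter l = (THE \<theta>. \<theta> \<in> P \<and> l \<in> \<sigma> \<theta>)"

lemma parameter_eq: "\<theta> \<in> P \<Longrightarrow> l \<in> \<sigma> \<theta> \<Longrightarrow> parameter l = \<theta>"
  unfolding parameter_def using disjoint_spectra by (intro the_equality) blast+

lemma parameter_in: "l \<in> K \<Longrightarrow> parameter l \<in> P" "l \<in> K \<Longrightarrow> l \<in> \<sigma> (parameter l)"
  using parameter_eq by (auto simp: K_def)

lemma spectrum_subset_K: "\<theta> \<in> P \<Longrightarrow> \<sigma> \<theta> \<subseteq> K"
  by (auto simp: K_def)

lemma finite_\<sigma>: "\<theta> \<in> P \<Longrightarrow> finite (\<sigma> \<theta>)" and card_\<sigma>: "\<theta> \<in> P \<Longrightarrow> card (\<sigma> \<theta>) = CARD('n)"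
  and charp_eq_prod: "\<theta> \<in> P \<Longrightarrow> charp \<theta> z = (\<Prod>l\<in>\<sigma> \<theta>. z - l)"
  using simple_spectrum[of "A \<theta>"] simple by auto

lemma entry_sum_bound: obtains M where "M \<ge> 0" "\<And>\<theta>. \<theta> \<in> P \<Longrightarrow> entry_sum (A \<theta>) \<le> M"
proof -
  have "compact ((\<lambda>\<theta>. entry_sum (A \<theta>)) ` P)"
    by (intro compact_continuous_image continuous_intros continuous_A compact_P)
  then obtain M where M: "M > 0" "\<And>\<theta>. \<theta> \<in> P \<Longrightarrow> \<bar>entry_sum (A \<theta>)\<bar> \<le> M"
    by (auto simp: bounded_pos dest!: compact_imp_bounded)
  show ?thesis
    by (rule that[of M]) (use M in \<open>auto intro: order_trans[OF abs_ge_self]\<close>)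
qed

text \<open>The graph is the zero set of a jointly continuous function, and a common bound for the
  entries of the matrices confines it to a compact product.\<close>

lemma compact_graph: "compact {p \<in> P \<times> UNIV. snd p \<in> \<sigma> (fst p)}"
proof -
  obtain M where M: "\<And>\<theta>. \<theta> \<in> P \<Longrightarrow> entry_sum (A \<theta>) \<le> M" using entry_sum_bound by blast
  let ?f = "\<lambda>p. charp (fst p) (snd p)"
  have "continuous_on (P \<times> cball 0 M) ?f"
    using continuous_on_subset[OF continuous_on_charpoly[OF continuous_A]] by blast
  then have "closed ((P \<times> cball 0 M) \<inter> ?f -` {0})"
    by (intro continuous_closed_preimage closed_Times closed_cball compact_imp_closed compact_P) auto
  then have "compact ((P \<times> cball 0 M) \<inter> ((P \<times> cball 0 M) \<inter> ?f -` {0}))"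
    by (intro compact_Int_closed compact_Times compact_P compact_cball)
  moreover have "(P \<times> cball 0 M) \<inter> ((P \<times> cball 0 M) \<inter> ?f -` {0}) = {p \<in> P \<times> UNIV. snd p \<in> \<sigma> (fst p)}"
    using norm_spectrum_le M by (fastforce simp: mem_spectrum_iff)
  ultimately show ?thesis by simp
qed

text \<open>Disjointness of the spectra makes the projection of the compact graph to the plane
  injective. Its inverse is then continuous, and \<open>parameter\<close> is the first component of
  that inverse.\<close>

lemma compact_K: "compact K" and continuous_on_parameter: "continuous_on K parameter"
proof -
  let ?G = "{p \<in> P \<times> UNIV. snd p \<in> \<sigma> (fst p)}"
  have img: "snd ` ?G = K" by (force simp: K_def)
  show "compact K" unfolding img[symmetric]
    by (intro compact_continuous_image compact_graph continuous_on_snd continuous_on_id)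
  have inj: "inj_on snd ?G"
    using parameter_eq by (auto simp: inj_on_def) 
  have "continuous_on K (the_inv_into ?G snd)"
    using continuous_on_inv_into[OF continuous_on_snd[OF continuous_on_id] compact_graph inj] by (simp only: img)
  then have "continuous_on K (\<lambda>l. fst (the_inv_into ?G snd l))" by (intro continuous_intros)
  moreover have "fst (the_inv_into ?G snd l) = parameter l" if "l \<in> K" for l
  proof -
    have "(parameter l, l) \<in> ?G" using parameter_in[OF that] by simp
    then show ?thesis using the_inv_into_f_f[OF inj, of "(parameter l, l)"] by simp
  qed
  ultimately show "continuous_on K parameter" by (simp cong: continuous_on_cong)
qed

lemma parameter_fibre: "\<theta> \<in> P \<Longrightarrow> {l \<in> K. parameter l = \<theta>} = \<sigma> \<theta>"
  using parameter_eq parameter_in spectrum_subset_K by blast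

lemma finite_parameter_fibre: "finite {l \<in> K. parameter l = \<theta>}"
proof (cases "\<theta> \<in> P")
  case False
  then have "{l \<in> K. parameter l = \<theta>} = {}" using parameter_in by auto
  then show ?thesis by (metis finite.emptyI)
qed (simp add: parameter_fibre finite_\<sigma>)

text \<open>A disc stays connected after the removal of a finite fibre. If \<open>K\<close>
  contained a disc, the parameter would take two values on it, hence also their midpoint
  \<open>t\<close> on the disc without the fibre over \<open>t\<close>.\<close>

lemma interior_K: "interior K = {}"
proof (rule ccontr)
  assume "interior K \<noteq> {}"
  then obtain c r where r: "r > 0" "ball c r \<subseteq> K" by (meson ex_in_conv mem_interior)
  have "\<exists>d\<in>ball c r. parameter d \<noteq> parameter c"
  proof (rule ccontr)
    assume "\<not> ?thesis"
    then have "ball c r \<subseteq> {l \<in> K. parameter l = parameter c}" using r(2) by blast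
    then have "finite (ball c r)" using finite_parameter_fibre finite_subset by blast
    then show False using r(1) by (metis finite_imp_not_open open_ball centre_in_ball empty_iff)
  qed
  then obtain d where d: "d \<in> ball c r" "parameter d \<noteq> parameter c" by blast
  define t where "t = (parameter c + parameter d) / 2"
  have conn: "connected (ball c r - {l \<in> K. parameter l = t})"
    by (rule connected_open_delete_finite) (auto simp: finite_parameter_fibre)
  let ?S = "ball c r - {l \<in> K. parameter l = t}"
  have "connected (parameter ` ?S)"
    using r(2) by (intro connected_continuous_image conn continuous_on_subset[OF continuous_on_parameter]) auto
  moreover have "c \<in> ?S" "d \<in> ?S" using r d by (auto simp: t_def)
  then have "parameter c \<in> parameter ` ?S" "parameter d \<in> parameter ` ?S" by blast+
  moreover have "min (parameter c) (parameter d) \<le> t" "t \<le> max (parameter c) (parameter d)"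
    by (auto simp: t_def)
  ultimately have "t \<in> parameter ` ?S"
    by (smt (verit, best) connected_contains_Icc atLeastAtMost_iff subset_eq min_def max_def)
  then show False using r(2) by auto
qed

text \<open>The factor 4 leaves room to move both eigenvalues by less than \<open>r\<close>.
  Inserting 1 into the set makes the minimum meaningful when there is only one eigenvalue.\<close>

lemma spectrum_separated:
  assumes "s \<in> P"
  obtains r where "r > 0" "\<And>l l'. l \<in> \<sigma> s \<Longrightarrow> l' \<in> \<sigma> s \<Longrightarrow> l \<noteq> l' \<Longrightarrow> 4 * r \<le> dist l l'"
proof -
  let ?D = "insert 1 ((\<lambda>(l, l'). dist l l') ` {p \<in> \<sigma> s \<times> \<sigma> s. fst p \<noteq> snd p})"
  have fin: "finite ?D" using finite_\<sigma>[OF assms] by auto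
  have pos: "Min ?D > 0" using fin by (subst Min_gr_iff) auto
  show ?thesis
  proof (rule that[of "Min ?D / 4"])
    fix l l' assume "l \<in> \<sigma> s" "l' \<in> \<sigma> s" "l \<noteq> l'"
    then have "dist l l' \<in> ?D" by force
    then show "4 * (Min ?D / 4) \<le> dist l l'" using Min_le[OF fin] by simp
  qed (use pos in simp)
qed

text \<open>A value \<open>l\<close> close to being a root is close to a root since \<open>\<bar>charp \<theta> l\<bar>\<close> is the product of its
  distances to the roots. As both spectra have the same number of elements, the nearby roots are
  all the roots.\<close>

lemma spectrum_perturbation:
  assumes s: "s \<in> P" and r: "r > 0"
    and sep: "\<And>l l'. l \<in> \<sigma> s \<Longrightarrow> l' \<in> \<sigma> s \<Longrightarrow> l \<noteq> l' \<Longrightarrow> 4 * r \<le> dist l l'"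
  obtains d where "d > 0" "\<And>\<theta>. \<theta> \<in> P \<Longrightarrow> \<bar>\<theta> - s\<bar> < d \<Longrightarrow> \<exists>\<phi>. bij_betw \<phi> (\<sigma> s) (\<sigma> \<theta>) \<and> (\<forall>l\<in>\<sigma> s. dist (\<phi> l) l < r)"
proof -
  let ?n = "CARD('n)"
  have "\<exists>d>0. \<forall>\<theta>\<in>P. \<bar>\<theta> - s\<bar> < d \<longrightarrow> cmod (charp \<theta> l) < r ^ ?n" if l: "l \<in> \<sigma> s" for l
  proof -
    have "continuous_on P (\<lambda>\<theta>. charp (fst (\<theta>, l)) (snd (\<theta>, l)))"
      by (intro continuous_on_compose2[OF continuous_on_charpoly[OF continuous_A]] continuous_intros) auto
    then have "\<exists>d>0. \<forall>\<theta>\<in>P. dist \<theta> s < d \<longrightarrow> dist (charp \<theta> l) (charp s l) < r ^ ?n"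
      using s r unfolding continuous_on_iff by simp
    moreover have "charp s l = 0" using l by (simp add: mem_spectrum_iff)
    ultimately show ?thesis by (simp add: dist_norm)
  qed
  then obtain D where D: "\<And>l. l \<in> \<sigma> s \<Longrightarrow> D l > 0"
    "\<And>l \<theta>. l \<in> \<sigma> s \<Longrightarrow> \<theta> \<in> P \<Longrightarrow> \<bar>\<theta> - s\<bar> < D l \<Longrightarrow> cmod (charp \<theta> l) < r ^ ?n"
    by metis
  define d where "d = Min (insert 1 (D ` \<sigma> s))"
  have fin: "finite (insert 1 (D ` \<sigma> s))" using finite_\<sigma>[OF s] by simp
  show ?thesis
  proof (rule that[of d])
    show "d > 0" unfolding d_def using fin D(1) by (subst Min_gr_iff) auto
    fix \<theta> assume \<theta>: "\<theta> \<in> P" "\<bar>\<theta> - s\<bar> < d"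
    have "\<exists>m\<in>\<sigma> \<theta>. dist m l < r" if l: "l \<in> \<sigma> s" for l
    proof (rule ccontr)
      assume "\<not> (\<exists>m\<in>\<sigma> \<theta>. dist m l < r)"
      then have far: "r \<le> cmod (l - m)" if "m \<in> \<sigma> \<theta>" for m
        using that by (force simp: dist_norm norm_minus_commute)
      have "d \<le> D l" unfolding d_def using l fin by (intro Min_le) auto
      then have "cmod (charp \<theta> l) < r ^ ?n" using D(2)[OF l \<theta>(1)] \<theta>(2) by simp
      moreover have "r ^ ?n = (\<Prod>m\<in>\<sigma> \<theta>. r)" by (simp add: card_\<sigma> \<theta>)
      moreover have "\<dots> \<le> (\<Prod>m\<in>\<sigma> \<theta>. cmod (l - m))" using far r by (intro prod_mono) auto
      ultimately show False by (simp add: charp_eq_prod \<theta> prod_norm)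
    qed
    then obtain \<phi> where \<phi>: "\<And>l. l \<in> \<sigma> s \<Longrightarrow> \<phi> l \<in> \<sigma> \<theta>" "\<And>l. l \<in> \<sigma> s \<Longrightarrow> dist (\<phi> l) l < r" by metis
    have inj: "inj_on \<phi> (\<sigma> s)"
    proof (rule inj_onI, rule ccontr)
      fix l l' assume l: "l \<in> \<sigma> s" "l' \<in> \<sigma> s" "\<phi> l = \<phi> l'" "l \<noteq> l'"
      have "dist l l' \<le> dist (\<phi> l) l + dist (\<phi> l') l'"
        using l(3) by (metis dist_commute dist_triangle)
      then show False using \<phi>(2)[OF l(1)] \<phi>(2)[OF l(2)] sep[OF l(1,2,4)] r by simp
    qed
    have "\<phi> ` \<sigma> s = \<sigma> \<theta>"
      using \<phi>(1) by (intro card_subset_eq finite_\<sigma> \<theta>) (auto simp: card_image[OF inj] card_\<sigma> s \<theta>)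
    then show "\<exists>\<phi>. bij_betw \<phi> (\<sigma> s) (\<sigma> \<theta>) \<and> (\<forall>l\<in>\<sigma> s. dist (\<phi> l) l < r)"
      using inj \<phi>(2) by (auto simp: bij_betw_def)
  qed
qed

section \<open>Continuation of logarithms along the parameter and connectedness of the
  complement\<close>

definition has_log_below :: "(complex \<Rightarrow> complex) \<Rightarrow> real \<Rightarrow> bool" where
  "has_log_below f t \<longleftrightarrow> (\<exists>g. continuous_on {l \<in> K. parameter l \<le> t} g \<and>
     (\<forall>l\<in>K. parameter l \<le> t \<longrightarrow> f l = exp (g l)))"

lemma closed_parameter_between: "closed {l \<in> K. parameter l \<in> {a..b}}" "closed {l \<in> K. parameter l \<le> b}"
proof -
  have "closed (K \<inter> parameter -` {a..b})" "closed (K \<inter> parameter -` {..b})"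
    by (intro continuous_closed_preimage continuous_on_parameter compact_imp_closed compact_K closed_atLeastAtMost closed_atMost)+
  then show "closed {l \<in> K. parameter l \<in> {a..b}}" "closed {l \<in> K. parameter l \<le> b}"
    by (auto simp: vimage_def Int_def)
qed

text \<open>For parameters near \<open>s\<close> the set \<open>K\<close> lies in small disjoint
  discs around the eigenvalues at \<open>s\<close>, with one eigenvalue of each nearby spectrum in
  each disc. On such a disc \<open>f\<close> is close to a nonzero constant, so it has a logarithm
  there, and these are glued to the given one. If \<open>s\<close> is not in \<open>P\<close>, no
  spectrum is passed at all.\<close>

lemma has_log_below_extend:
  assumes f: "continuous_on K f" "\<And>l. l \<in> K \<Longrightarrow> f l \<noteq> 0"
  shows "\<exists>d>0. \<forall>t t'. \<bar>t - s\<bar> < d \<longrightarrow> \<bar>t' - s\<bar> < d \<longrightarrow> has_log_below f t \<longrightarrow> has_log_below f t'"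
proof (cases "s \<in> P")
  case False
  then obtain d where d: "d > 0" "ball s d \<subseteq> - P"
    using compact_P by (metis ComplI compact_imp_closed open_Compl open_contains_ball)
  show ?thesis
  proof (intro exI[of _ d] conjI allI impI)
    fix t t' assume t: "\<bar>t - s\<bar> < d" "\<bar>t' - s\<bar> < d" "has_log_below f t"
    have "parameter l \<notin> ball s d" if "l \<in> K" for l using that parameter_in d by auto
    then have "parameter l \<le> t \<longleftrightarrow> parameter l \<le> t'" if "l \<in> K" for l
      using t that by (force simp: dist_real_def)
    then show "has_log_below f t'" using t(3) unfolding has_log_below_def by (smt (verit) Collect_cong)
  qed (use d in simp)
next
  case s: True
  obtain r0 where r0: "r0 > 0" "\<And>l l'. l \<in> \<sigma> s \<Longrightarrow> l' \<in> \<sigma> s \<Longrightarrow> l \<noteq> l' \<Longrightarrow> 4 * r0 \<le> dist l l'"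
    using spectrum_separated[OF s] by blast
  have "\<exists>e>0. \<forall>m\<in>K. dist m l < e \<longrightarrow> dist (f m) (f l) < cmod (f l)" if l: "l \<in> \<sigma> s" for l
  proof -
    have "l \<in> K" using l s spectrum_subset_K by auto
    then show ?thesis using f unfolding continuous_on_iff by simp
  qed
  then obtain E where E: "\<And>l. l \<in> \<sigma> s \<Longrightarrow> E l > 0"
    "\<And>l m. l \<in> \<sigma> s \<Longrightarrow> m \<in> K \<Longrightarrow> dist m l < E l \<Longrightarrow> dist (f m) (f l) < cmod (f l)" by metis
  \<comment> \<open>Halving \<open>E l\<close> keeps the closed discs of radius \<open>r\<close>
    inside the open ones of radius \<open>E l\<close> on which \<open>f\<close> is close to
    \<open>f l\<close>.\<close>
  define r where "r = Min (insert r0 ((\<lambda>l. E l / 2) ` \<sigma> s))"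
  have fin: "finite (insert r0 ((\<lambda>l. E l / 2) ` \<sigma> s))" using finite_\<sigma>[OF s] by simp
  have r: "r > 0" "r \<le> r0"
    unfolding r_def using fin E(1) r0(1) by (auto simp: Min_gr_iff intro!: Min_le)
  have rE: "r \<le> E l / 2" if "l \<in> \<sigma> s" for l
    unfolding r_def using that by (intro Min_le fin) auto
  have sep: "4 * r \<le> dist l l'" if "l \<in> \<sigma> s" "l' \<in> \<sigma> s" "l \<noteq> l'" for l l'
    using r0(2)[OF that] r(2) by simp
  obtain d where d: "d > 0" "\<And>\<theta>. \<theta> \<in> P \<Longrightarrow> \<bar>\<theta> - s\<bar> < d \<Longrightarrow> \<exists>\<phi>. bij_betw \<phi> (\<sigma> s) (\<sigma> \<theta>) \<and> (\<forall>l\<in>\<sigma> s. dist (\<phi> l) l < r)"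
    using spectrum_perturbation[OF s r(1) sep] by blast
  have near: "\<exists>l\<in>\<sigma> s. dist m l < r" if "\<theta> \<in> P" "\<bar>\<theta> - s\<bar> < d" "m \<in> \<sigma> \<theta>" for \<theta> m
    using d(2)[OF that(1,2)] that(3) by (metis bij_betw_imp_surj_on imageE)
  have unique: "m = m'" if \<theta>: "\<theta> \<in> P" "\<bar>\<theta> - s\<bar> < d" and m: "m \<in> \<sigma> \<theta>" "m' \<in> \<sigma> \<theta>" and l: "l \<in> \<sigma> s" "dist m l \<le> r" "dist m' l \<le> r"
    for \<theta> m m' l
  proof -
    obtain \<phi> where \<phi>: "bij_betw \<phi> (\<sigma> s) (\<sigma> \<theta>)" "\<And>l. l \<in> \<sigma> s \<Longrightarrow> dist (\<phi> l) l < r" using d(2)[OF \<theta>] by blast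
    have "x = \<phi> l" if x: "x \<in> \<sigma> \<theta>" "dist x l \<le> r" for x
    proof -
      obtain k where k: "k \<in> \<sigma> s" "x = \<phi> k" using x(1) \<phi>(1) by (metis bij_betw_imp_surj_on imageE)
      have "dist k l \<le> dist x k + dist x l" by (metis dist_commute dist_triangle)
      then have "dist k l < 4 * r" using \<phi>(2)[OF k(1)] k x r(1) by simp
      then show ?thesis using sep[OF k(1) l(1)] k by force
    qed
    then show ?thesis using m l by metis
  qed
  show ?thesis
  proof (intro exI[of _ d] conjI allI impI)
    fix t t' assume t: "\<bar>t - s\<bar> < d" "\<bar>t' - s\<bar> < d" and log: "has_log_below f t"
    \<comment> \<open>The pieces are closed, as gluing requires. If \<open>t'\<close> is less than
      \<open>t\<close>, the parameter interval and all pieces are empty, so the argument also covers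
      restriction to a smaller parameter.\<close>
    define D where "D l = {m \<in> K. parameter m \<in> {t..t'}} \<inter> cball l r" for l
    have clD: "closed (D l)" for l unfolding D_def by (intro closed_Int closed_parameter_between closed_cball)
    have logD: "\<exists>h. continuous_on (D l) h \<and> (\<forall>m\<in>D l. f m = exp (h m))" if l: "l \<in> \<sigma> s" for l
    proof -
      have fl: "f l \<noteq> 0" using l s spectrum_subset_K f(2) by blast
      \<comment> \<open>The quotient lies within distance 1 of 1, hence off the cut of
        \<open>Ln\<close>.\<close>
      have close: "f m / f l \<notin> \<real>\<^sub>\<le>\<^sub>0" if m: "m \<in> D l" for m
      proof -
        have "dist m l < E l" using m r(1) rE[OF l] E(1)[OF l] by (auto simp: D_def dist_commute)
        then have "cmod (f m - f l) < cmod (f l)" using E(2)[OF l] m by (auto simp: D_def dist_norm)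
        moreover have "f m / f l - 1 = (f m - f l) / f l" using fl by (simp add: field_simps)
        ultimately have "cmod (f m / f l - 1) < 1" using fl by (simp add: norm_divide)
        then show ?thesis using abs_Re_le_cmod[of "f m / f l - 1"] by (auto simp: complex_nonpos_Reals_iff)
      qed
      have "continuous_on (D l) (\<lambda>m. Ln (f m / f l) + Ln (f l))"
        using close fl by (intro continuous_intros continuous_on_subset[OF f(1)]) (auto simp: D_def)
      moreover have "f m = exp (Ln (f m / f l) + Ln (f l))" if "m \<in> D l" for m
      proof -
        have "f m \<noteq> 0" using that f(2) by (auto simp: D_def)
        then show ?thesis using fl by (simp add: exp_add)
      qed
      ultimately show ?thesis by blast
    qed
    let ?S = "{l \<in> K. parameter l \<le> t}"
    \<comment> \<open>A piece can meet the old part only at parameter \<open>t\<close>, where its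
      disc holds at most one eigenvalue. This is the single common point needed for gluing.\<close>
    have fibre: "\<exists>x. \<forall>m\<in>D l. parameter m = t \<longrightarrow> m = x" if l: "l \<in> \<sigma> s" for l
    proof -
      have "m = m'" if "m \<in> D l" "m' \<in> D l" "parameter m = t" "parameter m' = t" for m m'
      proof (rule unique[of t m m' l])
        show "t \<in> P" "m \<in> \<sigma> t" "m' \<in> \<sigma> t" using that parameter_in[of m] parameter_in[of m'] by (auto simp: D_def)
      qed (use that t l in \<open>auto simp: D_def dist_commute\<close>)
      then show ?thesis by metis
    qed
    have disj: "D l \<inter> D l' = {}" if "l \<in> \<sigma> s" "l' \<in> \<sigma> s" "l \<noteq> l'" for l l'
    proof (rule ccontr)
      assume "D l \<inter> D l' \<noteq> {}"
      then obtain m where "dist l m \<le> r" "dist l' m \<le> r" by (auto simp: D_def)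
      moreover have "dist l l' \<le> dist l m + dist l' m" by (metis dist_commute dist_triangle)
      ultimately show False using sep[OF that] r(1) by simp
    qed
    have "finite F \<Longrightarrow> F \<subseteq> \<sigma> s \<Longrightarrow> \<exists>g. continuous_on (?S \<union> (\<Union>l\<in>F. D l)) g \<and>
        (\<forall>m\<in>?S \<union> (\<Union>l\<in>F. D l). f m = exp (g m))" for F
    proof (induction F rule: finite_induct)
      case empty
      then show ?case using log by (auto simp: has_log_below_def)
    next
      case (insert l F)
      then obtain g where g: "continuous_on (?S \<union> (\<Union>l\<in>F. D l)) g"
        "\<And>m. m \<in> ?S \<union> (\<Union>l\<in>F. D l) \<Longrightarrow> f m = exp (g m)" by auto
      obtain h where h: "continuous_on (D l) h" "\<And>m. m \<in> D l \<Longrightarrow> f m = exp (h m)"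
        using logD[of l] insert.prems by auto
      obtain x where x: "\<And>m. m \<in> D l \<Longrightarrow> parameter m = t \<Longrightarrow> m = x" using fibre[of l] insert.prems by auto
      have cl: "closed (?S \<union> (\<Union>l\<in>F. D l))"
        using insert.hyps by (intro closed_Un closed_parameter_between closed_UN ballI clD)
      have "D l \<inter> (\<Union>l\<in>F. D l) = {}" using disj insert.hyps insert.prems by blast
      then have "(?S \<union> (\<Union>l\<in>F. D l)) \<inter> D l \<subseteq> {x}" using x by (fastforce simp: D_def)
      from continuous_log_Un[OF cl clD this g h]
      show ?case by (simp add: Un_ac)
    qed
    from this[of "\<sigma> s"] obtain g where g: "continuous_on (?S \<union> (\<Union>l\<in>\<sigma> s. D l)) g"
        "\<And>m. m \<in> ?S \<union> (\<Union>l\<in>\<sigma> s. D l) \<Longrightarrow> f m = exp (g m)" using finite_\<sigma>[OF s] by auto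
    have sub: "{l \<in> K. parameter l \<le> t'} \<subseteq> ?S \<union> (\<Union>l\<in>\<sigma> s. D l)"
    proof
      fix m assume m: "m \<in> {l \<in> K. parameter l \<le> t'}"
      show "m \<in> ?S \<union> (\<Union>l\<in>\<sigma> s. D l)"
      proof (cases "parameter m \<le> t")
        case False
        then have "\<bar>parameter m - s\<bar> < d" using m t by auto
        then obtain l where "l \<in> \<sigma> s" "dist m l < r" using near[of "parameter m" m] parameter_in[of m] m by auto
        then have "m \<in> D l" using m False by (auto simp: D_def dist_commute)
        then show ?thesis using \<open>l \<in> \<sigma> s\<close> by blast
      qed (use m in auto)
    qed
    show "has_log_below f t'"
      unfolding has_log_below_def using continuous_on_subset[OF g(1) sub] g(2) sub by blast
  qed (use d in simp)
qed

text \<open>Borsuk's criterion asks for a continuous logarithm of every nonvanishing continuous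
  function on \<open>K\<close>. The continuation starts at a parameter below all of
  \<open>P\<close>, where there is nothing to prove, and ends where all of \<open>K\<close> is
  covered.\<close>

lemma connected_Compl_K: "connected (- K)"
proof -
  have "\<exists>g. continuous_on K g \<and> (\<forall>l\<in>K. f l = exp (g l))"
    if f: "continuous_on K f" "f \<in> K \<rightarrow> - {0}" for f :: "complex \<Rightarrow> complex"
  proof -
    have f0: "\<And>l. l \<in> K \<Longrightarrow> f l \<noteq> 0" using f(2) by auto
    obtain B where B: "\<And>\<theta>. \<theta> \<in> P \<Longrightarrow> \<bar>\<theta>\<bar> \<le> B"
      using compact_imp_bounded[OF compact_P] by (auto simp: bounded_iff)
    have "has_log_below f B"
    proof (rule connected_induction_simple[of UNIV "- B - 1" B])
      have "{l \<in> K. parameter l \<le> - B - 1} = {}" using B parameter_in by force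
      then show "has_log_below f (- B - 1)" unfolding has_log_below_def by (metis (mono_tags, lifting) continuous_on_empty empty_Collect_eq)
      fix s :: real
      obtain d where d: "d > 0" "\<And>t t'. \<bar>t - s\<bar> < d \<Longrightarrow> \<bar>t' - s\<bar> < d \<Longrightarrow> has_log_below f t \<Longrightarrow> has_log_below f t'"
        using has_log_below_extend[OF f(1) f0] by blast
      then show "\<exists>T. openin (top_of_set UNIV) T \<and> s \<in> T \<and> (\<forall>x\<in>T. \<forall>y\<in>T. has_log_below f x \<longrightarrow> has_log_below f y)"
        by (intro exI[of _ "ball s d"]) (auto simp: dist_real_def abs_minus_commute)
    qed auto
    moreover have "{l \<in> K. parameter l \<le> B} = K" using B parameter_in by force
    ultimately show ?thesis unfolding has_log_below_def by auto
  qed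
  then have "Borsukian K" by (simp add: Borsukian_continuous_logarithm)
  then show ?thesis using Borsukian_separation_compact[OF compact_K] by simp
qed

text \<open>Taking real parts of the coefficients means averaging the polynomial with its reflection
  in the real axis.\<close>

lemma poly_map_Re: "poly (map_poly of_real (map_poly Re p)) z = (poly p z + cnj (poly p (cnj z))) / 2"
proof (induction p)
  case (pCons a p)
  have "map_poly of_real (map_poly Re (pCons a p)) = pCons (of_real (Re a)) (map_poly of_real (map_poly Re p) :: complex poly)"
    by (simp add: map_poly_pCons)
  moreover have "of_real (Re a) = (a + cnj a) / 2" by (simp add: complex_eq_iff)
  ultimately show ?case using pCons by (simp add: field_simps)
qed auto

text \<open>The symmetry of \<open>K\<close> respects the fibres: \<open>cnj l\<close> belongs to
  the same parameter as \<open>l\<close>. As \<open>g\<close> is real, the error of the averaged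
  polynomial at \<open>l\<close> is the average of the errors at \<open>l\<close> and
  \<open>cnj l\<close>.\<close>

lemma real_poly_approximation:
  fixes g :: "real \<Rightarrow> real"
  assumes g: "continuous_on P g" and e: "e > 0"
  obtains q :: "real poly" where "\<And>\<theta> l. \<theta> \<in> P \<Longrightarrow> l \<in> \<sigma> \<theta> \<Longrightarrow> cmod (poly (map_poly of_real q) l - of_real (g \<theta>)) < e"
proof -
  have "continuous_on K (\<lambda>l. complex_of_real (g (parameter l)))"
    using parameter_in by (intro continuous_intros continuous_on_compose2[OF g] continuous_on_parameter) auto
  from Lavrentiev[OF compact_K interior_K connected_Compl_K this]
  obtain p where p: "\<And>l. l \<in> K \<Longrightarrow> cmod (poly p l - of_real (g (parameter l))) < e"
    using e unfolding poly_approximable_def by blast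
  show ?thesis
  proof (rule that[of "map_poly Re p"])
    fix \<theta> l assume \<theta>: "\<theta> \<in> P" "l \<in> \<sigma> \<theta>"
    let ?g = "complex_of_real (g \<theta>)"
    have l: "l \<in> K" "cnj l \<in> K" "parameter l = \<theta>" "parameter (cnj l) = \<theta>"
      using \<theta> spectrum_cnj[OF \<theta>(2)] spectrum_subset_K parameter_eq by auto
    have "poly (map_poly of_real (map_poly Re p)) l - ?g = ((poly p l - ?g) + cnj (poly p (cnj l) - ?g)) / 2"
      unfolding poly_map_Re by (simp add: field_simps)
    also have "cmod \<dots> \<le> (cmod (poly p l - ?g) + cmod (poly p (cnj l) - ?g)) / 2"
      using norm_triangle_ineq[of "poly p l - ?g" "cnj (poly p (cnj l) - ?g)"]
      unfolding norm_divide complex_mod_cnj by simp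
    also have "\<dots> < e" using p[OF l(1)] p[OF l(2)] l by simp
    finally show "cmod (poly (map_poly of_real (map_poly Re p)) l - ?g) < e" .
  qed
qed

end

section \<open>Polynomials in a matrix\<close>

lemma matrix_vector_mult_smult: "A *v (c *s x) = c *s (A *v x)"
  for A :: "'a::comm_semiring_1^'n^'m"
  by (simp add: vec_eq_iff matrix_vector_mult_def sum_distrib_left mult_ac)

lemma matrix_vector_mult_sum: "A *v (\<Sum>i\<in>I. f i) = (\<Sum>i\<in>I. A *v f i)"
  for A :: "'a::comm_semiring_1^'n^'m"
  by (induction I rule: infinite_finite_induct) (simp_all add: matrix_vector_right_distrib)

text \<open>Horner's scheme for p(A)x. Acting on a vector, it needs neither a ring structure on
  matrices nor the matrix p(A) itself.\<close>

definition poly_apply :: "'a::comm_ring_1 poly \<Rightarrow> 'a^'n^'n \<Rightarrow> 'a^'n \<Rightarrow> 'a^'n" where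
  "poly_apply p A x = fold_coeffs (\<lambda>a y. a *s x + A *v y) p 0"

lemma poly_apply_0 [simp]: "poly_apply 0 A x = 0"
  by (simp add: poly_apply_def)

lemma poly_apply_pCons [simp]: "poly_apply (pCons a p) A x = a *s x + A *v poly_apply p A x"
proof (cases "a = 0 \<and> p = 0")
  case False
  then show ?thesis
    unfolding poly_apply_def
    by (cases "a = 0") (simp_all add: fold_coeffs_pCons_not_0_0_eq fold_coeffs_pCons_coeff_not_0_eq)
qed simp

lemma poly_apply_1 [simp]: "poly_apply 1 A x = x"
  by (simp add: one_pCons)

lemma poly_apply_vector_add: "poly_apply p A (x + y) = poly_apply p A x + poly_apply p A y"
  by (induction p) (simp_all add: matrix_vector_right_distrib vec.scale_right_distrib)

lemma poly_apply_vector_smult: "poly_apply p A (c *s x) = c *s poly_apply p A x"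
  by (induction p) (simp_all add: vec.scale_right_distrib matrix_vector_mult_smult vector_smult_assoc mult.commute)

lemma poly_apply_vector_0 [simp]: "poly_apply p A 0 = 0"
  by (induction p) simp_all

lemma poly_apply_vector_sum: "poly_apply p A (\<Sum>i\<in>I. f i) = (\<Sum>i\<in>I. poly_apply p A (f i))"
  by (induction I rule: infinite_finite_induct) (simp_all add: poly_apply_vector_add)

lemma poly_apply_add: "poly_apply (p + q) A x = poly_apply p A x + poly_apply q A x"
  by (induction p q rule: poly_induct2) (simp_all add: matrix_vector_right_distrib vec.scale_left_distrib algebra_simps)

lemma poly_apply_smult: "poly_apply (smult c p) A x = c *s poly_apply p A x"
  by (induction p) (simp_all add: vec.scale_right_distrib matrix_vector_mult_smult vector_smult_assoc)

lemma poly_apply_minus: "poly_apply (- p) A x = - poly_apply p A x"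
  using poly_apply_smult[of "- 1" p A x] by (simp add: vec_eq_iff)

lemma poly_apply_diff: "poly_apply (p - q) A x = poly_apply p A x - poly_apply q A x"
  using poly_apply_add[of p "- q" A x] by (simp add: poly_apply_minus)

lemma poly_apply_sum: "poly_apply (\<Sum>i\<in>I. p i) A x = (\<Sum>i\<in>I. poly_apply (p i) A x)"
  by (induction I rule: infinite_finite_induct) (simp_all add: poly_apply_add)

lemma poly_apply_mult: "poly_apply (p * q) A x = poly_apply p A (poly_apply q A x)"
  by (induction p) (simp_all add: poly_apply_add poly_apply_smult)

lemma poly_apply_monom_mult: "poly_apply (q * monom 1 k) A x = poly_apply q A (matpow A k *v x)"
proof -
  have "poly_apply (monom 1 k) A x = matpow A k *v x"
    by (induction k) (simp_all add: monom_0 monom_Suc matrix_vector_mul_assoc)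
  then show ?thesis by (simp add: poly_apply_mult)
qed

lemma poly_apply_eigenvector: "A *v w = l *s w \<Longrightarrow> poly_apply p A w = poly p l *s w"
  by (induction p) (simp_all add: matrix_vector_mult_smult vector_smult_assoc vec.scale_left_distrib mult.commute)

text \<open>The length \<open>T\<close> may exceed the degree, so that polynomials of different
  degrees can share one time horizon.\<close>

lemma poly_apply_eq_sum:
  assumes "\<And>k. k \<ge> T \<Longrightarrow> coeff p k = 0"
  shows "poly_apply p A x = (\<Sum>k<T. coeff p k *s (matpow A k *v x))"
  using assms
proof (induction p arbitrary: T)
  case (pCons a p)
  show ?case
  proof (cases T)
    case 0
    then have "pCons a p = 0" using pCons.prems by (intro poly_eqI) auto
    then show ?thesis using pCons.hyps by simp
  next
    case (Suc T')
    have "coeff p k = 0" if "k \<ge> T'" for k using pCons.prems[of "Suc k"] Suc that by simp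
    then have "poly_apply p A x = (\<Sum>k<T'. coeff p k *s (matpow A k *v x))" by (rule pCons.IH)
    then show ?thesis unfolding Suc sum.lessThan_Suc_shift
      by (simp add: matrix_vector_mult_sum matrix_vector_mult_smult matrix_vector_mul_assoc)
  qed
qed simp

section \<open>Lagrange polynomials as spectral projections of a matrix with distinct
  eigenvalues\<close>

definition lagrange_poly :: "'a::field set \<Rightarrow> 'a \<Rightarrow> 'a poly" where
  "lagrange_poly S l = smult (1 / (\<Prod>m\<in>S - {l}. l - m)) (\<Prod>m\<in>S - {l}. [:- m, 1:])"

lemma poly_lagrange_poly:
  assumes "finite S" "l \<in> S" "k \<in> S"
  shows "poly (lagrange_poly S l) k = (if k = l then 1 else 0)"
  using assms by (auto simp: lagrange_poly_def poly_prod prod_zero_iff)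

context
  fixes C :: "'a::field^'n^'n" and S :: "'a set" and W :: "'a \<Rightarrow> 'a^'n"
  assumes fin: "finite S" and card: "card S = CARD('n)"
    and W: "\<And>l. l \<in> S \<Longrightarrow> W l \<noteq> 0" "\<And>l. l \<in> S \<Longrightarrow> C *v W l = l *s W l"
begin

lemma lagrange_poly_eigenvector:
  "l \<in> S \<Longrightarrow> k \<in> S \<Longrightarrow> poly_apply (lagrange_poly S l) C (W k) = (if k = l then W l else 0)"
  using poly_apply_eigenvector[OF W(2)] poly_lagrange_poly[OF fin] by auto

text \<open>Applied to a linear relation among eigenvectors, the Lagrange polynomial of one
  eigenvalue leaves only the corresponding term. This gives independence, and as many independent
  vectors as the dimension span.\<close>

lemma span_eigenvectors: "vec.span (W ` S) = UNIV"
proof -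
  have inj: "inj_on W S"
  proof (rule inj_onI, rule ccontr)
    fix l k assume lk: "l \<in> S" "k \<in> S" "W l = W k" "l \<noteq> k"
    have "W l = poly_apply (lagrange_poly S l) C (W l)" using lagrange_poly_eigenvector[of l l] lk by simp
    also have "\<dots> = 0" using lagrange_poly_eigenvector[of l k] lk by simp
    finally show False using W(1) lk by simp
  qed
  have "\<not> vec.dependent (W ` S)"
  proof
    assume "vec.dependent (W ` S)"
    then obtain u k where u: "(\<Sum>v\<in>W ` S. u v *s v) = 0" "k \<in> S" "u (W k) \<noteq> 0"
      using vec.dependent_finite[of "W ` S"] fin by auto
    have "0 = poly_apply (lagrange_poly S k) C (\<Sum>l\<in>S. u (W l) *s W l)"
      using u(1) by (simp add: sum.reindex[OF inj])
    also have "\<dots> = (\<Sum>l\<in>S. if l = k then u (W k) *s W k else 0)"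
      unfolding poly_apply_vector_sum poly_apply_vector_smult
      by (intro sum.cong) (auto simp: lagrange_poly_eigenvector u(2))
    also have "\<dots> = u (W k) *s W k" using fin u(2) by simp
    finally show False using u W(1) by simp
  qed
  then have "UNIV \<subseteq> vec.span (W ` S)"
    by (intro vec.card_ge_dim_independent) (auto simp: card_image[OF inj] card vec_dim_card card_cart_basis)
  then show ?thesis by blast
qed

text \<open>Both sides are linear in \<open>x\<close> and agree on the eigenvectors, which
  span.\<close>

lemma poly_apply_spectral:
  "poly_apply q C x = (\<Sum>l\<in>S. poly q l *s poly_apply (lagrange_poly S l) C x)"
proof -
  have "x \<in> vec.span (W ` S)" by (simp add: span_eigenvectors)
  then show ?thesis
  proof (induction rule: vec.span_induct_alt)
    case base
    then show ?case by simp
  next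
    case (step c v y)
    then obtain k where k: "k \<in> S" "v = W k" by blast
    have "(\<Sum>l\<in>S. poly q l *s poly_apply (lagrange_poly S l) C v) = (\<Sum>l\<in>S. if l = k then poly q k *s v else 0)"
      by (intro sum.cong) (auto simp: lagrange_poly_eigenvector k)
    also have "\<dots> = poly_apply q C v" using fin k by (simp add: poly_apply_eigenvector W)
    finally have v: "(\<Sum>l\<in>S. poly q l *s poly_apply (lagrange_poly S l) C v) = poly_apply q C v" .
    have "(\<Sum>l\<in>S. poly q l *s poly_apply (lagrange_poly S l) C (c *s v + y)) =
        c *s (\<Sum>l\<in>S. poly q l *s poly_apply (lagrange_poly S l) C v) +
        (\<Sum>l\<in>S. poly q l *s poly_apply (lagrange_poly S l) C y)"
      unfolding poly_apply_vector_add poly_apply_vector_smult vec.scale_right_distrib sum.distrib vec.scale_sum_right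
      by (simp only: vec.scale_left_commute)
    then show ?case
      unfolding v step.IH[symmetric] by (simp only: poly_apply_vector_add poly_apply_vector_smult)
  qed
qed

end

lemma norm_vector_smult: "norm (c *s (x :: 'a::real_normed_field^'n)) = norm c * norm x"
  by (simp add: norm_vec_def norm_mult L2_set_right_distrib)

text \<open>Each factor, the matrix minus a scalar, at most multiplies the norm by 2M.\<close>

lemma norm_poly_apply_prod_le:
  fixes C :: "'a::real_normed_field^'n^'n"
  assumes "finite F" "entry_sum C \<le> M" "\<And>m. m \<in> F \<Longrightarrow> norm m \<le> M"
  shows "norm (poly_apply (\<Prod>m\<in>F. [:- m, 1:]) C x) \<le> (2 * M) ^ card F * norm x"
  using assms(1,3)
proof (induction F rule: finite_induct)
  case (insert m F)
  have M0: "M \<ge> 0" using assms(2) entry_sum_nonneg[of C] by simp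
  let ?y = "poly_apply (\<Prod>m\<in>F. [:- m, 1:]) C x"
  have "poly_apply (\<Prod>m\<in>insert m F. [:- m, 1:]) C x = poly_apply [:- m, 1:] C ?y"
    unfolding prod.insert[OF insert.hyps] by (rule poly_apply_mult)
  also have "\<dots> = C *v ?y - m *s ?y" by simp
  finally have "norm (poly_apply (\<Prod>m\<in>insert m F. [:- m, 1:]) C x) \<le> norm (C *v ?y) + norm (m *s ?y)"
    by (simp only: norm_triangle_ineq4)
  also have "\<dots> \<le> entry_sum C * norm ?y + norm m * norm ?y"
    unfolding norm_vector_smult by (intro add_mono norm_matrix_vector_mult_le order_refl)
  also have "\<dots> \<le> M * norm ?y + M * norm ?y"
    using insert.prems assms(2) by (intro add_mono mult_right_mono) auto
  also have "\<dots> = 2 * M * norm ?y" by simp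
  also have "\<dots> \<le> 2 * M * ((2 * M) ^ card F * norm x)"
    using insert M0 by (intro mult_left_mono) auto
  finally show ?case using insert by simp
qed simp

definition complex_vector :: "real^'n \<Rightarrow> complex^'n" where
  "complex_vector x = (\<chi> i. complex_of_real (x $ i))"

lemma norm_complex_vector [simp]: "norm (complex_vector x) = norm x"
  by (simp add: norm_vec_def complex_vector_def)

lemma complex_vector_diff: "complex_vector (x - y) = complex_vector x - complex_vector y"
  by (simp add: complex_vector_def vec_eq_iff)

lemma complex_vector_smult: "complex_vector (c *s x) = of_real c *s complex_vector x"
  by (simp add: complex_vector_def vec_eq_iff)

lemma complex_vector_poly_apply:
  "complex_vector (poly_apply p A x) = poly_apply (map_poly of_real p) (complex_matrix A) (complex_vector x)"
proof (induction p)
  case 0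
  then show ?case by (simp add: complex_vector_def vec_eq_iff)
next
  case (pCons a p)
  have "map_poly of_real (pCons a p) = pCons (complex_of_real a) (map_poly of_real p)"
    by (simp add: map_poly_pCons)
  moreover have "complex_vector (y + A *v z) = complex_vector y + complex_matrix A *v complex_vector z" for y z
    by (simp add: complex_vector_def complex_matrix_def vec_eq_iff matrix_vector_mult_def)
  ultimately show ?case by (simp add: pCons.IH complex_vector_smult)
qed

section \<open>Estimates uniform in the parameter\<close>

context simple_disjoint_spectra
begin

text \<open>Near \<open>s\<close> the eigenvalues lie within \<open>r\<close> of points that are at
  least 4r apart, so they are at least 2r apart. Finitely many such neighbourhoods cover the compact
  set \<open>P\<close>.\<close>

lemma uniform_separation:
  obtains d where "d > 0" "\<And>\<theta> l l'. \<theta> \<in> P \<Longrightarrow> l \<in> \<sigma> \<theta> \<Longrightarrow> l' \<in> \<sigma> \<theta> \<Longrightarrow> l \<noteq> l' \<Longrightarrow> d \<le> dist l l'"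
proof -
  have "\<exists>r>0. \<exists>e>0. \<forall>\<theta>\<in>P. \<bar>\<theta> - s\<bar> < e \<longrightarrow> (\<forall>l\<in>\<sigma> \<theta>. \<forall>l'\<in>\<sigma> \<theta>. l \<noteq> l' \<longrightarrow> r \<le> dist l l')" if s: "s \<in> P" for s
  proof -
    obtain r where r: "r > 0" "\<And>l l'. l \<in> \<sigma> s \<Longrightarrow> l' \<in> \<sigma> s \<Longrightarrow> l \<noteq> l' \<Longrightarrow> 4 * r \<le> dist l l'"
      using spectrum_separated[OF s] by blast
    obtain e where e: "e > 0" "\<And>\<theta>. \<theta> \<in> P \<Longrightarrow> \<bar>\<theta> - s\<bar> < e \<Longrightarrow> \<exists>\<phi>. bij_betw \<phi> (\<sigma> s) (\<sigma> \<theta>) \<and> (\<forall>l\<in>\<sigma> s. dist (\<phi> l) l < r)"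
      using spectrum_perturbation[OF s r] by blast
    have "r \<le> dist l l'" if \<theta>: "\<theta> \<in> P" "\<bar>\<theta> - s\<bar> < e" and l: "l \<in> \<sigma> \<theta>" "l' \<in> \<sigma> \<theta>" "l \<noteq> l'" for \<theta> l l'
    proof -
      obtain \<phi> where \<phi>: "bij_betw \<phi> (\<sigma> s) (\<sigma> \<theta>)" "\<And>l. l \<in> \<sigma> s \<Longrightarrow> dist (\<phi> l) l < r" using e(2)[OF \<theta>] by blast
      obtain k k' where k: "k \<in> \<sigma> s" "k' \<in> \<sigma> s" "l = \<phi> k" "l' = \<phi> k'"
        using l \<phi>(1) by (metis bij_betw_imp_surj_on imageE)
      have "4 * r \<le> dist k k'" using r(2)[OF k(1,2)] k l by blast
      moreover have "dist k k' \<le> dist l k + dist l l' + dist l' k'"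
        by (metis add.commute add_left_mono dist_commute dist_triangle dist_triangle_le)
      ultimately show ?thesis using \<phi>(2)[OF k(1)] \<phi>(2)[OF k(2)] k r(1) by simp
    qed
    then show ?thesis using r(1) e(1) by blast
  qed
  then obtain r e where re: "\<And>s. s \<in> P \<Longrightarrow> r s > 0" "\<And>s. s \<in> P \<Longrightarrow> e s > 0"
    "\<And>s \<theta> l l'. s \<in> P \<Longrightarrow> \<theta> \<in> P \<Longrightarrow> \<bar>\<theta> - s\<bar> < e s \<Longrightarrow> l \<in> \<sigma> \<theta> \<Longrightarrow> l' \<in> \<sigma> \<theta> \<Longrightarrow> l \<noteq> l' \<Longrightarrow> r s \<le> dist l l'"
    by metis
  obtain C where C: "C \<subseteq> P" "finite C" "P \<subseteq> (\<Union>s\<in>C. ball s (e s))"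
    by (rule compactE_image[OF compact_P, of P "\<lambda>s. ball s (e s)"]) (use re(2) in force)+
  show ?thesis
  proof (rule that[of "Min (insert 1 (r ` C))"])
    show "Min (insert 1 (r ` C)) > 0" using C re(1) by (subst Min_gr_iff) auto
    fix \<theta> l l' assume \<theta>: "\<theta> \<in> P" "l \<in> \<sigma> \<theta>" "l' \<in> \<sigma> \<theta>" "l \<noteq> l'"
    then obtain s where s: "s \<in> C" "\<bar>\<theta> - s\<bar> < e s" using C(3) by (auto simp: dist_real_def abs_minus_commute)
    have "Min (insert 1 (r ` C)) \<le> r s" using C(2) s(1) by (intro Min_le) auto
    also have "\<dots> \<le> dist l l'" using re(3)[of s \<theta> l l'] s \<theta> C(1) by blast
    finally show "Min (insert 1 (r ` C)) \<le> dist l l'" .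
  qed
qed

text \<open>By the spectral formula only the values of q - g on the spectrum matter. Each Lagrange
  projection has norm at most (2M/d)^(n-1), so \<open>c\<close> depends neither on \<open>q\<close>
  nor on its degree.\<close>

lemma norm_poly_apply_diff_le:
  obtains c where "c > 0"
    "\<And>\<theta> q g e x. \<theta> \<in> P \<Longrightarrow> (\<And>l. l \<in> \<sigma> \<theta> \<Longrightarrow> cmod (poly (map_poly of_real q) l - of_real g) \<le> e) \<Longrightarrow>
       norm (poly_apply q (A \<theta>) x - g *s x) \<le> c * e * norm x"
proof -
  obtain M where M: "M \<ge> 0" "\<And>\<theta>. \<theta> \<in> P \<Longrightarrow> entry_sum (A \<theta>) \<le> M" using entry_sum_bound by blast
  obtain d where d: "d > 0" "\<And>\<theta> l l'. \<theta> \<in> P \<Longrightarrow> l \<in> \<sigma> \<theta> \<Longrightarrow> l' \<in> \<sigma> \<theta> \<Longrightarrow> l \<noteq> l' \<Longrightarrow> d \<le> dist l l'"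
    using uniform_separation by blast
  let ?n = "CARD('n)"
  \<comment> \<open>The summand 1 keeps \<open>c\<close> positive when the other summand
    vanishes.\<close>
  define c where "c = real ?n * (1 / d ^ (?n - 1) * (2 * M) ^ (?n - 1)) + 1"
  have c0: "1 / d ^ (?n - 1) * (2 * M) ^ (?n - 1) \<ge> 0" using d M by simp
  show ?thesis
  proof (rule that[of c])
    show "c > 0" using mult_nonneg_nonneg[OF of_nat_0_le_iff[of ?n] c0] unfolding c_def by linarith
    fix \<theta> q g e and x :: "real^'n"
    assume \<theta>: "\<theta> \<in> P" and qg: "\<And>l. l \<in> \<sigma> \<theta> \<Longrightarrow> cmod (poly (map_poly of_real q) l - of_real g) \<le> e"
    let ?C = "complex_matrix (A \<theta>)" and ?S = "\<sigma> \<theta>" and ?x = "complex_vector x"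
    let ?q = "map_poly of_real q - [:complex_of_real g:]"
    have "\<exists>w. w \<noteq> 0 \<and> ?C *v w = l *s w" if "l \<in> ?S" for l using that by (auto simp: spectrum_def)
    then obtain W where W: "\<And>l. l \<in> ?S \<Longrightarrow> W l \<noteq> 0" "\<And>l. l \<in> ?S \<Longrightarrow> ?C *v W l = l *s W l" by metis
    have ge: "e \<ge> 0"
    proof -
      obtain l where "l \<in> ?S" using card_\<sigma>[OF \<theta>] by (metis card.empty ex_in_conv zero_less_card_finite less_irrefl)
      then show ?thesis using qg[of l] norm_ge_zero order_trans by blast
    qed
    have lag: "norm (poly_apply (lagrange_poly ?S l) ?C ?x) \<le> 1 / d ^ (?n - 1) * (2 * M) ^ (?n - 1) * norm x"
      if l: "l \<in> ?S" for l
    proof -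
      have cd: "card (?S - {l}) = ?n - 1" using l card_\<sigma>[OF \<theta>] finite_\<sigma>[OF \<theta>] by (simp add: card_Diff_singleton)
      have "d ^ (?n - 1) = (\<Prod>m\<in>?S - {l}. d)" by (simp add: cd)
      also have "\<dots> \<le> (\<Prod>m\<in>?S - {l}. cmod (l - m))"
        using d(1) d(2)[OF \<theta> l] by (intro prod_mono) (auto simp: dist_norm)
      finally have den: "d ^ (?n - 1) \<le> cmod (\<Prod>m\<in>?S - {l}. l - m)" by (simp add: prod_norm)
      have "cmod m \<le> M" if "m \<in> ?S" for m
        using norm_spectrum_le[OF that] M(2)[OF \<theta>] by linarith
      then have "norm (poly_apply (\<Prod>m\<in>?S - {l}. [:- m, 1:]) ?C ?x) \<le> (2 * M) ^ card (?S - {l}) * norm ?x"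
        using finite_\<sigma>[OF \<theta>] M(2)[OF \<theta>]
        by (intro norm_poly_apply_prod_le) (auto simp: entry_sum_complex_matrix)
      then have num: "norm (poly_apply (\<Prod>m\<in>?S - {l}. [:- m, 1:]) ?C ?x) \<le> (2 * M) ^ (?n - 1) * norm x"
        by (simp add: cd)
      have "norm (poly_apply (lagrange_poly ?S l) ?C ?x) =
          1 / cmod (\<Prod>m\<in>?S - {l}. l - m) * norm (poly_apply (\<Prod>m\<in>?S - {l}. [:- m, 1:]) ?C ?x)"
        by (simp add: lagrange_poly_def poly_apply_smult norm_vector_smult norm_divide)
      also have "\<dots> \<le> 1 / d ^ (?n - 1) * ((2 * M) ^ (?n - 1) * norm x)"
        using den num d(1) by (intro mult_mono frac_le) auto
      finally show ?thesis by simp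
    qed
    have "norm (poly_apply q (A \<theta>) x - g *s x) = norm (complex_vector (poly_apply q (A \<theta>) x - g *s x))" by simp
    also have "\<dots> = norm (poly_apply ?q ?C ?x)"
      by (simp add: complex_vector_diff complex_vector_smult complex_vector_poly_apply poly_apply_diff)
    also have "\<dots> = norm (\<Sum>l\<in>?S. poly ?q l *s poly_apply (lagrange_poly ?S l) ?C ?x)"
      by (subst poly_apply_spectral[OF finite_\<sigma>[OF \<theta>] card_\<sigma>[OF \<theta>] W]) auto
    also have "\<dots> \<le> (\<Sum>l\<in>?S. e * (1 / d ^ (?n - 1) * (2 * M) ^ (?n - 1) * norm x))"
    proof (rule sum_norm_le)
      fix l assume l: "l \<in> ?S"
      show "norm (poly ?q l *s poly_apply (lagrange_poly ?S l) ?C ?x) \<le> e * (1 / d ^ (?n - 1) * (2 * M) ^ (?n - 1) * norm x)"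
        unfolding norm_vector_smult using qg[OF l] lag[OF l] ge by (intro mult_mono) auto
    qed
    also have "\<dots> = (c - 1) * e * norm x" by (simp add: c_def card_\<sigma> \<theta>)
    also have "\<dots> \<le> c * e * norm x" using ge by (intro mult_right_mono) auto
    finally show "norm (poly_apply q (A \<theta>) x - g *s x) \<le> c * e * norm x" .
  qed
qed

lemma scalar_function_approximation:
  fixes g :: "real \<Rightarrow> real"
  assumes g: "continuous_on P g" and e: "e > 0"
  obtains q where "\<And>\<theta> x. \<theta> \<in> P \<Longrightarrow> norm (poly_apply q (A \<theta>) x - g \<theta> *s x) \<le> e * norm x"
proof -
  obtain c where c: "c > 0"
    "\<And>\<theta> q g e x. \<theta> \<in> P \<Longrightarrow> (\<And>l. l \<in> \<sigma> \<theta> \<Longrightarrow> cmod (poly (map_poly of_real q) l - of_real g) \<le> e) \<Longrightarrow>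
       norm (poly_apply q (A \<theta>) x - g *s x) \<le> c * e * norm x"
    using norm_poly_apply_diff_le by blast
  obtain q where q: "\<And>\<theta> l. \<theta> \<in> P \<Longrightarrow> l \<in> \<sigma> \<theta> \<Longrightarrow> cmod (poly (map_poly of_real q) l - of_real (g \<theta>)) < e / c"
    using real_poly_approximation[OF g, of "e / c"] e c(1) by (auto intro: divide_pos_pos)
  show ?thesis
  proof (rule that[of q])
    fix \<theta> x assume \<theta>: "\<theta> \<in> P"
    have "norm (poly_apply q (A \<theta>) x - g \<theta> *s x) \<le> c * (e / c) * norm x"
      using q[OF \<theta>] by (intro c(2) \<theta>) (auto intro: less_imp_le)
    then show "norm (poly_apply q (A \<theta>) x - g \<theta> *s x) \<le> e * norm x" using c(1) by simp
  qed
qed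

end

section \<open>Discrete time\<close>

lemma continuous_on_matrix_mult [continuous_intros]:
  fixes A :: "'b::topological_space \<Rightarrow> 'a::real_normed_algebra_1^'n^'m"
  assumes "continuous_on P A" "continuous_on P B"
  shows "continuous_on P (\<lambda>\<theta>. A \<theta> ** B \<theta>)"
  unfolding matrix_matrix_mult_def by (intro continuous_intros assms)

lemma continuous_on_matrix_vector_mult [continuous_intros]:
  fixes A :: "'b::topological_space \<Rightarrow> 'a::real_normed_algebra_1^'n^'m"
  assumes "continuous_on P A" "continuous_on P x"
  shows "continuous_on P (\<lambda>\<theta>. A \<theta> *v x \<theta>)"
  unfolding matrix_vector_mult_def by (intro continuous_intros assms)

lemma continuous_on_matpow [continuous_intros]:
  fixes A :: "'b::topological_space \<Rightarrow> 'a::real_normed_algebra_1^'n^'n"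
  assumes "continuous_on P A"
  shows "continuous_on P (\<lambda>\<theta>. matpow (A \<theta>) k)"
  by (induction k) (auto intro!: continuous_intros assms)

lemma continuous_on_column [continuous_intros]:
  fixes A :: "'b::topological_space \<Rightarrow> 'a::real_normed_algebra_1^'n^'m"
  assumes "continuous_on P A"
  shows "continuous_on P (\<lambda>\<theta>. column j (A \<theta>))"
  unfolding column_def by (intro continuous_intros assms)

lemma continuous_on_det [continuous_intros]:
  fixes A :: "'b::topological_space \<Rightarrow> real^'n^'n"
  assumes "continuous_on P A"
  shows "continuous_on P (\<lambda>\<theta>. det (A \<theta>))"
  unfolding det_def by (intro continuous_intros assms)

text \<open>Gram matrix argument: the quadratic form of R R^T at v is the squared norm of R^T v, and
  R^T is injective when R has full row rank.\<close>

lemma det_mult_transpose_nonzero: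
  fixes R :: "real^'k^'n"
  assumes "rank R = CARD('n)"
  shows "det (R ** transpose R) \<noteq> 0"
proof -
  have inj: "inj ((*v) (transpose R))"
    using assms by (simp add: full_rank_injective[symmetric] rank_transpose)
  have "v = 0" if "(R ** transpose R) *v v = 0" for v
  proof -
    have "(transpose R *v v) \<bullet> (transpose R *v v) = v \<bullet> ((R ** transpose R) *v v)"
      by (simp add: dot_lmul_matrix[symmetric] matrix_vector_mul_assoc[symmetric] transpose_matrix_vector)
    then have "transpose R *v v = transpose R *v 0" using that by simp
    then show ?thesis using inj by (rule injD[rotated])
  qed
  then show ?thesis
    using matrix_left_invertible_ker invertible_left_inverse invertible_det_nz by metis
qed

text \<open>The coefficients are the least-squares solution y = R^T (R R^T)^(-1) x. One formula
  serves for all parameters, so continuity holds without any choice of a basis among the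
  columns.\<close>

lemma continuous_spanning_coefficients:
  fixes A :: "real \<Rightarrow> real^'n^'n" and B :: "real \<Rightarrow> real^'m^'n" and x :: "real \<Rightarrow> real^'n"
  assumes A: "continuous_on P A" and B: "continuous_on P B" and x: "continuous_on P x"
    and R: "\<And>\<theta>. \<theta> \<in> P \<Longrightarrow> reachable (A \<theta>) (B \<theta>)"
  obtains y :: "real \<Rightarrow> real^('n \<times> 'm)" where "continuous_on P y"
    "\<And>\<theta>. \<theta> \<in> P \<Longrightarrow> x \<theta> = (\<Sum>p\<in>UNIV. y \<theta> $ p *s (matpow (A \<theta>) (exponent (fst p)) *v column (snd p) (B \<theta>)))"
proof -
  define R where "R \<theta> = reachability_matrix (A \<theta>) (B \<theta>)" for \<theta>
  define S where "S \<theta> = R \<theta> ** transpose (R \<theta>)" for \<theta>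
  have contR: "continuous_on P R"
    unfolding R_def reachability_matrix_def by (intro continuous_intros A B)
  have contRT: "continuous_on P (\<lambda>\<theta>. transpose (R \<theta>))"
    unfolding transpose_def by (intro continuous_intros contR)
  have contS: "continuous_on P S"
    unfolding S_def by (intro continuous_intros contR contRT)
  have det: "det (S \<theta>) \<noteq> 0" if "\<theta> \<in> P" for \<theta>
    unfolding S_def using assms(4)[OF that] by (intro det_mult_transpose_nonzero) (simp add: R_def reachable_def)
  \<comment> \<open>Cramer's rule writes the solution of S z = x as quotients of determinants, which
    makes its continuity visible.\<close>
  define z where "z \<theta> = (\<chi> k. det (\<chi> i j. if j = k then x \<theta> $ i else S \<theta> $ i $ j) / det (S \<theta>))" for \<theta>
  have "continuous_on P (\<lambda>\<theta>. if j = k then x \<theta> $ i else S \<theta> $ i $ j)" for i j k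
    by (cases "j = k") (auto intro!: continuous_intros x contS)
  then have contz: "continuous_on P z"
    unfolding z_def using det by (intro continuous_intros contS) auto
  have z: "S \<theta> *v z \<theta> = x \<theta>" if "\<theta> \<in> P" for \<theta>
    using cramer[OF det[OF that]] by (simp add: z_def)
  show ?thesis
  proof (rule that[of "\<lambda>\<theta>. transpose (R \<theta>) *v z \<theta>"])
    show "continuous_on P (\<lambda>\<theta>. transpose (R \<theta>) *v z \<theta>)" by (intro continuous_intros contRT contz)
    fix \<theta> assume \<theta>: "\<theta> \<in> P"
    have col: "column p (R \<theta>) = matpow (A \<theta>) (exponent (fst p)) *v column (snd p) (B \<theta>)" for p
      by (simp add: R_def reachability_matrix_def column_def vec_eq_iff matrix_matrix_mult_def matrix_vector_mult_def)
    have "x \<theta> = R \<theta> *v (transpose (R \<theta>) *v z \<theta>)"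
      using z[OF \<theta>, symmetric] by (simp only: S_def matrix_vector_mul_assoc)
    also have "\<dots> = (\<Sum>p\<in>UNIV. (transpose (R \<theta>) *v z \<theta>) $ p *s column p (R \<theta>))"
      by (rule matrix_mult_sum)
    finally show "x \<theta> = (\<Sum>p\<in>UNIV. (transpose (R \<theta>) *v z \<theta>) $ p *s (matpow (A \<theta>) (exponent (fst p)) *v column (snd p) (B \<theta>)))"
      by (simp only: col)
  qed
qed

lemma compact_bounded_function:
  fixes f :: "'a::topological_space \<Rightarrow> 'b::real_normed_vector"
  assumes "compact P" "continuous_on P f"
  obtains M where "M > 0" "\<And>\<theta>. \<theta> \<in> P \<Longrightarrow> norm (f \<theta>) \<le> M"
proof -
  have "bounded (f ` P)" using assms by (intro compact_imp_bounded compact_continuous_image)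
  then show ?thesis using that by (auto simp: bounded_pos)
qed

text \<open>Each continuous scalar coefficient of \<open>A\<^sup>k b\<^sub>j\<close> is replaced by
  a polynomial \<open>q\<close> in the matrix. The power k is absorbed into the polynomial, and the
  terms with the same column are collected in \<open>Q j\<close>.\<close>

lemma (in simple_disjoint_spectra) poly_apply_approximation:
  fixes B :: "real \<Rightarrow> real^'m^'n" and x :: "real \<Rightarrow> real^'n"
  assumes B: "continuous_on P B" and x: "continuous_on P x"
    and reach: "\<And>\<theta>. \<theta> \<in> P \<Longrightarrow> reachable (A \<theta>) (B \<theta>)" and e: "e > 0"
  obtains Q :: "'m \<Rightarrow> real poly" where
    "\<And>\<theta>. \<theta> \<in> P \<Longrightarrow> norm ((\<Sum>j\<in>UNIV. poly_apply (Q j) (A \<theta>) (column j (B \<theta>))) - x \<theta>) \<le> e"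
proof -
  obtain y :: "real \<Rightarrow> real^('n \<times> 'm)" where y: "continuous_on P y"
    "\<And>\<theta>. \<theta> \<in> P \<Longrightarrow> x \<theta> = (\<Sum>p\<in>UNIV. y \<theta> $ p *s (matpow (A \<theta>) (exponent (fst p)) *v column (snd p) (B \<theta>)))"
    using continuous_spanning_coefficients[OF continuous_A B x reach] by blast
  define v where "v p \<theta> = matpow (A \<theta>) (exponent (fst p)) *v column (snd p) (B \<theta>)" for p :: "'n \<times> 'm" and \<theta>
  have "\<exists>M>0. \<forall>\<theta>\<in>P. norm (v p \<theta>) \<le> M" for p
  proof -
    have "continuous_on P (v p)" unfolding v_def by (intro continuous_intros continuous_A B)
    from compact_bounded_function[OF compact_P this] show ?thesis by metis
  qed
  then obtain M where M: "\<And>p. M p > 0" "\<And>p \<theta>. \<theta> \<in> P \<Longrightarrow> norm (v p \<theta>) \<le> M p" by metis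
  define N where "N = real CARD('n \<times> 'm)"
  have N: "N > 0" by (simp add: N_def)
  have "\<exists>q. \<forall>\<theta>\<in>P. \<forall>w. norm (poly_apply q (A \<theta>) w - y \<theta> $ p *s w) \<le> e / (N * M p) * norm w" for p
    by (rule scalar_function_approximation[of "\<lambda>\<theta>. y \<theta> $ p" "e / (N * M p)"])
      (use e N M(1) in \<open>auto intro!: continuous_intros y\<close>)
  then obtain q where q: "\<And>p \<theta> w. \<theta> \<in> P \<Longrightarrow> norm (poly_apply (q p) (A \<theta>) w - y \<theta> $ p *s w) \<le> e / (N * M p) * norm w"
    by metis
  define Q where "Q j = (\<Sum>k\<in>UNIV. q (k, j) * monom 1 (exponent (k :: 'n)))" for j
  show ?thesis
  proof (rule that[of Q])
    fix \<theta> assume \<theta>: "\<theta> \<in> P"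
    have "(\<Sum>j\<in>UNIV. poly_apply (Q j) (A \<theta>) (column j (B \<theta>))) =
        (\<Sum>j\<in>UNIV. \<Sum>k\<in>UNIV. poly_apply (q (k, j)) (A \<theta>) (v (k, j) \<theta>))"
      by (simp add: Q_def poly_apply_sum poly_apply_monom_mult v_def)
    also have "\<dots> = (\<Sum>p\<in>UNIV. poly_apply (q p) (A \<theta>) (v p \<theta>))"
      by (subst sum.swap) (simp add: sum.cartesian_product)
    finally have "norm ((\<Sum>j\<in>UNIV. poly_apply (Q j) (A \<theta>) (column j (B \<theta>))) - x \<theta>) =
        norm (\<Sum>p\<in>UNIV. poly_apply (q p) (A \<theta>) (v p \<theta>) - y \<theta> $ p *s v p \<theta>)"
      using y(2)[OF \<theta>] by (simp add: sum_subtractf v_def)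
    also have "\<dots> \<le> (\<Sum>p\<in>(UNIV :: ('n \<times> 'm) set). e / N)"
    proof (rule sum_norm_le)
      fix p :: "'n \<times> 'm"
      have "norm (poly_apply (q p) (A \<theta>) (v p \<theta>) - y \<theta> $ p *s v p \<theta>) \<le> e / (N * M p) * norm (v p \<theta>)" by (rule q[OF \<theta>])
      also have "\<dots> \<le> e / (N * M p) * M p" using e N M(1)[of p] M(2)[OF \<theta>] by (intro mult_left_mono) auto
      also have "\<dots> = e / N" using M(1)[of p] by simp
      finally show "norm (poly_apply (q p) (A \<theta>) (v p \<theta>) - y \<theta> $ p *s v p \<theta>) \<le> e / N" .
    qed
    also have "\<dots> = e" using N by (simp add: N_def)
    finally show "norm ((\<Sum>j\<in>UNIV. poly_apply (Q j) (A \<theta>) (column j (B \<theta>))) - x \<theta>) \<le> e" .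
  qed
qed

lemma matrix_vector_mult_eq_sum_columns: "B *v u = (\<Sum>j\<in>UNIV. u $ j *s column j (B :: 'a::comm_semiring_1^'m^'n))"
  by (rule matrix_mult_sum)

text \<open>The quantifier order is the point: \<open>T\<close> and \<open>u\<close> depend only on
  the polynomials, so one input serves the whole ensemble.\<close>

lemma phi_discrete_eq_poly_apply:
  fixes Q :: "'m::finite \<Rightarrow> real poly"
  shows "\<exists>T>0. \<exists>u. \<forall>(A :: real^'n^'n) B. phi_discrete A B u T = (\<Sum>j\<in>UNIV. poly_apply (Q j) A (column j B))"
proof -
  define T where "T = Suc (\<Sum>j\<in>UNIV. degree (Q j))"
  have deg: "coeff (Q j) k = 0" if "k \<ge> T" for j k
  proof -
    have "degree (Q j) \<le> (\<Sum>j\<in>UNIV. degree (Q j))" by (intro member_le_sum) auto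
    then show ?thesis using that by (intro coeff_eq_0) (simp add: T_def)
  qed
  \<comment> \<open>Inputs act backwards in time: the coefficient of degree k is applied k steps
    before the last input.\<close>
  define u where "u i = (\<chi> j. coeff (Q j) (T - 1 - i))" for i
  show ?thesis
  proof (intro exI[of _ T] exI[of _ u] conjI allI)
    show "T > 0" by (simp add: T_def)
    fix A :: "real^'n^'n" and B :: "real^'m^'n"
    have "phi_discrete A B u T = (\<Sum>k<T. \<Sum>j\<in>UNIV. coeff (Q j) k *s (matpow A k *v column j B))"
      unfolding phi_discrete_def
    proof (intro sum.cong refl)
      fix k assume "k \<in> {..<T}"
      then have "u (T - 1 - k) $ j = coeff (Q j) k" for j by (simp add: u_def)
      then show "matpow A k *v (B *v u (T - 1 - k)) = (\<Sum>j\<in>UNIV. coeff (Q j) k *s (matpow A k *v column j B))"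
        by (simp add: matrix_vector_mult_eq_sum_columns[of B] matrix_vector_mult_sum matrix_vector_mult_smult)
    qed
    also have "\<dots> = (\<Sum>j\<in>UNIV. poly_apply (Q j) A (column j B))"
      by (subst sum.swap) (intro sum.cong refl poly_apply_eq_sum[symmetric] deg)
    finally show "phi_discrete A B u T = (\<Sum>j\<in>UNIV. poly_apply (Q j) A (column j B))" .
  qed
qed

text \<open>A pointwise strict bound by \<open>\<epsilon>\<close> would not make the supremum
  strictly smaller, hence the margin in the assumption.\<close>

lemma SUP_norm_less:
  assumes "\<And>\<theta>. \<theta> \<in> P \<Longrightarrow> norm (f \<theta>) \<le> \<epsilon> / 2" "\<epsilon> > 0"
  shows "(SUP \<theta>\<in>P. ereal (norm (f \<theta>))) < ereal \<epsilon>"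
proof -
  have "(SUP \<theta>\<in>P. ereal (norm (f \<theta>))) \<le> ereal (\<epsilon> / 2)" using assms(1) by (intro SUP_least) simp
  also have "\<dots> < ereal \<epsilon>" using assms(2) by simp
  finally show ?thesis .
qed

lemma (in simple_disjoint_spectra) uniformly_ensemble_controllable_discrete:
  fixes B :: "real \<Rightarrow> real^'m^'n"
  assumes B: "continuous_on P B" and reach: "\<And>\<theta>. \<theta> \<in> P \<Longrightarrow> reachable (A \<theta>) (B \<theta>)"
  shows "uniformly_ensemble_controllable_discrete P A B"
  unfolding uniformly_ensemble_controllable_discrete_def
proof (intro allI impI)
  fix x :: "real \<Rightarrow> real^'n" and \<epsilon> :: real
  assume x: "continuous_on P x" and \<epsilon>: "\<epsilon> > 0"
  obtain Q :: "'m \<Rightarrow> real poly" where Q: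
    "\<And>\<theta>. \<theta> \<in> P \<Longrightarrow> norm ((\<Sum>j\<in>UNIV. poly_apply (Q j) (A \<theta>) (column j (B \<theta>))) - x \<theta>) \<le> \<epsilon> / 2"
    using poly_apply_approximation[OF B x reach, of "\<epsilon> / 2"] \<epsilon> by auto
  obtain T u where Tu: "T > 0" "\<And>A B. phi_discrete A B u T = (\<Sum>j\<in>UNIV. poly_apply (Q j) (A :: real^'n^'n) (column j B))"
    using phi_discrete_eq_poly_apply[of Q] by blast
  show "\<exists>T>0. \<exists>u. (SUP \<theta>\<in>P. ereal (norm (phi_discrete (A \<theta>) (B \<theta>) u T - x \<theta>))) < ereal \<epsilon>"
    using Tu Q \<epsilon> by (intro exI[of _ T] conjI exI[of _ u] SUP_norm_less) auto
qed

section \<open>Continuous time\<close>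

lemma matpow_scaleR: "matpow (t *\<^sub>R A) k = t ^ k *\<^sub>R matpow (A :: real^'n^'n) k"
proof (induction k)
  case (Suc k)
  have "(t *\<^sub>R A) ** (t ^ k *\<^sub>R matpow A k) = (t * t ^ k) *\<^sub>R (A ** matpow A k)"
    by (simp add: vec_eq_iff matrix_matrix_mult_def sum_distrib_left mult_ac)
  then show ?case using Suc by simp
qed simp

lemma norm_matpow_mult_vector_le: "norm (matpow A k *v x) \<le> entry_sum A ^ k * norm (x :: real^'n)"
proof (induction k)
  case (Suc k)
  have "norm (matpow A (Suc k) *v x) \<le> entry_sum A * norm (matpow A k *v x)"
    using norm_matrix_vector_mult_le[of A "matpow A k *v x"] by (simp add: matrix_vector_mul_assoc)
  also have "\<dots> \<le> entry_sum A * (entry_sum A ^ k * norm x)"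
    by (intro mult_left_mono Suc entry_sum_nonneg)
  finally show ?case by (simp add: mult.assoc)
qed simp

lemma matexp_mult_vector_sums:
  fixes A :: "real^'n^'n" and x :: "real^'n"
  shows "(\<lambda>k. (t ^ k / fact k) *\<^sub>R (matpow A k *v x)) sums (matexp (t *\<^sub>R A) *v x)"
proof -
  have "bounded_linear (\<lambda>X :: real^'n^'n. X *v x :: real^'n)"
    by (intro linear_conv_bounded_linear[THEN iffD1] linearI)
      (simp_all add: matrix_vector_mult_add_rdistrib scaleR_matrix_vector_assoc)
  from bounded_linear.sums[OF this matexp_sums[of "t *\<^sub>R A"]]
  show ?thesis by (simp add: matpow_scaleR scaleR_matrix_vector_assoc[symmetric])
qed

text \<open>The tail is dominated termwise by the exponential series of \<open>M\<close>; since
  \<open>t \<le> 1\<close>, the power \<open>t ^ k\<close> can be factored out. For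
  \<open>k = 0\<close> this bounds the exponential itself.\<close>

lemma matexp_taylor:
  assumes t: "0 \<le> t" "t \<le> 1" and M: "entry_sum A \<le> M"
  shows "norm (matexp (t *\<^sub>R A) *v x - (\<Sum>i<k. (t ^ i / fact i) *\<^sub>R (matpow A i *v x))) \<le> t ^ k * exp M * norm x"
proof -
  have M0: "M \<ge> 0" using M entry_sum_nonneg[of A] by simp
  let ?f = "\<lambda>i. (t ^ i / fact i) *\<^sub>R (matpow A i *v x)"
  let ?g = "\<lambda>i. M ^ i /\<^sub>R fact i"
  have f: "(\<lambda>i. ?f (i + k)) sums (matexp (t *\<^sub>R A) *v x - (\<Sum>i<k. ?f i))"
    by (rule sums_split_initial_segment[OF matexp_mult_vector_sums])
  have "(\<lambda>i. ?g (i + k)) sums (exp M - (\<Sum>i<k. ?g i))"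
    by (rule sums_split_initial_segment[OF exp_converges])
  then have g: "(\<lambda>i. t ^ k * norm x * ?g (i + k)) sums (t ^ k * norm x * (exp M - (\<Sum>i<k. ?g i)))"
    by (rule sums_mult)
  have "norm (matexp (t *\<^sub>R A) *v x - (\<Sum>i<k. ?f i)) \<le> t ^ k * norm x * (exp M - (\<Sum>i<k. ?g i))"
  proof (rule norm_sums_le[OF f g])
    fix i
    have "norm (matpow A (i + k) *v x) \<le> entry_sum A ^ (i + k) * norm x" by (rule norm_matpow_mult_vector_le)
    also have "\<dots> \<le> M ^ (i + k) * norm x"
      using M entry_sum_nonneg by (intro mult_right_mono power_mono) auto
    finally have 1: "norm (matpow A (i + k) *v x) \<le> M ^ (i + k) * norm x" .
    have "t ^ (i + k) \<le> t ^ k" using t by (intro power_decreasing) auto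
    then have "t ^ (i + k) / fact (i + k) * norm (matpow A (i + k) *v x) \<le> t ^ k / fact (i + k) * (M ^ (i + k) * norm x)"
      using t 1 by (intro mult_mono divide_right_mono) auto
    then show "norm (?f (i + k)) \<le> t ^ k * norm x * ?g (i + k)"
      using t by (simp add: divide_inverse mult_ac)
  qed
  also have "\<dots> \<le> t ^ k * norm x * exp M"
    using t M0 by (intro mult_left_mono) (auto intro!: sum_nonneg)
  finally show ?thesis by (simp add: mult_ac)
qed

lemma measurable_matexp_mult_vector:
  fixes A :: "real^'n^'n"
  assumes "v \<in> borel_measurable borel"
  shows "(\<lambda>s. matexp ((1 - s) *\<^sub>R A) *v v s) \<in> borel_measurable borel"
proof (rule borel_measurable_continuous_Pair[where H = "\<lambda>(X :: real^'n^'n) y. X *v y"])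
  have "(\<lambda>s. (1 / fact k) *\<^sub>R matpow ((1 - s) *\<^sub>R A) k) \<in> borel_measurable borel" for k
    by (intro borel_measurable_continuous_onI continuous_intros)
  then show "(\<lambda>s. matexp ((1 - s) *\<^sub>R A)) \<in> borel_measurable borel"
    unfolding matexp_def by (rule borel_measurable_suminf)
  show "continuous_on UNIV (\<lambda>x. fst x *v (snd x :: real^'n) :: real^'n)"
    by (intro continuous_intros)
qed fact

text \<open>A class of inputs closed under linear combinations, for which the integrand of the state
  is absolutely integrable for every pair of matrices.\<close>

definition bounded_input :: "(real \<Rightarrow> real^'m) \<Rightarrow> bool" where
  "bounded_input u \<longleftrightarrow> u \<in> borel_measurable borel \<and> (\<exists>M. \<forall>s. norm (u s) \<le> M)"

lemma absolutely_integrable_bounded_borel: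
  fixes f :: "real \<Rightarrow> real^'n"
  assumes "f \<in> borel_measurable borel" "\<And>s. s \<in> {0..1} \<Longrightarrow> norm (f s) \<le> M"
  shows "f absolutely_integrable_on {0..1}"
  unfolding set_integrable_def
proof (rule integrableI_bounded_set_indicator)
  show "f \<in> borel_measurable lebesgue"
    using assms(1) by (simp add: measurable_completion)
  show "AE x in lebesgue. x \<in> {0..1} \<longrightarrow> norm (f x) \<le> M" using assms(2) by simp
qed auto

lemma bounded_input_absolutely_integrable: "bounded_input u \<Longrightarrow> u absolutely_integrable_on {0..1}"
  unfolding bounded_input_def using absolutely_integrable_bounded_borel by blast

lemma bounded_input_integrand:
  fixes A :: "real^'n^'n" and B :: "real^'m^'n"
  assumes "bounded_input u"
  shows "(\<lambda>s. matexp ((1 - s) *\<^sub>R A) *v (B *v u s)) absolutely_integrable_on {0..1}"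
proof -
  obtain M where M: "\<And>s. norm (u s) \<le> M" and u: "u \<in> borel_measurable borel"
    using assms by (auto simp: bounded_input_def)
  show ?thesis
  proof (rule absolutely_integrable_bounded_borel)
    have "continuous_on UNIV ((*v) B)" by (intro continuous_intros)
    then have "(\<lambda>s. B *v u s) \<in> borel_measurable borel"
      using u by (rule borel_measurable_continuous_on)
    then show "(\<lambda>s. matexp ((1 - s) *\<^sub>R A) *v (B *v u s)) \<in> borel_measurable borel"
      by (rule measurable_matexp_mult_vector)
    fix s :: real assume s: "s \<in> {0..1}"
    have "norm (matexp ((1 - s) *\<^sub>R A) *v (B *v u s)) \<le> exp (entry_sum A) * norm (B *v u s)"
      using matexp_taylor[of "1 - s" A "entry_sum A" "B *v u s" 0] s by simp
    also have "\<dots> \<le> exp (entry_sum A) * (entry_sum B * norm (u s))"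
      by (intro mult_left_mono norm_matrix_vector_mult_le) auto
    also have "\<dots> \<le> exp (entry_sum A) * (entry_sum B * M)"
      by (intro mult_left_mono M entry_sum_nonneg) auto
    finally show "norm (matexp ((1 - s) *\<^sub>R A) *v (B *v u s)) \<le> exp (entry_sum A) * (entry_sum B * M)" .
  qed
qed

lemma bounded_input_linear:
  assumes "bounded_input u" "bounded_input w"
  shows "bounded_input (\<lambda>s. c *\<^sub>R u s + w s)"
    and "phi_continuous A B (\<lambda>s. c *\<^sub>R u s + w s) 1 = c *\<^sub>R phi_continuous A B u 1 + phi_continuous A B w 1"
proof -
  obtain M N where MN: "\<And>s. norm (u s) \<le> M" "\<And>s. norm (w s) \<le> N"
    using assms unfolding bounded_input_def by blast
  have "norm (c *\<^sub>R u s + w s) \<le> \<bar>c\<bar> * M + N" for s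
    using norm_triangle_mono[of "c *\<^sub>R u s" "\<bar>c\<bar> * M" "w s" N] MN by (simp add: mult_left_mono)
  then show "bounded_input (\<lambda>s. c *\<^sub>R u s + w s)"
    using assms unfolding bounded_input_def by (intro conjI) (auto intro!: borel_measurable_add borel_measurable_scaleR)
  have "matexp ((1 - s) *\<^sub>R A) *v (B *v (c *\<^sub>R u s + w s)) =
      c *\<^sub>R (matexp ((1 - s) *\<^sub>R A) *v (B *v u s)) + matexp ((1 - s) *\<^sub>R A) *v (B *v w s)" for s
    by (simp add: matrix_vector_right_distrib matrix_vector_mult_scaleR)
  then show "phi_continuous A B (\<lambda>s. c *\<^sub>R u s + w s) 1 = c *\<^sub>R phi_continuous A B u 1 + phi_continuous A B w 1"
    unfolding phi_continuous_def
    using bounded_input_integrand[OF assms(1), of A B] bounded_input_integrand[OF assms(2), of A B]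
    by (simp add: set_integral_add set_integrable_scaleR_right)
qed

text \<open>Membership in the uniform closure over \<open>P\<close> of the states reached by common
  inputs. The final time is fixed at 1 so that inputs can be superposed.\<close>

definition approx_reachable ::
    "real set \<Rightarrow> (real \<Rightarrow> real^'n^'n) \<Rightarrow> (real \<Rightarrow> real^'m^'n) \<Rightarrow> (real \<Rightarrow> real^'n) \<Rightarrow> bool" where
  "approx_reachable P A B F \<longleftrightarrow>
     (\<forall>e>0. \<exists>u. bounded_input u \<and> (\<forall>\<theta>\<in>P. norm (phi_continuous (A \<theta>) (B \<theta>) u 1 - F \<theta>) \<le> e))"

lemma approx_reachable_limit:
  assumes "\<And>e. e > 0 \<Longrightarrow> \<exists>G. approx_reachable P A B G \<and> (\<forall>\<theta>\<in>P. norm (G \<theta> - F \<theta>) \<le> e)"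
  shows "approx_reachable P A B F"
  unfolding approx_reachable_def
proof (intro allI impI)
  fix e :: real assume "e > 0"
  then obtain G where G: "approx_reachable P A B G" "\<And>\<theta>. \<theta> \<in> P \<Longrightarrow> norm (G \<theta> - F \<theta>) \<le> e / 2"
    using assms[of "e / 2"] by auto
  then obtain u where u: "bounded_input u" "\<And>\<theta>. \<theta> \<in> P \<Longrightarrow> norm (phi_continuous (A \<theta>) (B \<theta>) u 1 - G \<theta>) \<le> e / 2"
    using \<open>e > 0\<close> unfolding approx_reachable_def by (meson half_gt_zero)
  have "norm (phi_continuous (A \<theta>) (B \<theta>) u 1 - F \<theta>) \<le> e" if "\<theta> \<in> P" for \<theta>
    using norm_triangle_ineq[of "phi_continuous (A \<theta>) (B \<theta>) u 1 - G \<theta>" "G \<theta> - F \<theta>"] u(2)[OF that] G(2)[OF that] by simp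
  then show "\<exists>u. bounded_input u \<and> (\<forall>\<theta>\<in>P. norm (phi_continuous (A \<theta>) (B \<theta>) u 1 - F \<theta>) \<le> e)"
    using u(1) by blast
qed

lemma approx_reachable_linear:
  assumes F: "approx_reachable P A B F" and G: "approx_reachable P A B G"
  shows "approx_reachable P A B (\<lambda>\<theta>. c *\<^sub>R F \<theta> + G \<theta>)"
  unfolding approx_reachable_def
proof (intro allI impI)
  fix e :: real assume e: "e > 0"
  define a where "a = e / (2 * (\<bar>c\<bar> + 1))"
  have a: "a > 0" "\<bar>c\<bar> * a \<le> e / 2" using e by (auto simp: a_def field_simps)
  obtain u where u: "bounded_input u" "\<And>\<theta>. \<theta> \<in> P \<Longrightarrow> norm (phi_continuous (A \<theta>) (B \<theta>) u 1 - F \<theta>) \<le> a"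
    using F a unfolding approx_reachable_def by blast
  obtain w where w: "bounded_input w" "\<And>\<theta>. \<theta> \<in> P \<Longrightarrow> norm (phi_continuous (A \<theta>) (B \<theta>) w 1 - G \<theta>) \<le> e / 2"
    using G e unfolding approx_reachable_def by (meson half_gt_zero)
  show "\<exists>u. bounded_input u \<and> (\<forall>\<theta>\<in>P. norm (phi_continuous (A \<theta>) (B \<theta>) u 1 - (c *\<^sub>R F \<theta> + G \<theta>)) \<le> e)"
  proof (intro exI[of _ "\<lambda>s. c *\<^sub>R u s + w s"] conjI ballI bounded_input_linear(1) u w)
    fix \<theta> assume \<theta>: "\<theta> \<in> P"
    let ?u = "phi_continuous (A \<theta>) (B \<theta>) u 1 - F \<theta>" and ?w = "phi_continuous (A \<theta>) (B \<theta>) w 1 - G \<theta>"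
    have "phi_continuous (A \<theta>) (B \<theta>) (\<lambda>s. c *\<^sub>R u s + w s) 1 - (c *\<^sub>R F \<theta> + G \<theta>) = c *\<^sub>R ?u + ?w"
      unfolding bounded_input_linear(2)[OF u(1) w(1)] by (simp add: scaleR_diff_right)
    moreover have "norm (c *\<^sub>R ?u) \<le> \<bar>c\<bar> * a" using u(2)[OF \<theta>] by (simp add: mult_left_mono)
    moreover have "norm (c *\<^sub>R ?u + ?w) \<le> norm (c *\<^sub>R ?u) + norm ?w" by (rule norm_triangle_ineq)
    ultimately show "norm (phi_continuous (A \<theta>) (B \<theta>) (\<lambda>s. c *\<^sub>R u s + w s) 1 - (c *\<^sub>R F \<theta> + G \<theta>)) \<le> e"
      using a(2) w(2)[OF \<theta>] by (simp only:)
  qed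
qed

lemma approx_reachable_0: "approx_reachable P A B (\<lambda>\<theta>. 0)"
proof -
  have "bounded_input (\<lambda>s. 0 :: real^'b)" by (auto simp: bounded_input_def)
  moreover have "phi_continuous A B (\<lambda>s. 0) 1 = 0" for A :: "real^'a^'a" and B :: "real^'b^'a"
    by (simp add: phi_continuous_def set_lebesgue_integral_def)
  ultimately show ?thesis unfolding approx_reachable_def by (metis diff_self norm_zero less_imp_le)
qed

lemma approx_reachable_sum:
  assumes "\<And>i. i \<in> I \<Longrightarrow> approx_reachable P A B (F i)"
  shows "approx_reachable P A B (\<lambda>\<theta>. \<Sum>i\<in>I. c i *\<^sub>R F i \<theta>)"
  using assms
  by (induction I rule: infinite_finite_induct) (auto intro: approx_reachable_0 approx_reachable_linear)

text \<open>During the pulse the remaining time 1 - s runs through an interval of length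
  \<open>t\<close>. Integrating the Taylor expansion of the exponential term by term raises each
  power by one, and the remainder gains the factor \<open>t\<close>.\<close>

lemma phi_continuous_final_pulse:
  fixes A :: "real^'n^'n" and B :: "real^'m^'n" and u :: "real \<Rightarrow> real^'m" and j :: 'm
  assumes t: "0 < t" "t \<le> 1" and M: "entry_sum A \<le> M"
  defines "u \<equiv> \<lambda>s. indicator {1 - t..1} s *\<^sub>R axis j 1"
  shows "bounded_input u"
    and "norm (phi_continuous A B u 1 - (\<Sum>i<k. (t ^ Suc i / fact (Suc i)) *\<^sub>R (matpow A i *v column j B)))
      \<le> t ^ Suc k * exp M * norm (column j B)"
proof -
  have "norm (u s) \<le> 1" for s by (auto simp: u_def indicator_def)
  moreover have "u \<in> borel_measurable borel" unfolding u_def by (intro borel_measurable_scaleR) auto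
  ultimately show "bounded_input u" unfolding bounded_input_def by blast
  let ?b = "column j B"
  let ?g = "\<lambda>s. matexp ((1 - s) *\<^sub>R A) *v ?b"
  have sub: "{1 - t..1} \<subseteq> {0..1}" using t by auto
  have "?g absolutely_integrable_on {0..1}"
  proof (rule absolutely_integrable_bounded_borel)
    show "?g \<in> borel_measurable borel" by (rule measurable_matexp_mult_vector) simp
    show "norm (?g s) \<le> exp M * norm ?b" if "s \<in> {0..1}" for s
      using matexp_taylor[of "1 - s" A M ?b 0] M that by simp
  qed
  from set_integrable_subset[OF this _ sub]
  have int: "?g absolutely_integrable_on {1 - t..1}"
    by simp
  have "indicator {0..1} s *\<^sub>R (matexp ((1 - s) *\<^sub>R A) *v (B *v u s)) = indicator {1 - t..1} s *\<^sub>R ?g s" for s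
    using sub by (auto simp: u_def indicator_def matrix_vector_mult_basis)
  then have "phi_continuous A B u 1 = (LINT s:{1 - t..1}|lebesgue. ?g s)"
    unfolding phi_continuous_def set_lebesgue_integral_def by simp
  also have "\<dots> = integral {1 - t..1} ?g" using int by (rule set_lebesgue_integral_eq_integral)
  finally have phi: "(?g has_integral phi_continuous A B u 1) {1 - t..1}"
    using set_lebesgue_integral_eq_integral(1)[OF int] by (simp add: has_integral_integral)
  have mono: "((\<lambda>s. (1 - s) ^ i / fact i) has_integral t ^ Suc i / fact (Suc i)) {1 - t..1}" for i
  proof -
    have "((\<lambda>s. (1 - s) ^ i / fact i) has_integral
        (- ((1 - 1) ^ Suc i / fact (Suc i)) - - ((1 - (1 - t)) ^ Suc i / fact (Suc i)))) {1 - t..1}"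
    proof (rule fundamental_theorem_of_calculus)
      fix s :: real
      have "((\<lambda>s. - ((1 - s) ^ Suc i / fact (Suc i))) has_real_derivative
          real (Suc i) * (1 - s) ^ i / fact (Suc i)) (at s within {1 - t..1})"
        by (auto intro!: derivative_eq_intros simp del: power_Suc fact_Suc of_nat_Suc)
      moreover have "real (Suc i) * (1 - s) ^ i / fact (Suc i) = (1 - s) ^ i / fact i"
        by (simp only: fact_Suc) (simp del: of_nat_Suc)
      ultimately have "((\<lambda>s. - ((1 - s) ^ Suc i / fact (Suc i))) has_real_derivative (1 - s) ^ i / fact i) (at s within {1 - t..1})"
        by (simp only:)
      then show "((\<lambda>s. - ((1 - s) ^ Suc i / fact (Suc i))) has_vector_derivative (1 - s) ^ i / fact i) (at s within {1 - t..1})"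
        by (rule has_real_derivative_iff_has_vector_derivative[THEN iffD1])
    qed (use t in auto)
    then show ?thesis by simp
  qed
  have "((\<lambda>s. \<Sum>i<k. ((1 - s) ^ i / fact i) *\<^sub>R (matpow A i *v ?b)) has_integral
      (\<Sum>i<k. (t ^ Suc i / fact (Suc i)) *\<^sub>R (matpow A i *v ?b))) {1 - t..1}"
    by (intro has_integral_sum has_integral_scaleR_left mono) auto
  note diff = has_integral_diff[OF phi this]
  have "norm (phi_continuous A B u 1 - (\<Sum>i<k. (t ^ Suc i / fact (Suc i)) *\<^sub>R (matpow A i *v ?b)))
      \<le> (t ^ k * exp M * norm ?b) * measure lborel {1 - t..1}"
  proof (rule has_integral_bound_real[OF _ finite.emptyI diff])
    fix s assume s: "s \<in> {1 - t..1} - {}"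
    have "norm (?g s - (\<Sum>i<k. ((1 - s) ^ i / fact i) *\<^sub>R (matpow A i *v ?b))) \<le> (1 - s) ^ k * exp M * norm ?b"
      using s t by (intro matexp_taylor M) auto
    also have "\<dots> \<le> t ^ k * exp M * norm ?b" using s t by (intro mult_right_mono power_mono) auto
    finally show "norm (?g s - (\<Sum>i<k. ((1 - s) ^ i / fact i) *\<^sub>R (matpow A i *v ?b))) \<le> t ^ k * exp M * norm ?b" .
  qed (use t in auto)
  also have "\<dots> = t ^ Suc k * exp M * norm ?b" using t by simp
  finally show "norm (phi_continuous A B u 1 - (\<Sum>i<k. (t ^ Suc i / fact (Suc i)) *\<^sub>R (matpow A i *v ?b)))
      \<le> t ^ Suc k * exp M * norm ?b" .
qed

text \<open>A pulse of length \<open>t\<close> before the final time reaches \<open>\<Sum>i. t\<^sup>i\<^sup>+\<^sup>1 / (i + 1)! A\<^sup>i b\<close>. Once the terms with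
  \<open>i < k\<close> are known to be approximable, subtracting them and letting \<open>t \<rightarrow> 0\<close> yields \<open>A\<^sup>k b\<close>.\<close>

lemma approx_reachable_matpow_column:
  fixes A :: "real \<Rightarrow> real^'n^'n" and B :: "real \<Rightarrow> real^'m^'n"
  assumes P: "compact P" and A: "continuous_on P A" and B: "continuous_on P B"
  shows "approx_reachable P A B (\<lambda>\<theta>. matpow (A \<theta>) k *v column j (B \<theta>))"
proof (induction k rule: less_induct)
  case (less k)
  obtain M where M: "\<And>\<theta>. \<theta> \<in> P \<Longrightarrow> entry_sum (A \<theta>) \<le> M"
    using compact_bounded_function[OF P continuous_on_entry_sum[OF A]] by (metis abs_ge_self order_trans real_norm_def)
  obtain b where b: "b > 0" "\<And>\<theta>. \<theta> \<in> P \<Longrightarrow> norm (column j (B \<theta>)) \<le> b"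
    using compact_bounded_function[OF P continuous_on_column[OF B]] by metis
  show ?case
  proof (rule approx_reachable_limit)
    fix e :: real assume e: "e > 0"
    \<comment> \<open>With the scaling \<open>c\<close> below, the remainder becomes
      \<open>c * t ^ (k + 2) * exp M * b\<close>, which equals \<open>t * D\<close>; the choice of
      \<open>t\<close> makes this at most \<open>e\<close>.\<close>
    define D where "D = fact (Suc k) * (exp M * b)"
    have D: "D > 0" using b by (simp add: D_def)
    define t where "t = min 1 (e / D)"
    have t: "0 < t" "t \<le> 1" "t * D \<le> e" using e D by (auto simp: t_def min_def field_simps)
    \<comment> \<open>The scaling turns the coefficient of the k-th power in the response to the
      pulse into 1.\<close>
    define c where "c = fact (Suc k) / t ^ Suc k"
    have c: "c > 0" using t by (simp add: c_def)
    define u :: "real \<Rightarrow> real^'m" where "u = (\<lambda>s. indicator {1 - t..1} s *\<^sub>R axis j 1)"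
    have u: "bounded_input u" unfolding u_def by (rule phi_continuous_final_pulse(1)[OF t(1,2) order_refl])
    let ?S = "\<lambda>k \<theta>. \<Sum>i<k. (t ^ Suc i / fact (Suc i)) *\<^sub>R (matpow (A \<theta>) i *v column j (B \<theta>))"
    have 1: "approx_reachable P A B (\<lambda>\<theta>. phi_continuous (A \<theta>) (B \<theta>) u 1)"
      unfolding approx_reachable_def using u by (metis diff_self norm_zero less_imp_le)
    have 2: "approx_reachable P A B (?S k)"
      by (intro approx_reachable_sum less.IH) auto
    have "approx_reachable P A B (\<lambda>\<theta>. c *\<^sub>R ((- 1) *\<^sub>R ?S k \<theta> + phi_continuous (A \<theta>) (B \<theta>) u 1) + 0)"
      by (intro approx_reachable_linear 1 2 approx_reachable_0)
    moreover have "norm (c *\<^sub>R ((- 1) *\<^sub>R ?S k \<theta> + phi_continuous (A \<theta>) (B \<theta>) u 1) + 0 - matpow (A \<theta>) k *v column j (B \<theta>)) \<le> e"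
      if \<theta>: "\<theta> \<in> P" for \<theta>
    proof -
      have ct: "c * (t ^ Suc k / fact (Suc k)) = 1" using t by (simp add: c_def)
      have "c *\<^sub>R ((- 1) *\<^sub>R ?S k \<theta> + phi_continuous (A \<theta>) (B \<theta>) u 1) + 0 - matpow (A \<theta>) k *v column j (B \<theta>) =
          c *\<^sub>R (phi_continuous (A \<theta>) (B \<theta>) u 1 - ?S (Suc k) \<theta>)"
      proof -
        let ?w = "matpow (A \<theta>) k *v column j (B \<theta>)"
        have "c *\<^sub>R (phi_continuous (A \<theta>) (B \<theta>) u 1 - ?S (Suc k) \<theta>) =
            c *\<^sub>R (phi_continuous (A \<theta>) (B \<theta>) u 1 - ?S k \<theta>) - (c * (t ^ Suc k / fact (Suc k))) *\<^sub>R ?w"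
          by (simp only: sum.lessThan_Suc diff_diff_eq[symmetric] scaleR_diff_right scaleR_scaleR)
        then show ?thesis unfolding ct by simp
      qed
      also have "norm \<dots> \<le> c * (t ^ Suc (Suc k) * exp M * norm (column j (B \<theta>)))"
        using phi_continuous_final_pulse(2)[OF t(1,2) M[OF \<theta>], where j = j and B = "B \<theta>" and k = "Suc k"] c
        by (simp add: u_def mult_left_mono del: power_Suc sum.lessThan_Suc fact_Suc)
      also have "\<dots> \<le> c * (t ^ Suc (Suc k) * exp M * b)"
        using b(2)[OF \<theta>] c t by (intro mult_left_mono) auto
      also have "\<dots> = t * D" using t by (simp add: c_def D_def)
      finally show ?thesis using t(3) by simp
    qed
    ultimately show "\<exists>G. approx_reachable P A B G \<and> (\<forall>\<theta>\<in>P. norm (G \<theta> - matpow (A \<theta>) k *v column j (B \<theta>)) \<le> e)"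
      by blast
  qed
qed

lemma approx_reachable_poly_apply:
  fixes A :: "real \<Rightarrow> real^'n^'n" and B :: "real \<Rightarrow> real^'m^'n"
  assumes "compact P" "continuous_on P A" "continuous_on P B"
  shows "approx_reachable P A B (\<lambda>\<theta>. \<Sum>j\<in>UNIV. poly_apply (Q j) (A \<theta>) (column j (B \<theta>)))"
proof -
  have "approx_reachable P A B (\<lambda>\<theta>. \<Sum>k<Suc (degree (Q j)). coeff (Q j) k *\<^sub>R (matpow (A \<theta>) k *v column j (B \<theta>)))" for j
    by (intro approx_reachable_sum approx_reachable_matpow_column assms)
  moreover have "poly_apply (Q j) (A \<theta>) v = (\<Sum>k<Suc (degree (Q j)). coeff (Q j) k *\<^sub>R (matpow (A \<theta>) k *v v))" for j \<theta> v
    by (subst poly_apply_eq_sum[where T = "Suc (degree (Q j))"])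
      (auto simp: coeff_eq_0 scalar_mult_eq_scaleR)
  ultimately have "approx_reachable P A B (\<lambda>\<theta>. poly_apply (Q j) (A \<theta>) (column j (B \<theta>)))" for j
    by simp
  from approx_reachable_sum[of UNIV P A B "\<lambda>j \<theta>. poly_apply (Q j) (A \<theta>) (column j (B \<theta>))" "\<lambda>_. 1", OF this]
  show ?thesis by simp
qed

lemma (in simple_disjoint_spectra) uniformly_ensemble_controllable_continuous:
  fixes B :: "real \<Rightarrow> real^'m^'n"
  assumes B: "continuous_on P B" and reach: "\<And>\<theta>. \<theta> \<in> P \<Longrightarrow> reachable (A \<theta>) (B \<theta>)"
  shows "uniformly_ensemble_controllable_continuous P A B"
  unfolding uniformly_ensemble_controllable_continuous_def
proof (intro allI impI)
  fix x :: "real \<Rightarrow> real^'n" and \<epsilon> :: real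
  assume x: "continuous_on P x" and \<epsilon>: "\<epsilon> > 0"
  have "approx_reachable P A B x"
  proof (rule approx_reachable_limit)
    fix e :: real assume "e > 0"
    then obtain Q :: "'m \<Rightarrow> real poly" where
      "\<And>\<theta>. \<theta> \<in> P \<Longrightarrow> norm ((\<Sum>j\<in>UNIV. poly_apply (Q j) (A \<theta>) (column j (B \<theta>))) - x \<theta>) \<le> e"
      using poly_apply_approximation[OF B x reach] by blast
    then show "\<exists>G. approx_reachable P A B G \<and> (\<forall>\<theta>\<in>P. norm (G \<theta> - x \<theta>) \<le> e)"
      using approx_reachable_poly_apply[OF compact_P continuous_A B] by blast
  qed
  then obtain u where u: "bounded_input u" "\<And>\<theta>. \<theta> \<in> P \<Longrightarrow> norm (phi_continuous (A \<theta>) (B \<theta>) u 1 - x \<theta>) \<le> \<epsilon> / 2"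
    using \<epsilon> unfolding approx_reachable_def by (meson half_gt_zero)
  show "\<exists>T>0. \<exists>u. u absolutely_integrable_on {0..T} \<and>
      (SUP \<theta>\<in>P. ereal (norm (phi_continuous (A \<theta>) (B \<theta>) u T - x \<theta>))) < ereal \<epsilon>"
    using bounded_input_absolutely_integrable[OF u(1)] u(2) \<epsilon>
    by (intro exI[of _ 1] conjI exI[of _ u] SUP_norm_less) auto
qed

theorem theorem2:
  fixes P :: "real set" and I :: "real set set"
    and A :: "real \<Rightarrow> real^'n^'n"
    and B :: "real \<Rightarrow> real^('m::{finite,linorder})^'n"
  assumes "finite I" and "disjoint I"
    and "\<And>J. J \<in> I \<Longrightarrow> \<exists>a b. a \<le> b \<and> J = {a..b}"
    and "P = \<Union> I" and "P \<noteq> {}" and "closure (interior P) = P"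
    and "continuous_on P A" and "continuous_on P B"
    and "\<And>\<theta>. \<theta> \<in> P \<Longrightarrow> reachable (A \<theta>) (B \<theta>)"
    and "\<And>i \<theta> \<theta>'. \<theta> \<in> P \<Longrightarrow> \<theta>' \<in> P \<Longrightarrow>
           hermite_index (A \<theta>) (B \<theta>) i = hermite_index (A \<theta>') (B \<theta>') i"
    and "\<And>\<theta> \<theta>'. \<theta> \<in> P \<Longrightarrow> \<theta>' \<in> P \<Longrightarrow> \<theta> \<noteq> \<theta>' \<Longrightarrow>
           spectrum (A \<theta>) \<inter> spectrum (A \<theta>') = {}"
    and "\<And>\<theta> l. \<theta> \<in> P \<Longrightarrow> l \<in> spectrum (A \<theta>) \<Longrightarrow> alg_mult (A \<theta>) l = 1"
  shows "uniformly_ensemble_controllable_continuous P A B \<and>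
         uniformly_ensemble_controllable_discrete P A B"
proof -
  have "compact J" if "J \<in> I" for J using assms(3)[OF that] by auto
  then have "compact P" using assms(1,4) by (auto intro: compact_Union)
  then interpret simple_disjoint_spectra P A
    using assms by unfold_locales auto
  show ?thesis
    using uniformly_ensemble_controllable_continuous uniformly_ensemble_controllable_discrete assms(8,9) by blast
qed

end
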